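(* Consider the LPSA iterates described in the context with $\eta_n=\eta_0n^{-\alpha}$, $p_n=\min\{\gamma\eta_n^\beta,1\}$, where $\gamma>0$, $0<\alpha\le1$, $\beta\in(1/2,1)$ and $\eta_0>2\cdot\mathbb{1}_{\{\alpha=1\}}/\mu$ (and $\eta_0>0$). Assume: (1) $\|\nabla f(x)-\nabla f(y)\|\le L\|x-y\|$ for all $x,y$; (2) $f$ is $\mu$-strongly convex, $\mu>0$; (3) $\|\nabla^2f(x)-\nabla^2f(y)\|\le\tilde L\|x-y\|$ for all $x,y$; (4) $\|\Sigma(x)-\Sigma(y)\|\le L\|x-y\|$ for all $x,y$; (5) there is $q>2$ with $\sup_n\mathbb{E}\|\xi_n\|^q<\infty$. Let $$m=\frac1\gamma\Big\{P_{A^\perp}\Big(\nabla^2f(x^\star)-\tfrac{1-\beta}{\eta_0}\mathbb{1}_{\{\alpha=1\}}I_d\Big)P_{A^\perp}\Big\}^{\dagger}\,P_{A^\perp}\nabla^2f(x^\star)\nabla f(x^\star),$$ where $G^\dagger$ denotes the pseudoinverse of the symmetric matrix $G$, and assume $m\ne0$. Then, with $u_n=P_{A^\perp}x_n$, the sequence $\hat u_n=\eta_{n-1}^{-(1-\beta)}(u_n-x^\star)$ converges to $m$ in $L_2$, i.e. $\mathbb{E}\|\hat u_n-m\|^2\to0$ as $n\to\infty$.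
   Context: Setting (LPSA, loopless projected stochastic approximation). Let $A$ be a real matrix with $d$ rows; $P_A$ is the orthogonal projection of $\mathbb{R}^d$ onto the column space of $A$, and $P_{A^\perp}=I_d-P_A$ the orthogonal projection onto the null space of $A^\top$. Let $\mathcal D$ be a probability distribution, $f(x)=\mathbb{E}_{\zeta\sim\mathcal D}f(x,\zeta)$, with $\mathbb{E}_{\zeta\sim\mathcal D}\nabla f(x,\zeta)=\nabla f(x)$ (gradients in $x$). Let $x^\star$ be the unique minimizer of $f$ over $\{x\in\mathbb{R}^d: A^\top x=0\}$. Starting from a deterministic point $x_1$, for $n\ge 1$ sample $\zeta_n\sim\mathcal D$ and $\omega_n\sim\mathrm{Bernoulli}(p_n)$ (all independent), set $x_{n+1/2}=x_n-\eta_n\nabla f(x_n,\zeta_n)$, and set $x_{n+1}=P_{A^\perp}x_{n+1/2}$ if $\omega_n=1$, $x_{n+1}=x_{n+1/2}$ if $\omega_n=0$. The gradient noise is $\xi_n=\nabla f(x_n)-\nabla f(x_n,\zeta_n)$, a martingale difference with respect to $\mathcal F_n=\sigma(\zeta_k,\omega_k:k<n)$, and $\mathbb{E}[\xi_n\xi_n^\top\mid\mathcal F_n]=\Sigma(x_n)$, where $\Sigma(x)$ is the covariance matrix of $\nabla f(x,\zeta)$, $\zeta\sim\mathcal D$. $\|\cdot\|$ is the Euclidean norm for vectors and the spectral norm for matrices. *)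

theory Defs
  imports "HOL-Probability.Probability"
begin

text \<open>The matrix of the orthogonal projection onto \<open>S\<close>; it is meaningful when \<open>S\<close> is a
  linear subspace.\<close>

definition orth_proj :: "(real^'d) set \<Rightarrow> real^'d^'d" where
  "orth_proj S = matrix (\<lambda>x. THE y. y \<in> S \<and> (\<forall>z\<in>S. orthogonal (x - y) z))"

definition col_proj :: "real^'k^'d \<Rightarrow> real^'d^'d" where
  "col_proj A = orth_proj (span (columns A))"

definition perp_proj :: "real^'k^'d \<Rightarrow> real^'d^'d" where
  "perp_proj A = mat 1 - col_proj A"

text \<open>The Moore--Penrose inverse, characterised by the four Penrose equations.\<close>

definition pseudo_inverse :: "real^'n^'m \<Rightarrow> real^'m^'n" where
  "pseudo_inverse G = (THE X. G ** X ** G = G \<and> X ** G ** X = X \<and>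
     transpose (G ** X) = G ** X \<and> transpose (X ** G) = X ** G)"

definition spectral_norm :: "real^'n^'m \<Rightarrow> real" where
  "spectral_norm G = onorm (\<lambda>v. G *v v)"

definition strongly_convex :: "real \<Rightarrow> ('a::real_normed_vector \<Rightarrow> real) \<Rightarrow> bool" where
  "strongly_convex \<mu> f \<longleftrightarrow> (\<forall>x y. \<forall>t\<in>{0..1}.
     f (t *\<^sub>R x + (1 - t) *\<^sub>R y)
       \<le> t * f x + (1 - t) * f y - \<mu> / 2 * t * (1 - t) * (norm (x - y))\<^sup>2)"

text \<open>The Bochner integrals below are \<open>0\<close> for non-integrable integrands, so this is the covariance
  matrix only for square-integrable \<open>Y\<close>.\<close>

definition cov_matrix :: "'z measure \<Rightarrow> ('z \<Rightarrow> real^'d) \<Rightarrow> real^'d^'d" where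
  "cov_matrix D Y = (\<chi> i j. LINT z|D.
     (Y z $ i - (LINT z'|D. Y z' $ i)) * (Y z $ j - (LINT z'|D. Y z' $ j)))"

definition lpsa_eta :: "real \<Rightarrow> real \<Rightarrow> nat \<Rightarrow> real" where
  "lpsa_eta \<eta>0 \<alpha> n = \<eta>0 * real n powr (- \<alpha>)"

definition lpsa_prob :: "real \<Rightarrow> real \<Rightarrow> real \<Rightarrow> real \<Rightarrow> nat \<Rightarrow> real" where
  "lpsa_prob \<gamma> \<eta>0 \<alpha> \<beta> n = min (\<gamma> * lpsa_eta \<eta>0 \<alpha> n powr \<beta>) 1"

text \<open>The limit point \<open>m\<close>; the last two arguments are the gradient and the Hessian of the
  objective at its constrained minimiser.\<close>

definition lpsa_limit ::
    "real^'k^'d \<Rightarrow> real \<Rightarrow> real \<Rightarrow> real \<Rightarrow> real \<Rightarrow> real^'d \<Rightarrow> real^'d^'d \<Rightarrow> real^'d" where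
  "lpsa_limit A \<gamma> \<eta>0 \<alpha> \<beta> g H = (1 / \<gamma>) *\<^sub>R
     (pseudo_inverse (perp_proj A ** (H - mat ((1 - \<beta>) / \<eta>0 * of_bool (\<alpha> = 1))) ** perp_proj A)
        ** perp_proj A ** H *v g)"

text \<open>Mutual independence of all samples \<open>\<zeta>\<^sub>n\<close> and \<open>\<omega>\<^sub>n\<close> with \<open>n \<ge> 1\<close>. It is expressed through the
  generated families of events because the two kinds of variables have different value types, which
  \<^const>\<open>prob_space.indep_vars\<close> does not admit.\<close>

definition lpsa_indep ::
    "'w measure \<Rightarrow> 'z measure \<Rightarrow> (nat \<Rightarrow> 'w \<Rightarrow> 'z) \<Rightarrow> (nat \<Rightarrow> 'w \<Rightarrow> bool) \<Rightarrow> bool" where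
  "lpsa_indep M D \<zeta> \<omega> \<longleftrightarrow> prob_space.indep_sets M
     (case_sum (\<lambda>n. {\<zeta> n -` S \<inter> space M |S. S \<in> sets D})
               (\<lambda>n. {\<omega> n -` B \<inter> space M |B. B \<in> sets (count_space (UNIV :: bool set))}))
     (Inl ` {1..} \<union> Inr ` {1..})"

end

theory Submission
  imports Defs "HOL-Real_Asymp.Real_Asymp"
begin

text \<open>
  Let \<open>P\<close> be the projection, \<open>g\<close> the gradient, \<open>xs\<close> the constrained minimiser and \<open>H\<close> the Hessian at \<open>xs\<close>.
  Split an iterate into its tangent component, in the null space of the transpose of \<open>A\<close>, and its
  normal component, in the column space. The gradient \<open>g xs\<close> is normal because \<open>xs\<close> is a constrained
  minimiser, so between two projections the normal component collects multiples of it: to leading order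
  it is \<open>- s n *\<^sub>R g xs\<close>, where \<open>s n\<close> is the sum of the step sizes since the last projection. A projection
  has probability \<open>p n\<close>, so \<open>s n\<close> has the size \<open>\<kappa> n = \<eta> n / p n = \<eta> n powr (1 - \<beta>) / \<gamma>\<close>, both in the
  mean and in its fluctuations. But \<open>s\<close> forgets its past after about \<open>1 / p n\<close> steps, whereas the tangent
  component moves on the time scale \<open>1 / \<eta> n\<close>, which is much longer. The tangent component therefore
  feels only the mean of \<open>s\<close>: its deviation \<open>u\<close> from \<open>xs\<close> follows a linear recursion with drift
  \<open>- \<eta> n *\<^sub>R (P (H u) - \<kappa> n *\<^sub>R h)\<close>, where \<open>h = P (H (g xs))\<close>. At the scale
  \<open>\<rho> n = \<eta> (n - 1) powr (1 - \<beta>)\<close> its equilibrium is \<open>m\<close>; for \<open>\<alpha> = 1\<close> the relative change of the scale in one step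
  is comparable with \<open>\<eta> n\<close> and shifts the Hessian by a multiple of the identity.

  To make this rigorous, the iterate is compared with the random point
  \<open>xs + \<rho> n *\<^sub>R m - (\<kappa> n * s n) *\<^sub>R h - s n *\<^sub>R g xs\<close>. The third term is a corrector, obtained from the
  Poisson equation of the Markov chain \<open>s\<close>: its expected change in one step turns the random forcing
  \<open>(\<eta> n * s n) *\<^sub>R h\<close> into its mean, up to a martingale increment of variance of order \<open>\<eta> n * \<kappa> n ^ 3\<close>
  (\<open>mean_tangent_step\<close>, \<open>V_after_step\<close>).

  If \<open>a\<close> and \<open>b\<close> are the tangent and normal components of the difference, the Lyapunov function
  \<open>V = (norm a)\<^sup>2 + K * \<kappa> n * (norm b)\<^sup>2\<close> contracts in the mean (\<open>averaged_drift\<close>): strong convexity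
  contracts \<open>a\<close> at a rate of order \<open>\<eta> n\<close>, and the projections contract \<open>b\<close> at the much larger rate \<open>p n\<close>.
  The remainder of the linearisation is quadratic in the distance from the comparison point to \<open>xs\<close>,
  so that its mean square is controlled by the fourth moment of \<open>s\<close> (\<open>fourth_moment_bound\<close>).
  The gradient noise contributes \<open>(\<eta> n)\<^sup>2\<close>, which is
  negligible against \<open>\<eta> n * (\<kappa> n)\<^sup>2\<close> since \<open>\<beta> > 1 / 2\<close>. Altogether the expectation of \<open>V\<close> satisfies
  \<open>EV (Suc n) \<le> (1 - \<mu> / 2 * \<eta> n) * EV n + \<eta> n * ((\<kappa> n)\<^sup>2 * \<epsilon> n)\<close> eventually, with \<open>\<epsilon> n\<close> tending to \<open>0\<close>
  (\<open>EV_recursion\<close>). The scale \<open>(\<kappa> n)\<^sup>2\<close> decays more slowly than this contraction, and so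
  \<open>EV n / (\<kappa> n)\<^sup>2\<close> tends to \<open>0\<close> (\<open>EV_lim\<close>). The rescaled deviation from \<open>m\<close> is
  \<open>(a - (\<kappa> n * s n) *\<^sub>R h) /\<^sub>R \<rho> n\<close>, and both of its parts tend to \<open>0\<close> in mean square.
\<close>

section \<open>Projections onto null spaces\<close>

lemma col_proj_works:
  fixes A :: "real^'k^'d"
  shows "col_proj A *v x \<in> span (columns A)"
    and "z \<in> span (columns A) \<Longrightarrow> orthogonal (x - col_proj A *v x) z"
proof -
  let ?S = "span (columns A)"
  define \<pi> where "\<pi> x = (THE y. y \<in> ?S \<and> (\<forall>z\<in>?S. orthogonal (x - y) z))" for x :: "real^'d"
  have unique: "y = y'"
    if "y \<in> ?S" "\<forall>z\<in>?S. orthogonal (x - y) z" "y' \<in> ?S" "\<forall>z\<in>?S. orthogonal (x - y') z"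
    for x y y' :: "real^'d"
  proof -
    have "y - y' \<in> ?S" using that span_diff by blast
    then have "(x - y) \<bullet> (y - y') = 0" "(x - y') \<bullet> (y - y') = 0"
      using that unfolding orthogonal_def by blast+
    then have "(y - y') \<bullet> (y - y') = 0"
      by (simp add: inner_diff_left)
    then show ?thesis by simp
  qed
  have ex: "\<exists>y. y \<in> ?S \<and> (\<forall>z\<in>?S. orthogonal (x - y) z)" for x :: "real^'d"
  proof -
    obtain y z where "y \<in> ?S" "\<And>w. w \<in> ?S \<Longrightarrow> orthogonal z w" "x = y + z"
      using orthogonal_subspace_decomp_exists[of "columns A" x] by metis
    then show ?thesis by (intro exI[of _ y]) auto
  qed
  have \<pi>: "\<pi> x \<in> ?S \<and> (\<forall>z\<in>?S. orthogonal (x - \<pi> x) z)" for x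
    unfolding \<pi>_def
    by (rule theI', rule ex_ex1I[OF ex], elim conjE, rule unique; assumption)
  have mem: "\<pi> x \<in> ?S" and orth: "z \<in> ?S \<Longrightarrow> (x - \<pi> x) \<bullet> z = 0" for x z
    using \<pi>[of x] by (simp_all add: orthogonal_def)
  have "linear \<pi>"
  proof (rule linearI)
    fix x y :: "real^'d" and c :: real
    show "\<pi> (x + y) = \<pi> x + \<pi> y"
    proof (rule unique[of _ "x + y"]; (intro ballI)?)
      fix z assume z: "z \<in> ?S"
      have "x + y - (\<pi> x + \<pi> y) = (x - \<pi> x) + (y - \<pi> y)" by simp
      then show "orthogonal (x + y - (\<pi> x + \<pi> y)) z"
        unfolding orthogonal_def by (simp only: inner_add_left orth[OF z])
      show "orthogonal (x + y - \<pi> (x + y)) z" unfolding orthogonal_def by (rule orth[OF z])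
    qed (intro mem span_add)+
    show "\<pi> (c *\<^sub>R x) = c *\<^sub>R \<pi> x"
    proof (rule unique[of _ "c *\<^sub>R x"]; (intro ballI)?)
      fix z assume z: "z \<in> ?S"
      have "c *\<^sub>R x - c *\<^sub>R \<pi> x = c *\<^sub>R (x - \<pi> x)" by (simp add: scaleR_diff_right)
      then show "orthogonal (c *\<^sub>R x - c *\<^sub>R \<pi> x) z"
        unfolding orthogonal_def by (simp only: inner_scaleR_left orth[OF z])
      show "orthogonal (c *\<^sub>R x - \<pi> (c *\<^sub>R x)) z" unfolding orthogonal_def by (rule orth[OF z])
    qed (intro mem span_scale)+
  qed
  moreover have "col_proj A = matrix \<pi>"
    unfolding col_proj_def orth_proj_def \<pi>_def ..
  ultimately have "col_proj A *v x = \<pi> x" by (simp add: matrix_works)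
  then show "col_proj A *v x \<in> ?S" "z \<in> ?S \<Longrightarrow> orthogonal (x - col_proj A *v x) z"
    using \<pi> by auto
qed

lemma perp_proj_eq: "perp_proj A *v x = x - col_proj A *v x"
  by (simp add: perp_proj_def matrix_vector_mult_diff_rdistrib)

lemma col_perp_orthogonal: "(col_proj A *v x) \<bullet> (perp_proj A *v y) = 0"
  using col_proj_works[where A = A] by (simp add: perp_proj_eq orthogonal_def inner_commute)

lemma perp_proj_self_adjoint: "(perp_proj A *v x) \<bullet> y = x \<bullet> (perp_proj A *v y)"
proof -
  have "(perp_proj A *v x) \<bullet> (perp_proj A *v y + col_proj A *v y)
      = (perp_proj A *v x + col_proj A *v x) \<bullet> (perp_proj A *v y)"
    using col_perp_orthogonal[of A x y] col_perp_orthogonal[of A y x]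
    by (simp add: inner_add_left inner_add_right inner_commute)
  then show ?thesis by (simp add: perp_proj_eq)
qed

lemma transpose_perp_proj [simp]: "transpose (perp_proj A) = perp_proj A"
proof -
  have "transpose (perp_proj A) *v x = perp_proj A *v x" for x
    by (rule vector_eq_rdot[THEN iffD1])
      (metis dot_lmul_matrix perp_proj_self_adjoint transpose_matrix_vector inner_commute)
  then show ?thesis by (simp add: matrix_eq)
qed

lemma transpose_mult_perp_proj: "transpose A *v (perp_proj A *v x) = 0"
proof -
  have "(transpose A *v (perp_proj A *v x)) \<bullet> v = 0" for v
  proof -
    have "A *v v \<in> span (columns A)"
      by (rule matrix_vector_mult_in_columnspace)
    then have "(perp_proj A *v x) \<bullet> (A *v v) = 0"
      using col_proj_works(2)[of "A *v v" A x] by (simp add: perp_proj_eq orthogonal_def)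
    then show ?thesis
      by (metis dot_lmul_matrix transpose_matrix_vector)
  qed
  then show ?thesis by (metis inner_eq_zero_iff)
qed

lemma perp_proj_fixes_kernel:
  assumes "transpose A *v x = 0"
  shows "perp_proj A *v x = x"
proof -
  have "x \<bullet> y = 0" if "y \<in> span (columns A)" for y
    using that
  proof (induction rule: span_induct_alt)
    case (step c y z)
    then obtain i where "y = column i A" by (auto simp: columns_def)
    then have "x \<bullet> y = (transpose A *v x) $ i"
      by (simp add: matrix_vector_mul_component transpose_def column_def inner_vec_def mult.commute matrix_vector_mult_def)
    with step assms show ?case by (simp add: inner_add_right)
  qed simp
  then have "x \<bullet> (col_proj A *v x) = 0" using col_proj_works(1) by blast
  moreover have "(x - col_proj A *v x) \<bullet> (col_proj A *v x) = 0"
    using col_proj_works[where A = A] by (simp add: orthogonal_def)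
  ultimately have "col_proj A *v x = 0" by (simp add: inner_diff_left)
  then show ?thesis by (simp add: perp_proj_eq)
qed

lemma perp_proj_idem: "perp_proj A *v (perp_proj A *v x) = perp_proj A *v x"
  by (rule perp_proj_fixes_kernel) (rule transpose_mult_perp_proj)

lemma perp_proj_mult_idem [simp]: "perp_proj A ** perp_proj A = perp_proj A"
  by (simp add: matrix_eq perp_proj_idem flip: matrix_vector_mul_assoc)

section \<open>Pseudoinverse of a compression\<close>

text \<open>A matrix that satisfies the four Penrose equations is the value of the definite description. Two
solutions agree because the equations determine the products \<open>G ** X\<close> and \<open>X ** G\<close>.\<close>

lemma pseudo_inverse_eqI:
  fixes G :: "real^'n^'m" and X :: "real^'m^'n"
  assumes "G ** X ** G = G" "X ** G ** X = X"
    "transpose (G ** X) = G ** X" "transpose (X ** G) = X ** G"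
  shows "pseudo_inverse G = X"
  unfolding pseudo_inverse_def
proof (rule the_equality)
  fix Y :: "real^'m^'n"
  assume Y: "G ** Y ** G = G \<and> Y ** G ** Y = Y \<and>
    transpose (G ** Y) = G ** Y \<and> transpose (Y ** G) = Y ** G"
  have "G ** X = transpose ((G ** Y) ** (G ** X))"
    using Y assms(3) by (metis matrix_mul_assoc)
  also have "\<dots> = transpose (G ** X) ** transpose (G ** Y)"
    by (rule matrix_transpose_mul)
  also have "\<dots> = G ** Y"
    using Y assms(1,3) by (metis matrix_mul_assoc)
  finally have GX: "G ** X = G ** Y" .
  have "X ** G = transpose ((X ** G) ** (Y ** G))"
    using Y assms(4) by (metis matrix_mul_assoc)
  also have "\<dots> = transpose (Y ** G) ** transpose (X ** G)"
    by (rule matrix_transpose_mul)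
  also have "\<dots> = Y ** G"
    using Y assms(1,4) by (metis matrix_mul_assoc)
  finally have XG: "X ** G = Y ** G" .
  have "Y = Y ** G ** Y" using Y by simp
  also have "\<dots> = X ** (G ** X)" using XG GX by (metis matrix_mul_assoc)
  also have "\<dots> = X" using assms(2) by (simp add: matrix_mul_assoc)
  finally show "Y = X" .
qed (use assms in auto)

text \<open>The compression \<open>G = P ** B ** P\<close> of a coercive matrix acts as an isomorphism on the range of the
orthogonal projection \<open>P\<close> and vanishes on its orthogonal complement. Its pseudoinverse is the inverse
on the range, extended by zero, so \<open>G\<close> times the pseudoinverse is \<open>P\<close>.\<close>

lemma pseudo_inverse_compression:
  fixes P B :: "real^'d^'d"
  assumes idem: "P ** P = P" and sym: "transpose P = P" and "0 < c"
    and coercive: "\<And>v. c * (norm v)\<^sup>2 \<le> (B *v v) \<bullet> v"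
  defines "G \<equiv> P ** B ** P"
  shows "P ** pseudo_inverse G = pseudo_inverse G" and "G ** pseudo_inverse G = P"
proof -
  \<comment> \<open>Adding the complementary projection makes the compression invertible.\<close>
  define T where "T = G + (mat 1 - P)"
  have self_adjoint: "(P *v u) \<bullet> v = u \<bullet> (P *v v)" for u v
    by (metis dot_lmul_matrix transpose_matrix_vector sym)
  have idem_v: "P *v (P *v u) = P *v u" for u using idem by (simp add: matrix_vector_mul_assoc)
  have inj: "v = 0" if "T *v v = 0" for v
  proof -
    have "(G *v v) \<bullet> v = (B *v (P *v v)) \<bullet> (P *v v)"
      unfolding G_def by (simp add: self_adjoint flip: matrix_vector_mul_assoc)
    moreover have "(v - P *v v) \<bullet> v = (v - P *v v) \<bullet> (v - P *v v)"
      by (simp add: inner_diff_left inner_diff_right self_adjoint idem_v)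
    moreover have "(T *v v) \<bullet> v = (G *v v) \<bullet> v + (v - P *v v) \<bullet> v"
      unfolding T_def by (simp add: matrix_vector_mult_add_rdistrib matrix_vector_mult_diff_rdistrib inner_add_left)
    ultimately have "(B *v (P *v v)) \<bullet> (P *v v) + (v - P *v v) \<bullet> (v - P *v v) = 0"
      using that by simp
    moreover have "0 \<le> c * (norm (P *v v))\<^sup>2" "0 \<le> (v - P *v v) \<bullet> (v - P *v v)"
      using \<open>0 < c\<close> by auto
    ultimately have "c * (norm (P *v v))\<^sup>2 = 0" "(v - P *v v) \<bullet> (v - P *v v) = 0"
      using coercive[of "P *v v"] by linarith+
    then show "v = 0" using \<open>0 < c\<close> by simp
  qed
  have "invertible T"
    by (metis inj matrix_left_invertible_ker invertible_left_inverse)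
  then obtain T' where T': "T ** T' = mat 1" "T' ** T = mat 1" by (auto simp: invertible_def)
  have PP [simp]: "Y ** P ** P = Y ** P" for Y :: "real^'d^'d"
    using idem by (metis matrix_mul_assoc)
  have "P ** T = G" "T ** P = G"
    unfolding T_def G_def
    by (simp_all add: matrix_eq matrix_vector_mult_add_rdistrib matrix_vector_mult_diff_rdistrib
        matrix_vector_right_distrib matrix_vector_mult_diff_distrib idem_v
        flip: matrix_vector_mul_assoc)
  define X where "X = P ** T' ** P"
  have comm: "P ** T' = T' ** P"
  proof -
    have "P ** T' = T' ** (T ** P) ** T'" using T' by (simp add: matrix_mul_assoc)
    also have "\<dots> = T' ** (P ** T) ** T'" using \<open>P ** T = G\<close> \<open>T ** P = G\<close> by simp
    also have "\<dots> = T' ** P ** (T ** T')" by (simp add: matrix_mul_assoc)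
    finally show ?thesis using T' by simp
  qed
  have GP: "G ** P = G" "P ** G = G" unfolding G_def by (simp_all add: matrix_mul_assoc idem)
  have GX: "G ** X = P"
  proof -
    have "G ** X = P ** (T ** T') ** P" unfolding X_def
      by (metis GP(1) \<open>P ** T = G\<close> matrix_mul_assoc)
    then show ?thesis using T' idem by simp
  qed
  have XG: "X ** G = P"
  proof -
    have "X ** G = P ** (T' ** T) ** P" unfolding X_def
      by (metis GP(2) \<open>T ** P = G\<close> matrix_mul_assoc)
    then show ?thesis using T' idem by simp
  qed
  have PX: "P ** X = X" unfolding X_def by (simp add: matrix_mul_assoc idem)
  have "pseudo_inverse G = X"
    by (rule pseudo_inverse_eqI) (use GX XG PX GP sym in auto)
  then show "P ** pseudo_inverse G = pseudo_inverse G" "G ** pseudo_inverse G = P"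
    using PX GX by auto
qed

lemma mat_mult_vec: "mat c *v v = c *\<^sub>R (v :: real^'n)"
  by (simp add: vec_eq_iff matrix_vector_mult_def mat_def if_distrib[of "\<lambda>a. a * _"] cong: if_cong)

section \<open>Gradients of strongly convex functions\<close>

lemma has_derivative_along_line:
  assumes "(f has_derivative D) (at y)"
  shows "((\<lambda>t::real. f (y + t *\<^sub>R v)) has_derivative (\<lambda>t. D (t *\<^sub>R v))) (at 0)"
proof -
  have "((\<lambda>t. y + t *\<^sub>R v) has_derivative (\<lambda>t. t *\<^sub>R v)) (at 0)"
    by (auto intro!: derivative_eq_intros)
  then show ?thesis
    using has_derivative_compose[of "\<lambda>t. y + t *\<^sub>R v" _ 0 UNIV f D] assms by simp
qed

lemma strongly_convex_first_order:
  fixes f :: "'a::real_inner \<Rightarrow> real"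
  assumes "strongly_convex \<mu> f" and "GDERIV f y :> g"
  shows "f y + g \<bullet> (x - y) + \<mu> / 2 * (norm (x - y))\<^sup>2 \<le> f x"
proof -
  define \<phi> where "\<phi> t = f (y + t *\<^sub>R (x - y))" for t
  have "(\<phi> has_derivative (\<lambda>t. (t *\<^sub>R (x - y)) \<bullet> g)) (at 0)"
    unfolding \<phi>_def using assms(2) unfolding gderiv_def by (rule has_derivative_along_line)
  then have "(\<phi> has_field_derivative (g \<bullet> (x - y))) (at 0)"
    by (rule has_derivative_imp_has_field_derivative) (simp add: inner_commute)
  then have "((\<lambda>t. (\<phi> t - \<phi> 0) / t) \<longlongrightarrow> g \<bullet> (x - y)) (at_right 0)"
    unfolding has_field_derivative_iff diff_0_right by (rule tendsto_within_subset) simp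
  moreover have "((\<lambda>t. f x - f y - \<mu> / 2 * (1 - t) * (norm (x - y))\<^sup>2) \<longlongrightarrow>
      f x - f y - \<mu> / 2 * (1 - 0) * (norm (x - y))\<^sup>2) (at_right 0)"
    by (intro tendsto_intros)
  moreover have "\<forall>\<^sub>F t in at_right 0.
      (\<phi> t - \<phi> 0) / t \<le> f x - f y - \<mu> / 2 * (1 - t) * (norm (x - y))\<^sup>2"
    using eventually_at_right_real[of 0 "1::real", simplified]
  proof (eventually_elim)
    case (elim t)
    have "f (t *\<^sub>R x + (1 - t) *\<^sub>R y)
        \<le> t * f x + (1 - t) * f y - \<mu> / 2 * t * (1 - t) * (norm (x - y))\<^sup>2"
      using assms(1) elim unfolding strongly_convex_def by auto
    moreover have "t *\<^sub>R x + (1 - t) *\<^sub>R y = y + t *\<^sub>R (x - y)" by (simp add: algebra_simps)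
    ultimately have "\<phi> t - \<phi> 0 \<le> t * (f x - f y - \<mu> / 2 * (1 - t) * (norm (x - y))\<^sup>2)"
      unfolding \<phi>_def by (simp add: algebra_simps)
    with elim show ?case by (simp add: divide_le_eq mult.commute)
  qed
  ultimately have "g \<bullet> (x - y) \<le> f x - f y - \<mu> / 2 * (1 - 0) * (norm (x - y))\<^sup>2"
    by (intro tendsto_le[of "at_right 0"]) auto
  then show ?thesis by simp
qed

lemma strongly_convex_gradient_monotone:
  assumes "strongly_convex \<mu> f" and "\<And>y. GDERIV f y :> g y"
  shows "\<mu> * (norm (x - y))\<^sup>2 \<le> (g x - g y) \<bullet> (x - y)"
proof -
  have "f y + g y \<bullet> (x - y) + \<mu> / 2 * (norm (x - y))\<^sup>2 \<le> f x"
    "f x + g x \<bullet> (y - x) + \<mu> / 2 * (norm (y - x))\<^sup>2 \<le> f y"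
    using assms strongly_convex_first_order by blast+
  then show ?thesis by (simp add: inner_diff_left inner_diff_right norm_minus_commute)
qed

text \<open>Dividing the monotonicity inequality between \<open>y\<close> and \<open>y + t *\<^sub>R v\<close> by \<open>t\<^sup>2\<close> and letting \<open>t\<close> tend to
\<open>0\<close> leaves the quadratic form of the derivative.\<close>

lemma monotone_derivative_coercive:
  fixes g :: "'a::real_inner \<Rightarrow> 'a"
  assumes "\<And>x y. \<mu> * (norm (x - y))\<^sup>2 \<le> (g x - g y) \<bullet> (x - y)"
    and deriv: "(g has_derivative H) (at y)"
  shows "\<mu> * (norm v)\<^sup>2 \<le> H v \<bullet> v"
proof -
  have bl: "bounded_linear H" using deriv by (rule has_derivative_bounded_linear)
  define \<phi> where "\<phi> t = g (y + t *\<^sub>R v) \<bullet> v" for t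
  have "(\<phi> has_derivative (\<lambda>t. H (t *\<^sub>R v) \<bullet> v)) (at 0)"
    unfolding \<phi>_def by (intro has_derivative_inner_left has_derivative_along_line deriv)
  then have "(\<phi> has_field_derivative (H v \<bullet> v)) (at 0)"
    by (rule has_derivative_imp_has_field_derivative) (simp add: linear_simps[OF bl])
  then have "((\<lambda>t. (\<phi> t - \<phi> 0) / t) \<longlongrightarrow> H v \<bullet> v) (at_right 0)"
    unfolding has_field_derivative_iff diff_0_right by (rule tendsto_within_subset) simp
  moreover have "\<forall>\<^sub>F t in at_right 0. \<mu> * (norm v)\<^sup>2 \<le> (\<phi> t - \<phi> 0) / t"
    using eventually_at_right_less[of 0]
  proof eventually_elim
    case (elim t)
    have "t * (t * (\<mu> * (norm v)\<^sup>2)) \<le> t * (\<phi> t - \<phi> 0)"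
      using assms(1)[of "y + t *\<^sub>R v" y]
      by (simp add: \<phi>_def inner_diff_left power2_eq_square algebra_simps)
    then have "t * (\<mu> * (norm v)\<^sup>2) \<le> \<phi> t - \<phi> 0" using elim by simp
    with elim show ?case by (simp add: pos_le_divide_eq mult.commute)
  qed
  ultimately show ?thesis by (intro tendsto_lowerbound[of _ _ "at_right 0"]) auto
qed

lemma stationary_at_constrained_min:
  fixes f :: "'a::real_inner \<Rightarrow> real"
  assumes min: "\<And>t::real. f y \<le> f (y + t *\<^sub>R v)" and "GDERIV f y :> g"
  shows "g \<bullet> v = 0"
proof -
  have "((\<lambda>t. f (y + t *\<^sub>R v)) has_derivative (\<lambda>t. (t *\<^sub>R v) \<bullet> g)) (at 0)"
    using assms(2) unfolding gderiv_def by (rule has_derivative_along_line)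
  then have "((\<lambda>t. f (y + t *\<^sub>R v)) has_field_derivative (g \<bullet> v)) (at 0)"
    by (rule has_derivative_imp_has_field_derivative) (simp add: inner_commute)
  then show ?thesis
    by (rule DERIV_local_min[where d = 1]) (use min in auto)
qed

text \<open>The mean value inequality, applied to the difference of \<open>g\<close> and its linearisation on the segment
between the two points.\<close>

lemma gradient_taylor_quadratic:
  fixes g :: "real^'d \<Rightarrow> real^'d"
  assumes deriv: "\<And>y. (g has_derivative (\<lambda>h. H y *v h)) (at y)"
    and lip: "\<And>y. spectral_norm (H y - H x0) \<le> L * norm (y - x0)"
  shows "norm (g x - g x0 - H x0 *v (x - x0)) \<le> \<bar>L\<bar> * (norm (x - x0))\<^sup>2"
proof -
  have "norm (g x - g x0 - H x0 *v (x - x0)) \<le> norm (x - x0) * (\<bar>L\<bar> * norm (x - x0))"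
  proof (rule differentiable_bound_linearization[where S = "closed_segment x0 x"
          and f' = "\<lambda>y. (*v) (H y)"])
    fix t :: "real^'d" assume "t \<in> closed_segment x0 x"
    then have "norm (t - x0) \<le> norm (x - x0)"
      using segment_bound(1) by blast
    then have "L * norm (t - x0) \<le> \<bar>L\<bar> * norm (x - x0)"
      by (meson abs_ge_self abs_ge_zero mult_mono norm_ge_zero order_trans)
    then show "onorm ((*v) (H t) - (*v) (H x0)) \<le> \<bar>L\<bar> * norm (x - x0)"
      using lip[of t] by (simp add: spectral_norm_def matrix_vector_mult_diff_rdistrib fun_diff_def)
    show "(g has_derivative (*v) (H t)) (at t within closed_segment x0 x)"
      using deriv by (rule has_derivative_at_withinI)
  next
    fix t :: real assume "t \<in> {0..1}"
    then show "x0 + t *\<^sub>R (x - x0) \<in> closed_segment x0 x"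
      unfolding in_segment by (intro exI[of _ t]) (simp add: algebra_simps)
  qed simp
  then show ?thesis by (simp add: power2_eq_square mult_ac)
qed
section \<open>Scalar recursions\<close>

text \<open>Once \<open>\<epsilon>\<close> is below \<open>c * (\<delta> / 2)\<close>, the excess of \<open>W\<close> over \<open>\<delta> / 2\<close> shrinks by the factor \<open>1 - c * \<eta>\<close>
in each step, and the product of these factors is \<open>0\<close> because the \<open>\<eta>\<close> are not summable.\<close>

lemma contraction_tendsto_0:
  fixes W \<eta> \<epsilon> :: "nat \<Rightarrow> real"
  assumes rec: "\<forall>\<^sub>F n in sequentially. W (Suc n) \<le> (1 - c * \<eta> n) * W n + \<eta> n * \<epsilon> n"
    and W_nonneg: "\<And>n. 0 \<le> W n" and \<eta>_nonneg: "\<And>n. 0 \<le> \<eta> n" and "0 < c"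
    and \<eta>_lim: "\<eta> \<longlonglongrightarrow> 0" and diverges: "\<not> summable \<eta>" and \<epsilon>_lim: "\<epsilon> \<longlonglongrightarrow> 0"
  shows "W \<longlonglongrightarrow> 0"
proof (rule order_tendstoI)
  fix \<delta> :: real assume "0 < \<delta>"
  have "\<forall>\<^sub>F n in sequentially. \<eta> n < 1 / c" "\<forall>\<^sub>F n in sequentially. \<epsilon> n < c * (\<delta> / 2)"
    using order_tendstoD(2)[OF \<eta>_lim, of "1 / c"] order_tendstoD(2)[OF \<epsilon>_lim, of "c * (\<delta> / 2)"]
      \<open>0 < c\<close> \<open>0 < \<delta>\<close> by auto
  with rec have "\<forall>\<^sub>F n in sequentially. c * \<eta> n \<le> 1 \<and> \<epsilon> n \<le> c * (\<delta> / 2) \<and>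
      W (Suc n) \<le> (1 - c * \<eta> n) * W n + \<eta> n * \<epsilon> n"
    by eventually_elim (use \<open>0 < c\<close> in \<open>auto simp: field_simps\<close>)
  then obtain N where N: "\<And>n. N \<le> n \<Longrightarrow> c * \<eta> n \<le> 1 \<and> \<epsilon> n \<le> c * (\<delta> / 2) \<and>
      W (Suc n) \<le> (1 - c * \<eta> n) * W n + \<eta> n * \<epsilon> n"
    unfolding eventually_sequentially by blast
  define E where "E n = max 0 (W n - \<delta> / 2)" for n
  have E_step: "E (Suc n) \<le> exp (- (c * \<eta> n)) * E n" if "N \<le> n" for n
  proof -
    have "\<eta> n * \<epsilon> n \<le> \<eta> n * (c * (\<delta> / 2))"
      using N[OF that] \<eta>_nonneg by (intro mult_left_mono) auto
    then have "W (Suc n) - \<delta> / 2 \<le> (1 - c * \<eta> n) * (W n - \<delta> / 2)"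
      using N[OF that] by (simp add: algebra_simps)
    also have "\<dots> \<le> (1 - c * \<eta> n) * E n"
      using N[OF that] by (intro mult_left_mono) (auto simp: E_def)
    finally have "E (Suc n) \<le> (1 - c * \<eta> n) * E n"
      using N[OF that] by (auto simp: E_def)
    also have "\<dots> \<le> exp (- (c * \<eta> n)) * E n"
      using exp_ge_add_one_self[of "- (c * \<eta> n)"] by (intro mult_right_mono) (auto simp: E_def)
    finally show ?thesis .
  qed
  have E_bound: "E (k + N) \<le> exp (- c * (\<Sum>i<k. \<eta> (i + N))) * E N" for k
  proof (induction k)
    case (Suc k)
    have "E (Suc k + N) \<le> exp (- (c * \<eta> (k + N))) * E (k + N)" using E_step[of "k + N"] by simp
    also have "\<dots> \<le> exp (- (c * \<eta> (k + N))) * (exp (- c * (\<Sum>i<k. \<eta> (i + N))) * E N)"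
      using Suc by (intro mult_left_mono) auto
    finally show ?case by (simp add: exp_add[symmetric] algebra_simps flip: mult.assoc)
  qed simp
  have unbounded: "\<not> summable (\<lambda>i. \<eta> (i + N))" using diverges by simp
  have "filterlim (\<lambda>k. \<Sum>i<k. \<eta> (i + N)) at_top sequentially"
    unfolding filterlim_at_top
  proof
    fix Z
    obtain k where "Z < (\<Sum>i<k. \<eta> (i + N))"
      using summableI_nonneg_bounded[of "\<lambda>i. \<eta> (i + N)" Z] unbounded \<eta>_nonneg
      by (meson not_le)
    moreover have "(\<Sum>i<k. \<eta> (i + N)) \<le> (\<Sum>i<l. \<eta> (i + N))" if "k \<le> l" for l
      using that \<eta>_nonneg by (intro sum_mono2) auto
    ultimately show "\<forall>\<^sub>F k in sequentially. Z \<le> (\<Sum>i<k. \<eta> (i + N))"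
      unfolding eventually_sequentially by (meson less_imp_le order_trans)
  qed
  then have "(\<lambda>k. exp (- (c * (\<Sum>i<k. \<eta> (i + N))))) \<longlonglongrightarrow> 0"
    using \<open>0 < c\<close>
    by (intro filterlim_compose[OF exp_at_bot] filterlim_uminus_at_top[THEN iffD1]
        filterlim_tendsto_pos_mult_at_top[OF tendsto_const])
  then have "(\<lambda>k. exp (- c * (\<Sum>i<k. \<eta> (i + N))) * E N) \<longlonglongrightarrow> 0"
    using tendsto_mult_left_zero by fastforce
  then have "\<forall>\<^sub>F k in sequentially. exp (- c * (\<Sum>i<k. \<eta> (i + N))) * E N < \<delta> / 2"
    using \<open>0 < \<delta>\<close> by (intro order_tendstoD(2)) auto
  then have "\<forall>\<^sub>F k in sequentially. W (k + N) < \<delta>"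
  proof eventually_elim
    case (elim k)
    then have "E (k + N) < \<delta> / 2" using E_bound[of k] by linarith
    moreover have "W (k + N) - \<delta> / 2 \<le> E (k + N)" by (simp add: E_def)
    ultimately show ?case by linarith
  qed
  then show "\<forall>\<^sub>F n in sequentially. W n < \<delta>"
    by (rule eventually_sequentially_seg[THEN iffD1])
next
  fix \<delta> :: real assume "\<delta> < 0"
  then show "\<forall>\<^sub>F n in sequentially. \<delta> < W n"
    using W_nonneg by (intro always_eventually) (auto intro: less_le_trans)
qed

text \<open>A quantity that grows by \<open>\<eta>\<close> and is reset to \<open>0\<close> with probability \<open>p\<close> has fourth moments of order
\<open>(\<eta> / p) ^ 4\<close>: half of the loss rate \<open>p\<close> absorbs the growth.\<close>

lemma fourth_power_reset_step:
  fixes s \<eta> p :: real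
  assumes "0 \<le> s" "0 \<le> \<eta>" "0 < p" "p \<le> 1"
  shows "(1 - p) * (s + \<eta>) ^ 4 \<le> (1 - p / 2) * s ^ 4 + 512 * \<eta> ^ 4 / p ^ 3"
proof -
  \<comment> \<open>The weight in the convexity inequality for the fourth power is chosen so that dividing by \<open>(1 - t) ^ 3\<close> costs at most half of the loss \<open>p\<close>.\<close>
  define t where "t = p / 8"
  have t: "0 < t" "t < 1" using assms by (auto simp: t_def)
  have "(s + \<eta>) ^ 4 = ((1 - t) * (s / (1 - t)) + t * (\<eta> / t)) ^ 4" using t by simp
  also have "\<dots> \<le> (1 - t) * (s / (1 - t)) ^ 4 + t * (\<eta> / t) ^ 4"
    using convex_onD[OF convex_power_even[of 4], of t "s / (1 - t)" "\<eta> / t"] t by simp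
  also have "\<dots> = s ^ 4 / (1 - t) ^ 3 + \<eta> ^ 4 / t ^ 3"
    using t by (simp add: power_divide power4_eq_xxxx power3_eq_cube)
  finally have "(1 - p) * (s + \<eta>) ^ 4 \<le> (1 - p) * (s ^ 4 / (1 - t) ^ 3 + \<eta> ^ 4 / t ^ 3)"
    using assms by (intro mult_left_mono) auto
  also have "\<dots> = (1 - p) / (1 - t) ^ 3 * s ^ 4 + (1 - p) * (512 * \<eta> ^ 4 / p ^ 3)"
    by (simp add: t_def distrib_left power_divide)
  also have "\<dots> \<le> (1 - p / 2) * s ^ 4 + 1 * (512 * \<eta> ^ 4 / p ^ 3)"
  proof (intro add_mono mult_right_mono)
    have "1 - 3 * t \<le> (1 - t) ^ 3"
      using Bernoulli_inequality[of "- t" 3] t by simp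
    then have "(1 - p / 2) * (1 - 3 * t) \<le> (1 - p / 2) * (1 - t) ^ 3"
      using assms by (intro mult_left_mono) auto
    moreover have "1 - p \<le> (1 - p / 2) * (1 - 3 * t)"
      using assms by (simp add: t_def algebra_simps)
    ultimately show "(1 - p) / (1 - t) ^ 3 \<le> 1 - p / 2"
      using t by (simp add: pos_divide_le_eq)
  qed (use assms in auto)
  finally show ?thesis by simp
qed

section \<open>Step sizes and their scales\<close>

locale step_sizes =
  fixes \<eta>0 \<alpha> \<beta> \<gamma> :: real
  assumes \<gamma>_pos: "0 < \<gamma>" and \<alpha>: "0 < \<alpha>" "\<alpha> \<le> 1" and \<beta>: "1 / 2 < \<beta>" "\<beta> < 1" and \<eta>0_pos: "0 < \<eta>0"
begin

definition \<eta> :: "nat \<Rightarrow> real" where "\<eta> n = \<eta>0 * real n powr (- \<alpha>)"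

definition p :: "nat \<Rightarrow> real" where "p n = min (\<gamma> * \<eta> n powr \<beta>) 1"

text \<open>The typical size \<open>\<eta> / p\<close> of the step mass that accumulates between two projections, written so that it
keeps its power-law form while the probability is capped at \<open>1\<close>.\<close>

definition \<kappa> :: "nat \<Rightarrow> real" where "\<kappa> n = \<eta> n powr (1 - \<beta>) / \<gamma>"

text \<open>The relative change of \<open>\<kappa>\<close> in one step is \<open>- \<nu> * \<eta>\<close> up to terms of smaller order than \<open>\<eta>\<close>; it is visible on the
time scale of the drift only for \<open>\<alpha> = 1\<close>.\<close>

definition \<nu> :: real where "\<nu> = (1 - \<beta>) / \<eta>0 * of_bool (\<alpha> = 1)"

lemma \<eta>_nonneg: "0 \<le> \<eta> n" using \<eta>0_pos by (simp add: \<eta>_def)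

lemma \<kappa>_nonneg: "0 \<le> \<kappa> n" using \<gamma>_pos by (simp add: \<kappa>_def)

lemma \<eta>_pos: "1 \<le> n \<Longrightarrow> 0 < \<eta> n" using \<eta>0_pos by (simp add: \<eta>_def)

lemma p_pos: "1 \<le> n \<Longrightarrow> 0 < p n" using \<eta>_pos[of n] \<gamma>_pos by (simp add: p_def)

lemma p_bounds: "0 \<le> p n" "p n \<le> 1" using \<gamma>_pos by (auto simp: p_def)

lemma \<kappa>_pos: "1 \<le> n \<Longrightarrow> 0 < \<kappa> n" using \<eta>_pos[of n] \<gamma>_pos by (simp add: \<kappa>_def)

lemma \<kappa>_eq: "\<kappa> n = (\<eta>0 powr (1 - \<beta>) / \<gamma>) * real n powr (- (\<alpha> * (1 - \<beta>)))"
  using \<eta>0_pos by (simp add: \<kappa>_def \<eta>_def powr_mult powr_powr algebra_simps)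

lemma \<eta>_lim: "\<eta> \<longlonglongrightarrow> 0"
  unfolding \<eta>_def using \<alpha> \<eta>0_pos by real_asymp

lemma \<kappa>_lim: "\<kappa> \<longlonglongrightarrow> 0"
proof -
  have "0 < \<alpha> * (1 - \<beta>)" using \<alpha> \<beta> by simp
  then have "(\<lambda>n. (\<eta>0 powr (1 - \<beta>) / \<gamma>) * real n powr (- (\<alpha> * (1 - \<beta>)))) \<longlonglongrightarrow> (\<eta>0 powr (1 - \<beta>) / \<gamma>) * 0"
    by (intro tendsto_intros tendsto_neg_powr filterlim_real_sequentially) auto
  then show ?thesis by (simp add: \<kappa>_eq[abs_def])
qed

lemma \<eta>_not_summable: "\<not> summable \<eta>"
proof -
  have "\<not> summable (\<lambda>n. real n powr (- \<alpha>))"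
    using summable_real_powr_iff[of "- \<alpha>"] \<alpha> by simp
  then show ?thesis
    unfolding \<eta>_def[abs_def] using \<eta>0_pos summable_cmult_iff[of \<eta>0 "\<lambda>n. real n powr (- \<alpha>)"] by simp
qed

lemma eventually_p_\<kappa>: "\<forall>\<^sub>F n in sequentially. \<kappa> n * p n = \<eta> n"
proof -
  have "(\<lambda>n. \<gamma> * \<eta> n powr \<beta>) \<longlonglongrightarrow> \<gamma> * 0 powr \<beta>"
    using \<eta>_nonneg \<beta> by (intro tendsto_intros \<eta>_lim tendsto_powr') auto
  then have "\<forall>\<^sub>F n in sequentially. \<gamma> * \<eta> n powr \<beta> < 1"
    by (rule order_tendstoD(2)) (use \<beta> in auto)
  with eventually_ge_at_top[of 1] show ?thesis
  proof eventually_elim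
    case (elim n)
    then have "\<kappa> n * p n = \<eta> n powr (1 - \<beta>) * \<eta> n powr \<beta>"
      using \<gamma>_pos by (simp add: \<kappa>_def p_def)
    also have "\<dots> = \<eta> n powr 1" by (simp flip: powr_add)
    finally show ?case using \<eta>_pos[OF elim(1)] by simp
  qed
qed

lemma inverse_le_\<eta>: "1 \<le> n \<Longrightarrow> 1 / real n \<le> \<eta> n / \<eta>0"
proof -
  assume "1 \<le> n"
  then have "real n powr (- 1) \<le> real n powr (- \<alpha>)"
    using \<alpha> by (intro powr_mono) auto
  then show "1 / real n \<le> \<eta> n / \<eta>0"
    using \<eta>0_pos by (simp add: \<eta>_def powr_minus_divide)
qed

lemma \<kappa>_antimono: "1 \<le> n \<Longrightarrow> \<kappa> (Suc n) \<le> \<kappa> n"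
  using \<gamma>_pos \<eta>0_pos \<alpha> \<beta> unfolding \<kappa>_eq by (intro mult_left_mono powr_mono2') auto

lemma \<kappa>_le_Suc:
  assumes "1 \<le> n"
  shows "\<kappa> n \<le> (1 + \<alpha> * (1 - \<beta>) / n) * \<kappa> (Suc n)"
proof -
  define \<tau> where "\<tau> = \<alpha> * (1 - \<beta>)"
  have \<tau>: "0 \<le> \<tau>" "\<tau> \<le> 1"
    unfolding \<tau>_def using \<alpha> \<beta> by (simp, intro mult_le_one) auto
  have "real n powr (- \<tau>) = (1 + 1 / real n) powr \<tau> * real (Suc n) powr (- \<tau>)"
  proof -
    have "(1 + 1 / real n) = real (Suc n) / real n" using assms by (simp add: field_simps)
    then show ?thesis using assms by (simp add: powr_divide powr_minus_divide)
  qed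
  also have "\<dots> \<le> (1 + \<tau> * (1 / real n)) * real (Suc n) powr (- \<tau>)"
    using \<tau> Youngs_inequality_0[of \<tau> "1 - \<tau>" "1 + 1 / real n" 1]
    by (intro mult_right_mono) (auto simp: algebra_simps add_pos_nonneg)
  finally show ?thesis
    using \<gamma>_pos \<eta>0_pos unfolding \<kappa>_eq \<tau>_def[symmetric]
    by (simp add: mult_left_mono divide_right_mono mult.left_commute)
qed

lemma \<kappa>_increment: "1 \<le> n \<Longrightarrow> \<bar>\<kappa> (Suc n) - \<kappa> n\<bar> \<le> \<alpha> * (1 - \<beta>) / \<eta>0 * (\<kappa> n * \<eta> n)"
proof -
  assume n: "1 \<le> n"
  have "\<bar>\<kappa> (Suc n) - \<kappa> n\<bar> \<le> \<alpha> * (1 - \<beta>) * (1 / n) * \<kappa> (Suc n)"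
    using \<kappa>_le_Suc[OF n] \<kappa>_antimono[OF n] by (simp add: distrib_right)
  also have "\<dots> \<le> \<alpha> * (1 - \<beta>) * (\<eta> n / \<eta>0) * \<kappa> n"
    using \<kappa>_antimono[OF n] inverse_le_\<eta>[OF n] \<kappa>_nonneg \<alpha> \<beta> \<eta>_nonneg[of n] \<eta>0_pos
    by (intro mult_mono mult_nonneg_nonneg) auto
  finally show ?thesis by (simp add: mult_ac)
qed

lemma inverse_n_\<eta>_lim: "(\<lambda>n. 1 / (real n * \<eta> n)) \<longlonglongrightarrow> of_bool (\<alpha> = 1) / \<eta>0"
proof (cases "\<alpha> = 1")
  case True
  have "\<forall>\<^sub>F n in sequentially. of_bool (\<alpha> = 1) / \<eta>0 = 1 / (real n * \<eta> n)"
    using eventually_gt_at_top[of 0]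
    by eventually_elim (simp add: \<eta>_def powr_minus_divide, simp add: True)
  then show ?thesis by (rule Lim_transform_eventually[OF tendsto_const])
next
  case False
  then have "\<alpha> < 1" using \<alpha> by simp
  then have "(\<lambda>n. 1 / (real n * (\<eta>0 * real n powr (- \<alpha>)))) \<longlonglongrightarrow> 0"
    using \<eta>0_pos by real_asymp
  then show ?thesis using False by (simp add: \<eta>_def)
qed

text \<open>The scale \<open>\<kappa>\<^sup>2\<close> decays more slowly than a contraction with rate \<open>\<theta> * \<eta>\<close>, so dividing a contracting
sequence by it keeps a contraction.\<close>

lemma \<kappa>_sq_ratio:
  assumes "2 * (1 - \<beta>) * of_bool (\<alpha> = 1) / \<eta>0 < \<theta>" and "0 < \<theta>"
  shows "\<forall>\<^sub>F n in sequentially. (\<kappa> n)\<^sup>2 \<le> (1 + \<theta> * \<eta> n) * (\<kappa> (Suc n))\<^sup>2"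
proof -
  define \<tau> where "\<tau> = \<alpha> * (1 - \<beta>)"
  have "(\<lambda>n. (2 * \<tau> + \<tau>\<^sup>2 * (1 / real n)) * (1 / (real n * \<eta> n)))
      \<longlonglongrightarrow> (2 * \<tau> + \<tau>\<^sup>2 * 0) * (of_bool (\<alpha> = 1) / \<eta>0)"
    by (intro tendsto_intros inverse_n_\<eta>_lim lim_1_over_n)
  moreover have "(2 * \<tau> + \<tau>\<^sup>2 * 0) * (of_bool (\<alpha> = 1) / \<eta>0) < \<theta>"
    using assms by (cases "\<alpha> = 1") (auto simp: \<tau>_def)
  ultimately have "\<forall>\<^sub>F n in sequentially.
      (2 * \<tau> + \<tau>\<^sup>2 * (1 / real n)) * (1 / (real n * \<eta> n)) < \<theta>"
    by (rule order_tendstoD(2))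
  with eventually_ge_at_top[of 1] show ?thesis
  proof eventually_elim
    case (elim n)
    have "(1 + \<tau> / n)\<^sup>2 = 1 + (2 * \<tau> + \<tau>\<^sup>2 * (1 / real n)) * (1 / real n)"
      using elim by (simp add: power2_eq_square field_simps)
    also have "\<dots> \<le> 1 + \<theta> * \<eta> n"
      using elim \<eta>_pos[of n] by (simp add: field_simps)
    finally have *: "(1 + \<tau> / n)\<^sup>2 \<le> 1 + \<theta> * \<eta> n" .
    have "(\<kappa> n)\<^sup>2 \<le> ((1 + \<tau> / n) * \<kappa> (Suc n))\<^sup>2"
      using \<kappa>_le_Suc[of n] elim \<kappa>_nonneg by (intro power_mono) (auto simp: \<tau>_def)
    also have "\<dots> \<le> (1 + \<theta> * \<eta> n) * (\<kappa> (Suc n))\<^sup>2"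
      unfolding power_mult_distrib using * by (intro mult_right_mono) auto
    finally show ?case .
  qed
qed

text \<open>Here the decay of the scale is compared with the projection probability, which is much larger than
\<open>1 / n\<close> because \<open>\<alpha> * \<beta> < 1\<close>.\<close>

lemma \<kappa>_fourth_ratio: "\<forall>\<^sub>F n in sequentially. (1 - p n / 4) * \<kappa> n ^ 4 \<le> \<kappa> (Suc n) ^ 4"
proof -
  define \<tau> where "\<tau> = \<alpha> * (1 - \<beta>)"
  have \<tau>: "0 \<le> \<tau>" "\<tau> \<le> 1"
    unfolding \<tau>_def using \<alpha> \<beta> by (simp, intro mult_le_one) auto
  have "\<alpha> * \<beta> \<le> \<beta>" 
    using \<alpha> \<beta> by (intro mult_left_le_one_le) auto
  then have "0 < 1 - \<alpha> * \<beta>" using \<beta> by linarith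
  moreover have "0 < \<gamma> * \<eta>0 powr \<beta>" using \<gamma>_pos \<eta>0_pos by simp
  ultimately have "filterlim (\<lambda>n. (\<gamma> * \<eta>0 powr \<beta>) * real n powr (1 - \<alpha> * \<beta>)) at_top sequentially"
    by real_asymp
  \<comment> \<open>The constant \<open>60\<close> makes the relative change \<open>15 / n\<close> of the fourth power at most a quarter of \<open>p n\<close>.\<close>
  then have "\<forall>\<^sub>F n in sequentially. 60 \<le> (\<gamma> * \<eta>0 powr \<beta>) * real n powr (1 - \<alpha> * \<beta>)"
    by (simp add: filterlim_at_top)
  then have "\<forall>\<^sub>F n in sequentially. 60 \<le> real n * p n"
    using eventually_ge_at_top[of 60]
  proof eventually_elim
    case (elim n)
    have "real n * real n powr (- (\<alpha> * \<beta>)) = real n powr (1 - \<alpha> * \<beta>)"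
      using elim by (simp add: powr_diff powr_minus_divide)
    then have "real n * (\<gamma> * \<eta> n powr \<beta>) = (\<gamma> * \<eta>0 powr \<beta>) * real n powr (1 - \<alpha> * \<beta>)"
      using \<eta>0_pos by (simp add: \<eta>_def powr_mult powr_powr mult_ac)
    then have "60 \<le> real n * (\<gamma> * \<eta> n powr \<beta>)" using elim(1) by linarith
    moreover have "60 \<le> real n * 1" using elim(2) by simp
    ultimately show ?case by (auto simp only: p_def min_def split: if_split)
  qed
  with eventually_ge_at_top[of 1] show ?thesis
  proof eventually_elim
    case (elim n)
    define t where "t = \<tau> / n"
    have t: "0 \<le> t" "t \<le> 1" "15 * t \<le> p n / 4" 
      using \<tau> elim by (auto simp: t_def field_simps)
    have fourth: "(1 + t) ^ 4 \<le> 1 + 15 * t"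
    proof -
      have "t * t \<le> t" using t by (simp add: mult_left_le)
      moreover have "t * t * t \<le> t" "t * t * t * t \<le> t" using t 
        by (metis calculation dual_order.trans mult_left_le mult_nonneg_nonneg)+
      ultimately show ?thesis by (simp add: power4_eq_xxxx algebra_simps)
    qed
    have "(1 - p n / 4) * (1 + 15 * t) \<le> (1 - 15 * t) * (1 + 15 * t)"
      using t by (intro mult_right_mono) auto
    also have "\<dots> \<le> 1" by (simp add: algebra_simps)
    finally have damped: "(1 - p n / 4) * (1 + 15 * t) \<le> 1" .
    have "\<kappa> n ^ 4 \<le> ((1 + t) * \<kappa> (Suc n)) ^ 4"
      using \<kappa>_le_Suc[of n] elim \<kappa>_nonneg by (intro power_mono) (auto simp: \<tau>_def t_def)
    also have "\<dots> \<le> (1 + 15 * t) * \<kappa> (Suc n) ^ 4"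
      unfolding power_mult_distrib using fourth by (intro mult_right_mono) auto
    finally have "(1 - p n / 4) * \<kappa> n ^ 4 \<le> ((1 - p n / 4) * (1 + 15 * t)) * \<kappa> (Suc n) ^ 4"
      using p_bounds[of n] by (simp add: mult.assoc mult_left_mono)
    also have "\<dots> \<le> 1 * \<kappa> (Suc n) ^ 4"
      using damped by (intro mult_right_mono) auto
    finally show ?case by simp
  qed
qed

text \<open>This is where \<open>\<beta> > 1 / 2\<close> enters: gradient noise contributes \<open>\<eta>\<^sup>2\<close> per step and must be negligible
against \<open>\<eta> * \<kappa>\<^sup>2\<close>.\<close>

lemma \<eta>_over_\<kappa>_sq_lim: "(\<lambda>n. \<eta> n / (\<kappa> n)\<^sup>2) \<longlonglongrightarrow> 0"
proof -
  have "(\<lambda>n. \<gamma>\<^sup>2 * \<eta> n powr (2 * \<beta> - 1)) \<longlonglongrightarrow> \<gamma>\<^sup>2 * 0 powr (2 * \<beta> - 1)"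
    using \<eta>_nonneg \<beta> by (intro tendsto_intros \<eta>_lim tendsto_powr') auto
  moreover have "\<forall>\<^sub>F n in sequentially. \<gamma>\<^sup>2 * \<eta> n powr (2 * \<beta> - 1) = \<eta> n / (\<kappa> n)\<^sup>2"
    using eventually_ge_at_top[of 1]
  proof eventually_elim
    case (elim n)
    have "\<eta> n = \<eta> n powr (2 * \<beta> - 1) * (\<eta> n powr (1 - \<beta>))\<^sup>2"
      using \<eta>_pos[OF elim] by (simp add: power2_eq_square flip: powr_add)
    then show ?case
      using \<gamma>_pos \<eta>_pos[OF elim] by (simp add: \<kappa>_def field_simps)
  qed
  ultimately show ?thesis using \<beta> by (simp add: Lim_transform_eventually)
qed

lemma \<kappa>_pred_ratio_lim: "(\<lambda>n. \<kappa> (n - 1) / \<kappa> n) \<longlonglongrightarrow> 1"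
  and \<kappa>_pred_increment_lim: "(\<lambda>n. (\<kappa> n - \<kappa> (n - 1)) / (\<eta> n * \<kappa> n)) \<longlonglongrightarrow> - \<nu>"
proof -
  define \<tau> where "\<tau> = \<alpha> * (1 - \<beta>)"
  have "0 < \<tau>" using \<alpha> \<beta> by (simp add: \<tau>_def)
  define r where "r n = ((real n - 1) / real n) powr (- \<tau>)" for n
  have r: "\<forall>\<^sub>F n in sequentially. r n = \<kappa> (n - 1) / \<kappa> n"
    using eventually_ge_at_top[of 1]
    by eventually_elim (use \<eta>0_pos \<gamma>_pos in \<open>simp add: r_def \<kappa>_eq \<tau>_def powr_divide of_nat_diff\<close>)
  have "r \<longlonglongrightarrow> 1" unfolding r_def using \<open>0 < \<tau>\<close> by real_asymp
  then show "(\<lambda>n. \<kappa> (n - 1) / \<kappa> n) \<longlonglongrightarrow> 1" using r by (rule Lim_transform_eventually)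
  have "(\<lambda>n. real n * (1 - r n)) \<longlonglongrightarrow> - \<tau>" unfolding r_def using \<open>0 < \<tau>\<close> by real_asymp
  then have "(\<lambda>n. real n * (1 - r n) * (1 / (real n * \<eta> n))) \<longlonglongrightarrow> - \<tau> * (of_bool (\<alpha> = 1) / \<eta>0)"
    by (intro tendsto_mult inverse_n_\<eta>_lim)
  moreover have "- \<tau> * (of_bool (\<alpha> = 1) / \<eta>0) = - \<nu>" by (auto simp: \<tau>_def \<nu>_def)
  moreover have "\<forall>\<^sub>F n in sequentially.
      real n * (1 - r n) * (1 / (real n * \<eta> n)) = (\<kappa> n - \<kappa> (n - 1)) / (\<eta> n * \<kappa> n)"
    using r eventually_ge_at_top[of 1]
  proof eventually_elim
    case (elim n)
    then show ?case using \<eta>_pos[of n] \<kappa>_pos[of n] by (simp add: field_simps)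
  qed
  ultimately show "(\<lambda>n. (\<kappa> n - \<kappa> (n - 1)) / (\<eta> n * \<kappa> n)) \<longlonglongrightarrow> - \<nu>"
    by (auto intro: Lim_transform_eventually)
qed

lemma p_lim: "p \<longlonglongrightarrow> 0"
proof -
  have "(\<lambda>n. min (\<gamma> * \<eta> n powr \<beta>) 1) \<longlonglongrightarrow> min (\<gamma> * 0 powr \<beta>) 1"
    using \<eta>_nonneg \<beta> by (intro tendsto_intros \<eta>_lim tendsto_powr') auto
  then show ?thesis using \<beta> by (simp add: p_def[abs_def])
qed

end

section \<open>Drift of the tangent and normal components\<close>

lemma norm_add_sq_le:
  fixes u e :: "'a::real_inner"
  assumes "0 < t"
  shows "(norm (u + e))\<^sup>2 \<le> (1 + t) * (norm u)\<^sup>2 + (1 + 1 / t) * (norm e)\<^sup>2"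
proof -
  have "0 \<le> (norm (t *\<^sub>R u - e))\<^sup>2 / t" using assms by simp
  also have "(norm (t *\<^sub>R u - e))\<^sup>2 = t * (t * (norm u)\<^sup>2 - 2 * (u \<bullet> e)) + (norm e)\<^sup>2"
    by (simp add: power2_norm_eq_inner inner_diff_left inner_diff_right inner_commute algebra_simps)
  also have "\<dots> / t = t * (norm u)\<^sup>2 - 2 * (u \<bullet> e) + (norm e)\<^sup>2 / t"
    using assms by (simp add: add_divide_distrib)
  finally have "2 * (u \<bullet> e) \<le> t * (norm u)\<^sup>2 + (norm e)\<^sup>2 / t" by simp
  moreover have "(norm (u + e))\<^sup>2 = (norm u)\<^sup>2 + 2 * (u \<bullet> e) + (norm e)\<^sup>2"
    by (simp add: power2_norm_eq_inner inner_add_left inner_add_right inner_commute)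
  ultimately show ?thesis by (simp add: algebra_simps)
qed

lemma two_point_bias_variance:
  fixes u v :: "'a::real_inner"
  shows "p * (norm u)\<^sup>2 + (1 - p) * (norm (u + v))\<^sup>2
    = (norm (u + (1 - p) *\<^sub>R v))\<^sup>2 + p * (1 - p) * (norm v)\<^sup>2"
  by (simp add: power2_norm_eq_inner inner_add_left inner_add_right inner_commute algebra_simps)

text \<open>The deterministic data of the problem: \<open>P\<close> is the projection onto the feasible subspace, \<open>g\<close> the
gradient, \<open>xs\<close> the constrained minimiser and \<open>H\<close> the Hessian there.\<close>

locale projected_gradient_field =
  fixes P g H :: "'a::euclidean_space \<Rightarrow> 'a" and xs :: 'a and \<mu> L L' :: real
  assumes linear_P: "linear P" and P_idem: "P (P x) = P x" and P_adjoint: "P x \<bullet> y = x \<bullet> P y"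
    and P_xs: "P xs = xs" and P_grad_xs: "P (g xs) = 0" and linear_H: "linear H"
    and monotone: "\<mu> * (norm (x - y))\<^sup>2 \<le> (g x - g y) \<bullet> (x - y)" and \<mu>_pos: "0 < \<mu>"
    and lipschitz: "norm (g x - g y) \<le> L * norm (x - y)" and L_nonneg: "0 \<le> L"
    and taylor: "norm (g x - g xs - H (x - xs)) \<le> L' * (norm (x - xs))\<^sup>2" and L'_nonneg: "0 \<le> L'"
begin

lemma pythagoras: "(norm x)\<^sup>2 = (norm (P x))\<^sup>2 + (norm (x - P x))\<^sup>2"
proof -
  have "P x \<bullet> (x - P x) = 0" using P_adjoint[of x "x - P x"] P_idem linear_diff[OF linear_P] by simp
  then have "(norm (P x + (x - P x)))\<^sup>2 = (norm (P x))\<^sup>2 + (norm (x - P x))\<^sup>2"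
    by (intro norm_add_Pythagorean) (simp add: orthogonal_def)
  then show ?thesis by simp
qed

lemma norm_P_le: "norm (P x) \<le> norm x"
  by (rule power2_le_imp_le) (use pythagoras[of x] in auto)

lemma norm_coP_le: "norm (x - P x) \<le> norm x"
  by (rule power2_le_imp_le) (use pythagoras[of x] in auto)

text \<open>Strong convexity controls the part of \<open>x - y\<close> in the range of \<open>P\<close>: the gradient increment is split at
\<open>y + a\<close>, where the first piece is a monotonicity increment along \<open>a\<close> and the second is Lipschitz in \<open>b\<close>.\<close>

lemma inner_tangent_ge:
  fixes x y :: 'a
  defines "a \<equiv> P (x - y)" and "b \<equiv> (x - y) - P (x - y)"
  shows "\<mu> * (norm a)\<^sup>2 - L * norm a * norm b \<le> a \<bullet> P (g x - g y)"
proof -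
  have xb: "x - (y + a) = b" by (simp add: a_def b_def)
  have "a \<bullet> P (g x - g y) = a \<bullet> (g x - g y)"
    unfolding a_def by (metis P_adjoint P_idem)
  also have "\<dots> = (g (y + a) - g y) \<bullet> ((y + a) - y) + a \<bullet> (g x - g (y + a))"
    by (simp add: inner_diff_left inner_diff_right inner_commute)
  also have "\<dots> \<ge> \<mu> * (norm a)\<^sup>2 - norm a * norm (g x - g (y + a))"
    using monotone[where x = "y + a" and y = y] Cauchy_Schwarz_ineq2[of a "g x - g (y + a)"] by simp
  moreover have "norm a * norm (g x - g (y + a)) \<le> norm a * (L * norm b)"
    using lipschitz[where x = x and y = "y + a"] xb by (intro mult_left_mono) auto
  ultimately show ?thesis by (simp add: mult_ac)
qed

text \<open>One gradient step contracts the tangent component at rate \<open>\<mu> * \<eta>\<close>. Monotonicity offers the rate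
\<open>2 * \<mu> * \<eta>\<close>; one half of it pays for the normal component, for the quadratic terms and for the
perturbation \<open>e\<close>.\<close>

lemma tangent_step:
  fixes x y e :: 'a
  defines "a \<equiv> P (x - y)" and "b \<equiv> (x - y) - P (x - y)"
  assumes "0 < \<eta>" "\<eta> * L\<^sup>2 \<le> \<mu> / 4" "\<eta> * \<mu> \<le> 1"
  shows "(norm (a - \<eta> *\<^sub>R P (g x - g y) + e))\<^sup>2
    \<le> (1 - \<mu> * \<eta>) * (norm a)\<^sup>2 + (4 * L\<^sup>2 / \<mu> + \<mu> / 2) * \<eta> * (norm b)\<^sup>2 + 5 / (\<mu> * \<eta>) * (norm e)\<^sup>2"
proof -
  define \<Delta> where "\<Delta> = P (g x - g y)"
  define A B where "A = (norm a)\<^sup>2" and "B = (norm b)\<^sup>2"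
  have AB: "0 \<le> A" "0 \<le> B" by (auto simp: A_def B_def)
  have "(norm \<Delta>)\<^sup>2 \<le> (L * norm (x - y))\<^sup>2"
    unfolding \<Delta>_def using norm_P_le[of "g x - g y"] lipschitz[of x y] by (intro power_mono) auto
  then have \<Delta>: "(norm \<Delta>)\<^sup>2 \<le> L\<^sup>2 * (A + B)"
    using pythagoras[of "x - y"] by (simp add: A_def B_def a_def b_def power_mult_distrib)
  have cross: "\<mu> * A - L * norm a * norm b \<le> a \<bullet> \<Delta>"
    unfolding A_def \<Delta>_def a_def b_def by (rule inner_tangent_ge)
  have "0 \<le> (\<mu> / 2 * norm a - L * norm b)\<^sup>2 * (2 / \<mu>)" using \<mu>_pos by simp
  also have "\<dots> = \<mu> / 2 * A - 2 * (L * norm a * norm b) + 2 * L\<^sup>2 / \<mu> * B"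
    using \<mu>_pos by (simp add: A_def B_def power2_diff power_mult_distrib) (simp add: field_simps power2_eq_square)
  finally have young: "2 * (L * norm a * norm b) \<le> \<mu> / 2 * A + 2 * L\<^sup>2 / \<mu> * B" by simp
  have "(norm (a - \<eta> *\<^sub>R \<Delta>))\<^sup>2 = A - 2 * \<eta> * (a \<bullet> \<Delta>) + \<eta>\<^sup>2 * (norm \<Delta>)\<^sup>2"
    unfolding A_def power2_norm_eq_inner
    by (simp add: inner_diff_left inner_diff_right inner_commute power2_eq_square algebra_simps)
  also have "\<dots> \<le> A - \<eta> * (2 * \<mu> * A - (\<mu> / 2 * A + 2 * L\<^sup>2 / \<mu> * B)) + \<eta>\<^sup>2 * (L\<^sup>2 * (A + B))"
  proof -
    have "2 * \<mu> * A - (\<mu> / 2 * A + 2 * L\<^sup>2 / \<mu> * B) \<le> 2 * (a \<bullet> \<Delta>)" using cross young by linarith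
    then have "\<eta> * (2 * \<mu> * A - (\<mu> / 2 * A + 2 * L\<^sup>2 / \<mu> * B)) \<le> \<eta> * (2 * (a \<bullet> \<Delta>))"
      using assms by (intro mult_left_mono) auto
    moreover have "\<eta>\<^sup>2 * (norm \<Delta>)\<^sup>2 \<le> \<eta>\<^sup>2 * (L\<^sup>2 * (A + B))"
      using \<Delta> by (intro mult_left_mono) auto
    ultimately show ?thesis by simp
  qed
  also have "\<dots> = A - \<eta> * (2 * \<mu> * A - (\<mu> / 2 * A + 2 * L\<^sup>2 / \<mu> * B)) + \<eta> * ((\<eta> * L\<^sup>2) * (A + B))"
    by (simp add: power2_eq_square)
  also have "\<dots> \<le> A - \<eta> * (2 * \<mu> * A - (\<mu> / 2 * A + 2 * L\<^sup>2 / \<mu> * B)) + \<eta> * (\<mu> / 4 * (A + B))"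
    using assms AB by (intro add_left_mono mult_left_mono mult_right_mono) auto
  also have "\<dots> = (1 - 5 / 4 * (\<mu> * \<eta>)) * A + (2 * L\<^sup>2 / \<mu> + \<mu> / 4) * \<eta> * B"
    by (simp add: algebra_simps)
  finally have drift: "(norm (a - \<eta> *\<^sub>R \<Delta>))\<^sup>2 \<le> \<dots>" .
  define t where "t = \<mu> * \<eta> / 4"
  have t: "0 < t" "t \<le> 1 / 4" using assms \<mu>_pos by (auto simp: t_def mult.commute)
  have "(norm (a - \<eta> *\<^sub>R \<Delta> + e))\<^sup>2 \<le> (1 + t) * (norm (a - \<eta> *\<^sub>R \<Delta>))\<^sup>2 + (1 + 1 / t) * (norm e)\<^sup>2"
    using t by (intro norm_add_sq_le)
  also have "\<dots> \<le> (1 + t) * ((1 - 5 * t) * A + (2 * L\<^sup>2 / \<mu> + \<mu> / 4) * \<eta> * B) + (1 + 1 / t) * (norm e)\<^sup>2"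
    using drift t by (intro add_right_mono mult_left_mono) (auto simp: t_def)
  also have "\<dots> = ((1 + t) * (1 - 5 * t)) * A + (1 + t) * ((2 * L\<^sup>2 / \<mu> + \<mu> / 4) * \<eta> * B) + (1 + 1 / t) * (norm e)\<^sup>2"
    by (simp add: algebra_simps)
  also have "\<dots> \<le> (1 - 4 * t) * A + 2 * ((2 * L\<^sup>2 / \<mu> + \<mu> / 4) * \<eta> * B) + 5 / (4 * t) * (norm e)\<^sup>2"
  proof (intro add_mono mult_right_mono)
    show "(1 + t) * (1 - 5 * t) \<le> 1 - 4 * t" using t by (simp add: algebra_simps)
    show "1 + 1 / t \<le> 5 / (4 * t)" using t by (simp add: field_simps)
  qed (use t AB assms \<mu>_pos in auto)
  finally show ?thesis
    unfolding \<Delta>_def A_def B_def t_def by (simp add: algebra_simps)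
qed

text \<open>The normal component is set to \<open>0\<close> with probability \<open>p\<close>. Half of this loss absorbs the gradient force,
whose square therefore enters with weight \<open>\<eta>\<^sup>2 / p\<close>.\<close>

lemma normal_step:
  fixes x y :: 'a
  defines "a \<equiv> P (x - y)" and "b \<equiv> (x - y) - P (x - y)"
  assumes "0 \<le> \<eta>" "0 < p" "p \<le> 1"
  defines "\<Delta> \<equiv> g x - g xs"
  shows "(1 - p) * (norm (b - \<eta> *\<^sub>R (\<Delta> - P \<Delta>)))\<^sup>2
    \<le> (1 - p / 2) * (norm b)\<^sup>2 + 9 * L\<^sup>2 * \<eta>\<^sup>2 / p * ((norm a)\<^sup>2 + (norm b)\<^sup>2 + (norm (y - xs))\<^sup>2)"
proof -
  define c where "c = \<Delta> - P \<Delta>"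
  define Y where "Y = (norm a)\<^sup>2 + (norm b)\<^sup>2 + (norm (y - xs))\<^sup>2"
  have "norm c \<le> norm \<Delta>" unfolding c_def by (rule norm_coP_le)
  also have "\<dots> \<le> L * norm (x - xs)" unfolding \<Delta>_def by (rule lipschitz)
  finally have c0: "(norm c)\<^sup>2 \<le> L\<^sup>2 * (norm (x - xs))\<^sup>2"
    using power_mono[of "norm c" "L * norm (x - xs)" 2] by (simp add: power_mult_distrib)
  have "(norm (x - xs))\<^sup>2 \<le> 2 * ((norm a)\<^sup>2 + (norm b)\<^sup>2) + 2 * (norm (y - xs))\<^sup>2"
    using norm_add_sq_le[of 1 "x - y" "y - xs"] pythagoras[of "x - y"] by (simp add: a_def b_def)
  moreover have "0 \<le> (norm a)\<^sup>2" "0 \<le> (norm b)\<^sup>2" "0 \<le> (norm (y - xs))\<^sup>2" by auto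
  ultimately have "(norm (x - xs))\<^sup>2 \<le> 3 * Y" unfolding Y_def distrib_left by linarith
  with c0 have c: "(norm c)\<^sup>2 \<le> L\<^sup>2 * (3 * Y)"
    by (meson mult_left_mono order_trans zero_le_power2)
  have "(1 - p) * (norm (b - \<eta> *\<^sub>R c))\<^sup>2
      \<le> (1 - p) * ((1 + p / 2) * (norm b)\<^sup>2 + (1 + 1 / (p / 2)) * (norm (- (\<eta> *\<^sub>R c)))\<^sup>2)"
    using assms norm_add_sq_le[of "p / 2" b "- (\<eta> *\<^sub>R c)"] by (intro mult_left_mono) auto
  also have "\<dots> = ((1 - p) * (1 + p / 2)) * (norm b)\<^sup>2 + ((1 - p) * (1 + 2 / p)) * (\<eta>\<^sup>2 * (norm c)\<^sup>2)"
    by (simp add: power_mult_distrib algebra_simps)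
  also have "\<dots> \<le> (1 - p / 2) * (norm b)\<^sup>2 + 3 / p * (\<eta>\<^sup>2 * (L\<^sup>2 * (3 * Y)))"
  proof (intro add_mono mult_right_mono mult_mono)
    show "(1 - p) * (1 + p / 2) \<le> 1 - p / 2" using assms by (simp add: algebra_simps)
    show "(1 - p) * (1 + 2 / p) \<le> 3 / p" using assms by (simp add: field_simps)
  qed (use assms c in auto)
  also have "\<dots> = (1 - p / 2) * (norm b)\<^sup>2 + 9 * L\<^sup>2 * \<eta>\<^sup>2 / p * Y" by (simp add: mult_ac)
  finally show ?thesis unfolding c_def Y_def .
qed

end

text \<open>The vector \<open>h\<close> is the force that the accumulated normal displacement exerts on the tangent component,
per unit of step mass.\<close>

locale corrected_frame = projected_gradient_field P g H xs \<mu> L L'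
  for P g H :: "'a::euclidean_space \<Rightarrow> 'a" and xs \<mu> L L' +
  fixes m h :: 'a
  assumes P_m: "P m = m" and h_def: "h = P (H (g xs))"
begin

lemma P_h: "P h = h" unfolding h_def by (rule P_idem)

text \<open>The point to which an iterate is compared. The term \<open>s *\<^sub>R g xs\<close> is the displacement in the normal
direction since the last projection. The term \<open>(\<kappa> * s) *\<^sub>R h\<close> is a corrector of higher order: since \<open>s\<close>
decreases by \<open>p * s\<close> on average in one step, \<open>\<kappa> * s\<close> changes by \<open>- \<eta> * s\<close> on average, which
exchanges the random forcing of the tangent component for its mean.\<close>

definition centre :: "real \<Rightarrow> real \<Rightarrow> real \<Rightarrow> 'a" where
  "centre \<rho> \<kappa> s = xs + \<rho> *\<^sub>R m - (\<kappa> * s) *\<^sub>R h - s *\<^sub>R g xs"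

definition tangent_error :: "real \<Rightarrow> real \<Rightarrow> 'a \<Rightarrow> real \<Rightarrow> 'a" where
  "tangent_error \<rho> \<kappa> x s = P x - xs - \<rho> *\<^sub>R m + (\<kappa> * s) *\<^sub>R h"

definition normal_error :: "'a \<Rightarrow> real \<Rightarrow> 'a" where
  "normal_error x s = x - P x + s *\<^sub>R g xs"

lemmas P_simps = linear_add[OF linear_P] linear_diff[OF linear_P] linear_scale[OF linear_P]
  linear_neg[OF linear_P] P_xs P_m P_h P_grad_xs P_idem

lemma P_centre: "P (x - centre \<rho> \<kappa> s) = tangent_error \<rho> \<kappa> x s"
  by (simp add: centre_def tangent_error_def P_simps)

lemma minus_tangent_error: "x - centre \<rho> \<kappa> s - tangent_error \<rho> \<kappa> x s = normal_error x s"
  by (simp add: centre_def tangent_error_def normal_error_def)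

text \<open>What remains of the deterministic part of the tangent drift; it is of smaller order exactly when \<open>\<rho>\<close>
times \<open>m\<close> solves the averaged recursion to leading order.\<close>

definition defect :: "real \<Rightarrow> real \<Rightarrow> real \<Rightarrow> real \<Rightarrow> real \<Rightarrow> 'a" where
  "defect \<eta> p \<kappa> \<rho> \<rho>' = (\<kappa> * (1 - p) * \<eta>) *\<^sub>R h - (\<eta> * \<rho>) *\<^sub>R P (H m) - (\<rho>' - \<rho>) *\<^sub>R m"

text \<open>The mean of the tangent error after one step is a gradient step relative to the centre \<open>y\<close> plus an
explicit perturbation: the Taylor remainder at \<open>y\<close>, the Hessian acting on the corrector, the change of
the scale of the corrector, and the defect. The terms of order \<open>\<eta> * s\<close> cancel, which is the purpose of
the corrector.\<close>

lemma mean_tangent_step: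
  fixes s \<rho> \<rho>' \<kappa> \<kappa>' \<eta> p :: real and x :: 'a
  assumes "\<kappa> * p = \<eta>"
  defines "y \<equiv> centre \<rho> \<kappa> s"
  shows "P x - \<eta> *\<^sub>R P (g x) - xs - \<rho>' *\<^sub>R m + ((1 - p) * (\<kappa>' * (s + \<eta>))) *\<^sub>R h
    = P (x - y) - \<eta> *\<^sub>R P (g x - g y)
      + (- (\<eta> *\<^sub>R P (g y - g xs - H (y - xs))) + (\<eta> * \<kappa> * s) *\<^sub>R P (H h)
         + ((\<kappa>' - \<kappa>) * (1 - p) * (s + \<eta>)) *\<^sub>R h + defect \<eta> p \<kappa> \<rho> \<rho>')"
proof -
  have "y - xs = \<rho> *\<^sub>R m - (\<kappa> * s) *\<^sub>R h - s *\<^sub>R g xs" by (simp add: y_def centre_def)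
  then have PH: "P (H (y - xs)) = \<rho> *\<^sub>R P (H m) - (\<kappa> * s) *\<^sub>R P (H h) - s *\<^sub>R h"
    by (simp add: linear_diff[OF linear_H] linear_scale[OF linear_H] linear_diff[OF linear_P]
        linear_scale[OF linear_P] h_def[symmetric])
  have Px: "P (x - y) = P x - xs - \<rho> *\<^sub>R m + (\<kappa> * s) *\<^sub>R h"
    by (simp add: y_def P_centre tangent_error_def)
  have split: "P (g x - g y) = P (g x) - P (g y)" 
    "P (g y - g xs - H (y - xs)) = P (g y) - P (H (y - xs))"
    by (simp_all add: P_simps)
  show ?thesis
    unfolding split PH Px defect_def assms(1)[symmetric]
    by (simp add: algebra_simps)
qed

text \<open>The weight of the normal component in the Lyapunov function. The tangent estimate spends
\<open>K / 4 * \<eta>\<close> times the square of the normal component, and \<open>K * \<kappa>\<close> times the loss \<open>p / 2\<close> returns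
\<open>K / 2 * \<eta>\<close> of it.\<close>

definition K :: real where "K = 16 * L\<^sup>2 / \<mu> + 2 * \<mu>"

text \<open>The Lyapunov function. The normal component is contracted at a rate \<open>1 / \<kappa>\<close> times faster than the tangent
component and enters with a correspondingly small weight.\<close>

definition V :: "real \<Rightarrow> real \<Rightarrow> 'a \<Rightarrow> real \<Rightarrow> real" where
  "V \<rho> \<kappa> x s = (norm (tangent_error \<rho> \<kappa> x s))\<^sup>2 + K * \<kappa> * (norm (normal_error x s))\<^sup>2"

text \<open>The upper bounds on the scale under which all terms of higher order are absorbed.\<close>

definition small :: "real \<Rightarrow> bool" where
  "small \<kappa> \<longleftrightarrow> 0 < \<kappa> \<and> \<kappa> \<le> 1 \<and> \<kappa> * L\<^sup>2 \<le> \<mu> / 4 \<and> \<kappa> * \<mu> \<le> 1 / 4 \<and>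
     9 * L\<^sup>2 * \<kappa>\<^sup>2 \<le> 1 / 8 \<and> 9 * L\<^sup>2 * K * \<kappa>\<^sup>2 \<le> \<mu> / 2"

lemma K_nonneg: "0 \<le> K" using \<mu>_pos by (simp add: K_def)

lemma eventually_small:
  assumes "\<kappa> \<longlonglongrightarrow> 0" and "\<forall>\<^sub>F n in sequentially. 0 < \<kappa> n"
  shows "\<forall>\<^sub>F n in sequentially. small (\<kappa> n)"
proof -
  have lim: "(\<lambda>n. \<kappa> n * L\<^sup>2) \<longlonglongrightarrow> 0" "(\<lambda>n. \<kappa> n * \<mu>) \<longlonglongrightarrow> 0"
    "(\<lambda>n. 9 * L\<^sup>2 * (\<kappa> n)\<^sup>2) \<longlonglongrightarrow> 0" "(\<lambda>n. 9 * L\<^sup>2 * K * (\<kappa> n)\<^sup>2) \<longlonglongrightarrow> 0"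
    by (rule tendsto_eq_intros assms(1) refl | simp)+
  have "\<forall>\<^sub>F n in sequentially. \<kappa> n < 1" "\<forall>\<^sub>F n in sequentially. \<kappa> n * L\<^sup>2 < \<mu> / 4"
    "\<forall>\<^sub>F n in sequentially. \<kappa> n * \<mu> < 1 / 4" "\<forall>\<^sub>F n in sequentially. 9 * L\<^sup>2 * (\<kappa> n)\<^sup>2 < 1 / 8"
    "\<forall>\<^sub>F n in sequentially. 9 * L\<^sup>2 * K * (\<kappa> n)\<^sup>2 < \<mu> / 2"
    by (rule order_tendstoD(2)[OF assms(1)] order_tendstoD(2)[OF lim(1)] order_tendstoD(2)[OF lim(2)]
        order_tendstoD(2)[OF lim(3)] order_tendstoD(2)[OF lim(4)]; use \<mu>_pos in simp)+
  with assms(2) show ?thesis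
    by eventually_elim (auto simp: small_def)
qed

text \<open>Bounds the distance from the centre to \<open>xs\<close> in units of \<open>\<kappa> + s\<close>.\<close>

definition reach :: "real \<Rightarrow> real" where
  "reach c = c * norm m + norm h + norm (g xs)"

lemma norm_centre_le:
  assumes "0 \<le> \<rho>" "\<rho> \<le> c * \<kappa>" "0 < \<kappa>" "\<kappa> \<le> 1" "0 \<le> s"
  shows "(norm (centre \<rho> \<kappa> s - xs))\<^sup>2 \<le> 2 * (reach c)\<^sup>2 * (\<kappa>\<^sup>2 + s\<^sup>2)"
proof -
  have c: "0 \<le> c" using assms by (metis linorder_not_le mult_less_0_iff order_trans)
  have "norm (centre \<rho> \<kappa> s - xs) = norm (\<rho> *\<^sub>R m - (\<kappa> * s) *\<^sub>R h - s *\<^sub>R g xs)"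
    by (simp add: centre_def)
  also have "\<dots> \<le> \<rho> * norm m + \<kappa> * s * norm h + s * norm (g xs)"
    using assms by (intro order_trans[OF norm_triangle_ineq4] add_mono) auto
  also have "\<dots> \<le> (c * \<kappa>) * norm m + 1 * s * norm h + s * norm (g xs)"
    using assms by (intro add_mono mult_right_mono) auto
  also have "\<dots> \<le> reach c * \<kappa> + reach c * s"
    using assms c by (simp add: reach_def algebra_simps)
  finally have "(norm (centre \<rho> \<kappa> s - xs))\<^sup>2 \<le> (reach c * (\<kappa> + s))\<^sup>2"
    by (intro power_mono) (auto simp: distrib_left)
  also have "\<dots> = (reach c)\<^sup>2 * (\<kappa> + s)\<^sup>2" by (simp add: power_mult_distrib)
  also have "\<dots> \<le> (reach c)\<^sup>2 * (2 * (\<kappa>\<^sup>2 + s\<^sup>2))"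
    by (intro mult_left_mono) (use sum_squares_bound[of \<kappa> s] in \<open>auto simp: power2_sum\<close>)
  finally show ?thesis by (simp only: mult_ac)
qed

definition error_const :: "real \<Rightarrow> real" where
  "error_const c = L' * (2 * (reach c)\<^sup>2) + norm (P (H h)) + 2 * c * norm h"

text \<open>Every term of the perturbation carries the factor \<open>\<eta>\<close> and, apart from the defect, a quadratic expression
in \<open>\<kappa>\<close> and \<open>s\<close>; this is what makes it small against a drift of order \<open>\<eta> * \<kappa>\<close>.\<close>

lemma norm_drift_error_le:
  assumes \<rho>: "0 \<le> \<rho>" "\<rho> \<le> c * \<kappa>" and \<kappa>: "0 < \<kappa>" "\<kappa> \<le> 1" and s: "0 \<le> s"
    and \<eta>: "0 < \<eta>" "\<eta> \<le> \<kappa>" and p: "0 \<le> p" "p \<le> 1" and \<kappa>': "\<bar>\<kappa>' - \<kappa>\<bar> \<le> c * (\<kappa> * \<eta>)"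
    and d: "norm d \<le> \<eta> * \<kappa> * \<delta>"
  defines "y \<equiv> centre \<rho> \<kappa> s"
  shows "norm (- (\<eta> *\<^sub>R P (g y - g xs - H (y - xs))) + (\<eta> * \<kappa> * s) *\<^sub>R P (H h)
         + ((\<kappa>' - \<kappa>) * (1 - p) * (s + \<eta>)) *\<^sub>R h + d)
    \<le> \<eta> * (error_const c * (\<kappa>\<^sup>2 + s\<^sup>2) + \<kappa> * \<delta>)"
proof -
  have c: "0 \<le> c" using \<rho> \<kappa> by (metis linorder_not_le mult_less_0_iff order_trans)
  have ks: "\<kappa> * s \<le> \<kappa>\<^sup>2 + s\<^sup>2" 
    using sum_squares_bound[of \<kappa> s] mult_nonneg_nonneg[of \<kappa> s] \<kappa> s by linarith
  then have ks2: "\<kappa> * s + \<kappa>\<^sup>2 \<le> 2 * (\<kappa>\<^sup>2 + s\<^sup>2)"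
    using zero_le_power2[of s] unfolding distrib_left by linarith
  have R: "norm (\<eta> *\<^sub>R P (g y - g xs - H (y - xs))) \<le> \<eta> * (L' * (2 * (reach c)\<^sup>2) * (\<kappa>\<^sup>2 + s\<^sup>2))"
  proof -
    have "norm (P (g y - g xs - H (y - xs))) \<le> L' * (norm (y - xs))\<^sup>2"
      using norm_P_le taylor order_trans by blast
    also have "\<dots> \<le> L' * (2 * (reach c)\<^sup>2 * (\<kappa>\<^sup>2 + s\<^sup>2))"
      unfolding y_def using norm_centre_le[OF \<rho> \<kappa> s] L'_nonneg by (rule mult_left_mono)
    finally show ?thesis using \<eta> by (simp add: mult_left_mono mult.assoc)
  qed
  have S: "norm ((\<eta> * \<kappa> * s) *\<^sub>R P (H h)) \<le> \<eta> * (norm (P (H h)) * (\<kappa>\<^sup>2 + s\<^sup>2))"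
  proof -
    have "norm ((\<eta> * \<kappa> * s) *\<^sub>R P (H h)) = \<eta> * (norm (P (H h)) * (\<kappa> * s))"
      using \<eta> \<kappa> s by (simp add: mult_ac)
    also have "\<dots> \<le> \<eta> * (norm (P (H h)) * (\<kappa>\<^sup>2 + s\<^sup>2))"
      using ks \<eta> by (intro mult_left_mono) auto
    finally show ?thesis .
  qed
  have T: "norm (((\<kappa>' - \<kappa>) * (1 - p) * (s + \<eta>)) *\<^sub>R h) \<le> \<eta> * (2 * c * norm h * (\<kappa>\<^sup>2 + s\<^sup>2))"
  proof -
    have "\<bar>\<kappa>' - \<kappa>\<bar> * (1 - p) * (s + \<eta>) \<le> (c * (\<kappa> * \<eta>)) * 1 * (s + \<kappa>)"
      using \<kappa>' p s \<eta> \<kappa> c by (intro mult_mono) auto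
    also have "\<dots> = \<eta> * (c * (\<kappa> * s + \<kappa>\<^sup>2))" by (simp add: algebra_simps power2_eq_square)
    also have "\<dots> \<le> \<eta> * (c * (2 * (\<kappa>\<^sup>2 + s\<^sup>2)))"
      using ks2 \<eta> c by (intro mult_left_mono) auto
    finally have "\<bar>\<kappa>' - \<kappa>\<bar> * (1 - p) * (s + \<eta>) * norm h \<le> \<eta> * (c * (2 * (\<kappa>\<^sup>2 + s\<^sup>2))) * norm h"
      by (intro mult_right_mono) auto
    then show ?thesis using p s \<eta> by (simp add: abs_mult mult_ac)
  qed
  have "norm (- (\<eta> *\<^sub>R P (g y - g xs - H (y - xs))) + (\<eta> * \<kappa> * s) *\<^sub>R P (H h)
         + ((\<kappa>' - \<kappa>) * (1 - p) * (s + \<eta>)) *\<^sub>R h + d)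
    \<le> norm (\<eta> *\<^sub>R P (g y - g xs - H (y - xs))) + norm ((\<eta> * \<kappa> * s) *\<^sub>R P (H h))
       + norm (((\<kappa>' - \<kappa>) * (1 - p) * (s + \<eta>)) *\<^sub>R h) + norm d"
    by (metis (no_types, lifting) norm_triangle_mono norm_minus_cancel order_refl)
  also have "\<dots> \<le> \<eta> * (L' * (2 * (reach c)\<^sup>2) * (\<kappa>\<^sup>2 + s\<^sup>2)) + \<eta> * (norm (P (H h)) * (\<kappa>\<^sup>2 + s\<^sup>2))
      + \<eta> * (2 * c * norm h * (\<kappa>\<^sup>2 + s\<^sup>2)) + \<eta> * \<kappa> * \<delta>"
    by (intro add_mono R S T d)
  also have "\<dots> = \<eta> * (error_const c * (\<kappa>\<^sup>2 + s\<^sup>2) + \<kappa> * \<delta>)"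
    by (simp add: error_const_def algebra_simps)
  finally show ?thesis .
qed

definition remainder_const :: "real \<Rightarrow> real" where
  "remainder_const c = 20 / \<mu> * (error_const c)\<^sup>2 + 4 * (norm h)\<^sup>2 + 36 * L\<^sup>2 * K * (reach c)\<^sup>2"

text \<open>The Lyapunov function contracts at rate \<open>\<mu> / 2 * \<eta>\<close> when the gradient noise is averaged out. The left side
is the square of the mean tangent error, the variance that the random projection adds through the
corrector, and the weighted normal error.\<close>

lemma mean_drift:
  assumes \<rho>: "0 \<le> \<rho>" "\<rho> \<le> c * \<kappa>" and small: "small \<kappa>" and s: "0 \<le> s"
    and p: "0 < p" "p \<le> 1" and \<eta>: "\<kappa> * p = \<eta>"
    and \<kappa>': "0 \<le> \<kappa>'" "\<kappa>' \<le> \<kappa>" "\<bar>\<kappa>' - \<kappa>\<bar> \<le> c * (\<kappa> * \<eta>)"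
    and d: "norm (defect \<eta> p \<kappa> \<rho> \<rho>') \<le> \<eta> * \<kappa> * \<delta>"
  shows "(norm (P x - \<eta> *\<^sub>R P (g x) - xs - \<rho>' *\<^sub>R m + ((1 - p) * (\<kappa>' * (s + \<eta>))) *\<^sub>R h))\<^sup>2
      + p * (1 - p) * (\<kappa>' * (s + \<eta>))\<^sup>2 * (norm h)\<^sup>2
      + K * \<kappa>' * ((1 - p) * (norm (normal_error x s - \<eta> *\<^sub>R (g x - g xs - P (g x - g xs))))\<^sup>2)
    \<le> (1 - \<mu> / 2 * \<eta>) * V \<rho> \<kappa> x s + \<eta> * (remainder_const c * (\<kappa> ^ 3 + s ^ 4 / \<kappa>) + 20 / \<mu> * \<kappa>\<^sup>2 * \<delta>\<^sup>2)"
proof -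
  have k: "0 < \<kappa>" "\<kappa> \<le> 1" using small by (auto simp: small_def)
  have \<eta>_pos: "0 < \<eta>" and \<eta>_le: "\<eta> \<le> \<kappa>" using k p unfolding \<eta>[symmetric] by (auto simp: mult_left_le)
  define y where "y = centre \<rho> \<kappa> s"
  define e where "e = - (\<eta> *\<^sub>R P (g y - g xs - H (y - xs))) + (\<eta> * \<kappa> * s) *\<^sub>R P (H h)
         + ((\<kappa>' - \<kappa>) * (1 - p) * (s + \<eta>)) *\<^sub>R h + defect \<eta> p \<kappa> \<rho> \<rho>'"
  define A B where "A = (norm (tangent_error \<rho> \<kappa> x s))\<^sup>2" and "B = (norm (normal_error x s))\<^sup>2"
  have AB: "0 \<le> A" "0 \<le> B" by (auto simp: A_def B_def)
  define r where "r = \<kappa> ^ 3 + s ^ 4 / \<kappa>"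
  have r: "0 \<le> r" using k by (simp add: r_def)
  \<comment> \<open>All remainder terms are measured by \<open>r\<close>; lower powers of \<open>s\<close> are traded for the fourth by the arithmetic-geometric mean inequality.\<close>
  have r1: "\<kappa> * (\<kappa>\<^sup>2 + s\<^sup>2) \<le> 2 * r"
  proof -
    have "\<kappa> * s\<^sup>2 \<le> (\<kappa> ^ 3 + s ^ 4 / \<kappa>)"
    proof -
      have "\<kappa> * (\<kappa> * s\<^sup>2) = \<kappa>\<^sup>2 * s\<^sup>2" by (simp add: power2_eq_square)
      also have "\<dots> \<le> (\<kappa>\<^sup>2)\<^sup>2 + (s\<^sup>2)\<^sup>2"
        using sum_squares_bound[of "\<kappa>\<^sup>2" "s\<^sup>2"] mult_nonneg_nonneg[of "\<kappa>\<^sup>2" "s\<^sup>2"]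
        zero_le_power2[of \<kappa>] zero_le_power2[of s] by linarith
      also have "\<dots> = \<kappa> * (\<kappa> ^ 3 + s ^ 4 / \<kappa>)"
        using k by (simp add: distrib_left power_numeral_reduce)
      finally have "\<kappa> * (\<kappa> * s\<^sup>2) \<le> \<kappa> * (\<kappa> ^ 3 + s ^ 4 / \<kappa>)" .
      then show ?thesis using k by simp
    qed
    moreover have "0 \<le> s ^ 4 / \<kappa>" using k by simp
    ultimately show ?thesis by (simp add: r_def power2_eq_square power3_eq_cube algebra_simps)
  qed
  have r2: "(\<kappa>\<^sup>2 + s\<^sup>2)\<^sup>2 \<le> 2 * r"
  proof -
    have "(\<kappa>\<^sup>2 + s\<^sup>2)\<^sup>2 \<le> 2 * (\<kappa> ^ 4 + s ^ 4)"
      using sum_squares_bound[of "\<kappa>\<^sup>2" "s\<^sup>2"] by (simp add: power2_sum)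
    moreover have "\<kappa> ^ 4 \<le> \<kappa> ^ 3" using k by (simp add: power_decreasing)
    moreover have "s ^ 4 \<le> s ^ 4 / \<kappa>" using k by (simp add: pos_le_divide_eq mult_left_le)
    ultimately show ?thesis by (simp add: r_def)
  qed
  have e: "5 / (\<mu> * \<eta>) * (norm e)\<^sup>2 \<le> \<eta> * (20 / \<mu> * (error_const c)\<^sup>2 * r + 10 / \<mu> * \<kappa>\<^sup>2 * \<delta>\<^sup>2)"
  proof -
    have "norm e \<le> \<eta> * (error_const c * (\<kappa>\<^sup>2 + s\<^sup>2) + \<kappa> * \<delta>)"
      unfolding e_def y_def by (rule norm_drift_error_le) (use assms k \<eta>_pos \<eta>_le in auto)
    then have "(norm e)\<^sup>2 \<le> (\<eta> * (error_const c * (\<kappa>\<^sup>2 + s\<^sup>2) + \<kappa> * \<delta>))\<^sup>2" by (intro power_mono) auto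
    also have "\<dots> = \<eta>\<^sup>2 * (error_const c * (\<kappa>\<^sup>2 + s\<^sup>2) + \<kappa> * \<delta>)\<^sup>2" by (simp add: power_mult_distrib)
    also have "\<dots> \<le> \<eta>\<^sup>2 * (2 * ((error_const c)\<^sup>2 * (\<kappa>\<^sup>2 + s\<^sup>2)\<^sup>2) + 2 * (\<kappa>\<^sup>2 * \<delta>\<^sup>2))"
      using norm_add_sq_le[of 1 "error_const c * (\<kappa>\<^sup>2 + s\<^sup>2)" "\<kappa> * \<delta>"]
      by (intro mult_left_mono) (auto simp: power_mult_distrib)
    also have "\<dots> \<le> \<eta>\<^sup>2 * (2 * ((error_const c)\<^sup>2 * (2 * r)) + 2 * (\<kappa>\<^sup>2 * \<delta>\<^sup>2))"
      using r2 by (intro mult_left_mono add_right_mono) auto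
    finally have "5 / (\<mu> * \<eta>) * (norm e)\<^sup>2
        \<le> 5 / (\<mu> * \<eta>) * (\<eta>\<^sup>2 * (2 * ((error_const c)\<^sup>2 * (2 * r)) + 2 * (\<kappa>\<^sup>2 * \<delta>\<^sup>2)))"
      using \<mu>_pos \<eta>_pos by (intro mult_left_mono) auto
    also have "\<dots> = \<eta> * (20 / \<mu> * (error_const c)\<^sup>2 * r + 10 / \<mu> * \<kappa>\<^sup>2 * \<delta>\<^sup>2)"
      using \<mu>_pos \<eta>_pos by (simp add: field_simps power2_eq_square)
    finally show ?thesis .
  qed
  have tangent: "(norm (P x - \<eta> *\<^sub>R P (g x) - xs - \<rho>' *\<^sub>R m + ((1 - p) * (\<kappa>' * (s + \<eta>))) *\<^sub>R h))\<^sup>2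
      \<le> (1 - \<mu> * \<eta>) * A + K / 4 * \<eta> * B + 5 / (\<mu> * \<eta>) * (norm e)\<^sup>2"
  proof -
    have "\<eta> * L\<^sup>2 \<le> \<mu> / 4"
      using small mult_right_mono[OF \<eta>_le, of "L\<^sup>2"] by (auto simp: small_def)
    moreover have "\<eta> * \<mu> \<le> 1"
      using small mult_right_mono[OF \<eta>_le, of \<mu>] \<mu>_pos unfolding small_def by linarith
    ultimately have "(norm (tangent_error \<rho> \<kappa> x s - \<eta> *\<^sub>R P (g x - g y) + e))\<^sup>2
        \<le> (1 - \<mu> * \<eta>) * A + (4 * L\<^sup>2 / \<mu> + \<mu> / 2) * \<eta> * B + 5 / (\<mu> * \<eta>) * (norm e)\<^sup>2"
      using tangent_step[where \<eta> = \<eta> and x = x and y = y and e = e] \<eta>_pos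
      unfolding y_def minus_tangent_error P_centre A_def B_def by blast
    moreover have "P x - \<eta> *\<^sub>R P (g x) - xs - \<rho>' *\<^sub>R m + ((1 - p) * (\<kappa>' * (s + \<eta>))) *\<^sub>R h
        = tangent_error \<rho> \<kappa> x s - \<eta> *\<^sub>R P (g x - g y) + e"
      unfolding mean_tangent_step[OF \<eta>, where \<rho> = \<rho>] y_def e_def P_centre ..
    moreover have "4 * L\<^sup>2 / \<mu> + \<mu> / 2 = K / 4" by (simp add: K_def)
    ultimately show ?thesis by metis
  qed
  have normal: "(1 - p) * (norm (normal_error x s - \<eta> *\<^sub>R (g x - g xs - P (g x - g xs))))\<^sup>2
      \<le> (1 - p / 2) * B + 9 * L\<^sup>2 * (\<eta> * \<kappa>) * (A + B + 2 * (reach c)\<^sup>2 * (\<kappa>\<^sup>2 + s\<^sup>2))"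
  proof -
    have "\<eta>\<^sup>2 / p = \<eta> * \<kappa>" using p unfolding \<eta>[symmetric] by (simp add: power2_eq_square)
    then have "(1 - p) * (norm (normal_error x s - \<eta> *\<^sub>R (g x - g xs - P (g x - g xs))))\<^sup>2
      \<le> (1 - p / 2) * B + 9 * L\<^sup>2 * (\<eta> * \<kappa>) * (A + B + (norm (y - xs))\<^sup>2)"
      using normal_step[of \<eta> p x y] \<eta>_pos p
      unfolding y_def minus_tangent_error P_centre A_def B_def by (simp flip: times_divide_eq_right)
    also have "\<dots> \<le> (1 - p / 2) * B + 9 * L\<^sup>2 * (\<eta> * \<kappa>) * (A + B + 2 * (reach c)\<^sup>2 * (\<kappa>\<^sup>2 + s\<^sup>2))"
      using norm_centre_le[OF \<rho> k s] \<eta>_pos k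
      by (intro add_left_mono mult_left_mono) (auto simp: y_def)
    finally show ?thesis .
  qed
  have jump: "p * (1 - p) * (\<kappa>' * (s + \<eta>))\<^sup>2 * (norm h)\<^sup>2 \<le> \<eta> * (4 * (norm h)\<^sup>2 * r)"
  proof -
    have "(\<kappa>' * (s + \<eta>))\<^sup>2 \<le> (\<kappa> * (s + \<kappa>))\<^sup>2"
      using \<kappa>' \<eta>_le \<eta>_pos s by (intro power_mono mult_mono) auto
    also have "\<dots> = \<kappa>\<^sup>2 * (\<kappa> + s)\<^sup>2" by (simp add: power_mult_distrib add.commute)
    also have "\<dots> \<le> \<kappa>\<^sup>2 * (2 * (\<kappa>\<^sup>2 + s\<^sup>2))"
      by (intro mult_left_mono) (use sum_squares_bound[of \<kappa> s] in \<open>auto simp: power2_sum\<close>)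
    also have "\<dots> = 2 * \<kappa> * (\<kappa> * (\<kappa>\<^sup>2 + s\<^sup>2))" by (simp add: power2_eq_square)
    also have "\<dots> \<le> 2 * \<kappa> * (2 * r)" using r1 k by (intro mult_left_mono) auto
    finally have "(p * (1 - p)) * (\<kappa>' * (s + \<eta>))\<^sup>2 \<le> (p * 1) * (2 * \<kappa> * (2 * r))"
      using p by (intro mult_mono mult_left_mono) auto
    then have "(p * (1 - p)) * (\<kappa>' * (s + \<eta>))\<^sup>2 * (norm h)\<^sup>2 \<le> (p * 1) * (2 * \<kappa> * (2 * r)) * (norm h)\<^sup>2"
      by (intro mult_right_mono) auto
    then show ?thesis by (simp add: mult_ac flip: \<eta>)
  qed
  have weighted: "K * \<kappa>' * ((1 - p) * (norm (normal_error x s - \<eta> *\<^sub>R (g x - g xs - P (g x - g xs))))\<^sup>2)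
    \<le> K * \<kappa> * ((1 - p / 2) * B) + \<eta> * (\<mu> / 2) * A + K * \<eta> / 8 * B + \<eta> * (36 * L\<^sup>2 * K * (reach c)\<^sup>2 * r)"
  proof -
    have "K * \<kappa>' * ((1 - p) * (norm (normal_error x s - \<eta> *\<^sub>R (g x - g xs - P (g x - g xs))))\<^sup>2)
      \<le> K * \<kappa> * ((1 - p / 2) * B + 9 * L\<^sup>2 * (\<eta> * \<kappa>) * (A + B + 2 * (reach c)\<^sup>2 * (\<kappa>\<^sup>2 + s\<^sup>2)))"
      using \<kappa>' K_nonneg p normal by (intro mult_mono mult_left_mono) auto
    also have "\<dots> = K * \<kappa> * ((1 - p / 2) * B) + \<eta> * (9 * L\<^sup>2 * K * \<kappa>\<^sup>2) * A
        + K * \<eta> * (9 * L\<^sup>2 * \<kappa>\<^sup>2) * B + \<eta> * (18 * L\<^sup>2 * K * (reach c)\<^sup>2) * (\<kappa> * (\<kappa> * (\<kappa>\<^sup>2 + s\<^sup>2)))"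
      by (simp add: algebra_simps power2_eq_square)
    also have "\<dots> \<le> K * \<kappa> * ((1 - p / 2) * B) + \<eta> * (\<mu> / 2) * A
        + K * \<eta> * (1 / 8) * B + \<eta> * (18 * L\<^sup>2 * K * (reach c)\<^sup>2) * (1 * (2 * r))"
    proof (intro add_mono order_refl)
      show "\<eta> * (9 * L\<^sup>2 * K * \<kappa>\<^sup>2) * A \<le> \<eta> * (\<mu> / 2) * A"
        using small AB \<eta>_pos unfolding small_def by (intro mult_right_mono mult_left_mono) auto
      show "K * \<eta> * (9 * L\<^sup>2 * \<kappa>\<^sup>2) * B \<le> K * \<eta> * (1 / 8) * B"
        using small AB \<eta>_pos K_nonneg unfolding small_def by (intro mult_right_mono mult_left_mono) auto
      have "\<kappa> * (\<kappa> * (\<kappa>\<^sup>2 + s\<^sup>2)) \<le> 1 * (\<kappa> * (\<kappa>\<^sup>2 + s\<^sup>2))"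
        using k by (intro mult_right_mono) auto
      also have "\<dots> \<le> 1 * (2 * r)" using r1 by simp
      finally have "\<kappa> * (\<kappa> * (\<kappa>\<^sup>2 + s\<^sup>2)) \<le> 1 * (2 * r)" .
      then show "\<eta> * (18 * L\<^sup>2 * K * (reach c)\<^sup>2) * (\<kappa> * (\<kappa> * (\<kappa>\<^sup>2 + s\<^sup>2)))
          \<le> \<eta> * (18 * L\<^sup>2 * K * (reach c)\<^sup>2) * (1 * (2 * r))"
        using \<eta>_pos K_nonneg by (intro mult_left_mono) auto
    qed
    finally show ?thesis by simp
  qed
  have "K * \<eta> / 4 * B + K * \<kappa> * ((1 - p / 2) * B) + K * \<eta> / 8 * B \<le> (1 - \<mu> / 2 * \<eta>) * (K * \<kappa> * B)"
  proof -
    have "K * \<kappa> * ((1 - p / 2) * B) = K * \<kappa> * B - 1 / 2 * (K * \<eta> * B)"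
      unfolding \<eta>[symmetric] by (simp add: algebra_simps)
    moreover have "(K * \<eta> * B) * (\<kappa> * \<mu>) \<le> (K * \<eta> * B) * (1 / 4)"
      using small K_nonneg \<eta>_pos AB by (intro mult_left_mono) (auto simp: small_def)
    moreover have "(1 - \<mu> / 2 * \<eta>) * (K * \<kappa> * B) = K * \<kappa> * B - 1 / 2 * ((K * \<eta> * B) * (\<kappa> * \<mu>))"
      by (simp add: algebra_simps)
    moreover have "K * \<eta> / 4 * B + K * \<eta> / 8 * B = 3 / 8 * (K * \<eta> * B)" by simp
    ultimately show ?thesis by linarith
  qed
  moreover have "K / 4 * \<eta> * B = K * \<eta> / 4 * B" by simp
  moreover have "\<eta> * (10 / \<mu> * \<kappa>\<^sup>2 * \<delta>\<^sup>2) \<le> \<eta> * (20 / \<mu> * \<kappa>\<^sup>2 * \<delta>\<^sup>2)"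
    using \<mu>_pos \<eta>_pos by (intro mult_left_mono mult_right_mono divide_right_mono) auto
  moreover have "V \<rho> \<kappa> x s = A + K * \<kappa> * B" by (simp add: V_def A_def B_def)
  ultimately show ?thesis
    using tangent weighted jump e unfolding remainder_const_def r_def[symmetric]
    by (simp add: algebra_simps)
qed

end

section \<open>Averaging over one random step\<close>

lemma (in prob_space) mean_square_shift:
  fixes \<psi> :: "'a \<Rightarrow> 'b::euclidean_space"
  assumes int: "integrable M \<psi>" and mean: "(LINT z|M. \<psi> z) = 0"
    and sq: "integrable M (\<lambda>z. (norm (\<psi> z))\<^sup>2)"
  shows "integrable M (\<lambda>z. (norm (c + \<psi> z))\<^sup>2)"
    and "(LINT z|M. (norm (c + \<psi> z))\<^sup>2) = (norm c)\<^sup>2 + (LINT z|M. (norm (\<psi> z))\<^sup>2)"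
proof -
  have expand: "(norm (c + \<psi> z))\<^sup>2 = (norm c)\<^sup>2 + 2 * (\<psi> z \<bullet> c) + (norm (\<psi> z))\<^sup>2" for z
    unfolding power2_norm_eq_inner by (simp add: inner_add_left inner_add_right inner_commute)
  have inner: "integrable M (\<lambda>z. \<psi> z \<bullet> c)" "(LINT z|M. \<psi> z \<bullet> c) = 0"
    using int mean by simp_all
  show "integrable M (\<lambda>z. (norm (c + \<psi> z))\<^sup>2)"
    unfolding expand using inner sq by auto
  show "(LINT z|M. (norm (c + \<psi> z))\<^sup>2) = (norm c)\<^sup>2 + (LINT z|M. (norm (\<psi> z))\<^sup>2)"
    unfolding expand using inner sq by (simp add: prob_space)
qed

lemma (in prob_space) mean_square_shift_contraction:
  fixes \<xi> :: "'a \<Rightarrow> 'b::euclidean_space"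
  assumes int: "integrable M \<xi>" and mean: "(LINT z|M. \<xi> z) = 0"
    and sq: "integrable M (\<lambda>z. (norm (\<xi> z))\<^sup>2)"
    and T: "linear (T :: 'b \<Rightarrow> 'b)" "\<And>v. norm (T v) \<le> norm v"
  shows "integrable M (\<lambda>z. (norm (c + t *\<^sub>R T (\<xi> z)))\<^sup>2)"
    and "(LINT z|M. (norm (c + t *\<^sub>R T (\<xi> z)))\<^sup>2) \<le> (norm c)\<^sup>2 + t\<^sup>2 * (LINT z|M. (norm (\<xi> z))\<^sup>2)"
proof -
  have bl: "bounded_linear T" using T(1) by (rule linear_conv_bounded_linear[THEN iffD1])
  have meas [measurable]: "\<xi> \<in> borel_measurable M" "T \<in> borel_measurable borel"
    using int T(1) by (auto intro: borel_measurable_continuous_onI linear_continuous_on bl)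
  have \<psi>: "integrable M (\<lambda>z. t *\<^sub>R T (\<xi> z))" "(LINT z|M. t *\<^sub>R T (\<xi> z)) = 0"
    using integrable_bounded_linear[OF bl int] integral_bounded_linear[OF bl int]
    by (auto simp: mean linear_0[OF T(1)])
  have le: "(norm (t *\<^sub>R T (\<xi> z)))\<^sup>2 \<le> t\<^sup>2 * (norm (\<xi> z))\<^sup>2" for z
    using T(2)[of "\<xi> z"] by (simp add: power_mult_distrib mult_left_mono power_mono)
  have sq\<psi>: "integrable M (\<lambda>z. (norm (t *\<^sub>R T (\<xi> z)))\<^sup>2)"
  proof (rule Bochner_Integration.integrable_bound)
    show "integrable M (\<lambda>z. t\<^sup>2 * (norm (\<xi> z))\<^sup>2)" using sq by simp
    show "(\<lambda>z. (norm (t *\<^sub>R T (\<xi> z)))\<^sup>2) \<in> borel_measurable M" by measurable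
    show "AE z in M. norm ((norm (t *\<^sub>R T (\<xi> z)))\<^sup>2) \<le> norm (t\<^sup>2 * (norm (\<xi> z))\<^sup>2)"
      using le by simp
  qed
  show "integrable M (\<lambda>z. (norm (c + t *\<^sub>R T (\<xi> z)))\<^sup>2)"
    using \<psi> sq\<psi> by (rule mean_square_shift(1))
  have "(LINT z|M. (norm (t *\<^sub>R T (\<xi> z)))\<^sup>2) \<le> (LINT z|M. t\<^sup>2 * (norm (\<xi> z))\<^sup>2)"
    using sq sq\<psi> le by (intro integral_mono) auto
  then show "(LINT z|M. (norm (c + t *\<^sub>R T (\<xi> z)))\<^sup>2) \<le> (norm c)\<^sup>2 + t\<^sup>2 * (LINT z|M. (norm (\<xi> z))\<^sup>2)"
    using mean_square_shift(2)[OF \<psi> sq\<psi>, of c] by simp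
qed

context corrected_frame
begin

text \<open>Averaging over the coin toss: the two outcomes of the tangent error differ by the jump of the corrector,
so the mean square is the square of the mean plus the Bernoulli variance of the jump, and the normal
error survives only if there is no projection.\<close>

lemma V_after_step:
  fixes s \<rho>' \<kappa>' \<eta> p :: real and x \<xi> :: 'a
  defines "x' \<equiv> x - \<eta> *\<^sub>R (g x - \<xi>)"
  shows "p * V \<rho>' \<kappa>' (P x') 0 + (1 - p) * V \<rho>' \<kappa>' x' (s + \<eta>)
    = (norm (P x - \<eta> *\<^sub>R P (g x) - xs - \<rho>' *\<^sub>R m + ((1 - p) * (\<kappa>' * (s + \<eta>))) *\<^sub>R h + \<eta> *\<^sub>R P \<xi>))\<^sup>2
      + p * (1 - p) * (\<kappa>' * (s + \<eta>))\<^sup>2 * (norm h)\<^sup>2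
      + K * \<kappa>' * ((1 - p) * (norm (normal_error x s - \<eta> *\<^sub>R (g x - g xs - P (g x - g xs)) + \<eta> *\<^sub>R (\<xi> - P \<xi>)))\<^sup>2)"
proof -
  define u where "u = P x - \<eta> *\<^sub>R P (g x) - xs - \<rho>' *\<^sub>R m + \<eta> *\<^sub>R P \<xi>"
  define v where "v = (\<kappa>' * (s + \<eta>)) *\<^sub>R h"
  define b where "b = normal_error x s - \<eta> *\<^sub>R (g x - g xs - P (g x - g xs)) + \<eta> *\<^sub>R (\<xi> - P \<xi>)"
  have "tangent_error \<rho>' \<kappa>' (P x') 0 = u" "tangent_error \<rho>' \<kappa>' x' (s + \<eta>) = u + v"
    unfolding tangent_error_def x'_def u_def v_def by (simp_all add: P_simps algebra_simps)
  moreover have "normal_error (P x') 0 = 0" "normal_error x' (s + \<eta>) = b"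
    unfolding normal_error_def x'_def b_def by (simp_all add: P_simps algebra_simps)
  ultimately have "p * V \<rho>' \<kappa>' (P x') 0 + (1 - p) * V \<rho>' \<kappa>' x' (s + \<eta>)
      = (p * (norm u)\<^sup>2 + (1 - p) * (norm (u + v))\<^sup>2) + K * \<kappa>' * ((1 - p) * (norm b)\<^sup>2)"
    unfolding V_def by (simp add: algebra_simps)
  also have "p * (norm u)\<^sup>2 + (1 - p) * (norm (u + v))\<^sup>2
      = (norm (u + (1 - p) *\<^sub>R v))\<^sup>2 + p * (1 - p) * (norm v)\<^sup>2"
    by (rule two_point_bias_variance)
  also have "u + (1 - p) *\<^sub>R v
      = P x - \<eta> *\<^sub>R P (g x) - xs - \<rho>' *\<^sub>R m + ((1 - p) * (\<kappa>' * (s + \<eta>))) *\<^sub>R h + \<eta> *\<^sub>R P \<xi>"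
    by (simp add: u_def v_def)
  also have "(norm v)\<^sup>2 = (\<kappa>' * (s + \<eta>))\<^sup>2 * (norm h)\<^sup>2"
    by (simp add: v_def power_mult_distrib)
  finally show ?thesis by (simp add: b_def mult.assoc)
qed

lemma V_nonneg: "0 \<le> \<kappa> \<Longrightarrow> 0 \<le> V \<rho> \<kappa> x s"
  using K_nonneg by (simp add: V_def)

text \<open>Centred noise adds only its variance to the mean square, and neither projection increases it. The bound
is linear in the Lyapunov function at the current state, so it can be integrated over that state.\<close>

lemma averaged_drift:
  fixes \<xi> :: "'z \<Rightarrow> 'a" and x :: 'a
  assumes "prob_space D" and int: "integrable D \<xi>" and mean: "(LINT z|D. \<xi> z) = 0"
    and sq: "integrable D (\<lambda>z. (norm (\<xi> z))\<^sup>2)"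
    and \<rho>: "0 \<le> \<rho>" "\<rho> \<le> c * \<kappa>" and small: "small \<kappa>" and s: "0 \<le> s"
    and p: "0 < p" "p \<le> 1" and \<eta>: "\<kappa> * p = \<eta>"
    and \<kappa>': "0 \<le> \<kappa>'" "\<kappa>' \<le> \<kappa>" "\<bar>\<kappa>' - \<kappa>\<bar> \<le> c * (\<kappa> * \<eta>)"
    and d: "norm (defect \<eta> p \<kappa> \<rho> \<rho>') \<le> \<eta> * \<kappa> * \<delta>"
  defines "x' \<equiv> \<lambda>z. x - \<eta> *\<^sub>R (g x - \<xi> z)"
  shows "(\<integral>\<^sup>+z. ennreal (p * V \<rho>' \<kappa>' (P (x' z)) 0 + (1 - p) * V \<rho>' \<kappa>' (x' z) (s + \<eta>)) \<partial>D)
    \<le> ennreal ((1 - \<mu> / 2 * \<eta>) * V \<rho> \<kappa> x s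
        + \<eta> * (remainder_const c * (\<kappa> ^ 3 + s ^ 4 / \<kappa>) + 20 / \<mu> * \<kappa>\<^sup>2 * \<delta>\<^sup>2)
        + (1 + K) * \<eta>\<^sup>2 * (LINT z|D. (norm (\<xi> z))\<^sup>2))"
proof -
  interpret D: prob_space D by fact
  define \<sigma>2 where "\<sigma>2 = (LINT z|D. (norm (\<xi> z))\<^sup>2)"
  define a where "a = P x - \<eta> *\<^sub>R P (g x) - xs - \<rho>' *\<^sub>R m + ((1 - p) * (\<kappa>' * (s + \<eta>))) *\<^sub>R h"
  define b where "b = normal_error x s - \<eta> *\<^sub>R (g x - g xs - P (g x - g xs))"
  define j where "j = p * (1 - p) * (\<kappa>' * (s + \<eta>))\<^sup>2 * (norm h)\<^sup>2"
  define Q where "Q v = v - P v" for v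
  have Q: "linear Q" "norm (Q v) \<le> norm v" for v
    unfolding Q_def by (auto intro: linear_compose_sub linear_id[unfolded id_def] linear_P norm_coP_le)
  note tangent = D.mean_square_shift_contraction[OF int mean sq linear_P norm_P_le, of a \<eta>]
  note normal = D.mean_square_shift_contraction[OF int mean sq Q, of b \<eta>]
  have \<kappa>1: "\<kappa>' \<le> 1" using \<kappa>' small by (auto simp: small_def)
  have eq: "p * V \<rho>' \<kappa>' (P (x' z)) 0 + (1 - p) * V \<rho>' \<kappa>' (x' z) (s + \<eta>)
      = (norm (a + \<eta> *\<^sub>R P (\<xi> z)))\<^sup>2 + j + K * \<kappa>' * ((1 - p) * (norm (b + \<eta> *\<^sub>R Q (\<xi> z)))\<^sup>2)" for z
    unfolding x'_def a_def b_def j_def Q_def by (rule V_after_step)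
  have intV: "integrable D (\<lambda>z. p * V \<rho>' \<kappa>' (P (x' z)) 0 + (1 - p) * V \<rho>' \<kappa>' (x' z) (s + \<eta>))"
    unfolding eq using tangent(1) normal(1) by auto
  have "(\<integral>\<^sup>+z. ennreal (p * V \<rho>' \<kappa>' (P (x' z)) 0 + (1 - p) * V \<rho>' \<kappa>' (x' z) (s + \<eta>)) \<partial>D)
      = ennreal (LINT z|D. p * V \<rho>' \<kappa>' (P (x' z)) 0 + (1 - p) * V \<rho>' \<kappa>' (x' z) (s + \<eta>))"
    using intV p \<kappa>'(1)
    by (intro nn_integral_eq_integral) (auto intro!: AE_I2 add_nonneg_nonneg mult_nonneg_nonneg V_nonneg)
  also have "(LINT z|D. p * V \<rho>' \<kappa>' (P (x' z)) 0 + (1 - p) * V \<rho>' \<kappa>' (x' z) (s + \<eta>))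
      = (LINT z|D. (norm (a + \<eta> *\<^sub>R P (\<xi> z)))\<^sup>2) + j
        + K * \<kappa>' * ((1 - p) * (LINT z|D. (norm (b + \<eta> *\<^sub>R Q (\<xi> z)))\<^sup>2))"
    unfolding eq using tangent(1) normal(1) by (simp add: D.prob_space)
  also have "\<dots> \<le> ((norm a)\<^sup>2 + \<eta>\<^sup>2 * \<sigma>2) + j
        + K * \<kappa>' * ((1 - p) * ((norm b)\<^sup>2 + \<eta>\<^sup>2 * \<sigma>2))"
    using tangent(2) normal(2) p \<kappa>' K_nonneg unfolding \<sigma>2_def
    by (intro add_mono mult_left_mono order_refl) auto
  also have "\<dots> = ((norm a)\<^sup>2 + j + K * \<kappa>' * ((1 - p) * (norm b)\<^sup>2)) + (1 + K * (\<kappa>' * (1 - p))) * (\<eta>\<^sup>2 * \<sigma>2)"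
    by (simp add: algebra_simps)
  also have "\<dots> \<le> ((1 - \<mu> / 2 * \<eta>) * V \<rho> \<kappa> x s
        + \<eta> * (remainder_const c * (\<kappa> ^ 3 + s ^ 4 / \<kappa>) + 20 / \<mu> * \<kappa>\<^sup>2 * \<delta>\<^sup>2)) + (1 + K * 1) * (\<eta>\<^sup>2 * \<sigma>2)"
  proof (rule add_mono)
    show "(norm a)\<^sup>2 + j + K * \<kappa>' * ((1 - p) * (norm b)\<^sup>2) \<le> (1 - \<mu> / 2 * \<eta>) * V \<rho> \<kappa> x s
        + \<eta> * (remainder_const c * (\<kappa> ^ 3 + s ^ 4 / \<kappa>) + 20 / \<mu> * \<kappa>\<^sup>2 * \<delta>\<^sup>2)"
      unfolding a_def b_def j_def by (rule mean_drift) (use assms in auto)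
    have "\<kappa>' * (1 - p) \<le> 1" using \<kappa>1 \<kappa>' p by (intro mult_le_one) auto
    moreover have "0 \<le> \<eta>\<^sup>2 * \<sigma>2" unfolding \<sigma>2_def by simp
    ultimately show "(1 + K * (\<kappa>' * (1 - p))) * (\<eta>\<^sup>2 * \<sigma>2) \<le> (1 + K * 1) * (\<eta>\<^sup>2 * \<sigma>2)"
      using K_nonneg by (intro mult_right_mono add_left_mono mult_left_mono)
  qed
  finally show ?thesis unfolding \<sigma>2_def by (simp add: ennreal_leI mult.assoc)
qed

end

section \<open>Joint measurability of the stochastic gradient\<close>

text \<open>Approximating the identity by simple functions reduces joint measurability to countably many sections.\<close>

lemma borel_measurable_caratheodory:
  fixes F :: "'a::euclidean_space \<Rightarrow> 'z \<Rightarrow> 'b::metric_space"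
  assumes cont: "\<And>z. z \<in> space D \<Longrightarrow> continuous_on UNIV (\<lambda>y. F y z)"
    and meas: "\<And>y. F y \<in> borel_measurable D"
  shows "(\<lambda>(y, z). F y z) \<in> borel_measurable (borel \<Otimes>\<^sub>M D)"
proof -
  have "(\<lambda>y::'a. y) \<in> borel_measurable borel" by simp
  from borel_measurable_implies_sequence_metric[OF this, of undefined]
  obtain \<pi> :: "nat \<Rightarrow> 'a \<Rightarrow> 'a" where simple: "\<And>n. simple_function borel (\<pi> n)"
    and lim: "\<And>y. (\<lambda>n. \<pi> n y) \<longlonglongrightarrow> y" by auto
  show ?thesis
  proof (rule borel_measurable_LIMSEQ_metric)
    fix n
    have "(\<lambda>yz. F (\<pi> n (fst yz)) (snd yz)) \<in> borel_measurable (borel \<Otimes>\<^sub>M D)"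
    proof (rule measurable_compose_countable'[where I = "range (\<pi> n)" and f = "\<lambda>i yz. F i (snd yz)"])
      show "(\<lambda>yz. F i (snd yz)) \<in> borel_measurable (borel \<Otimes>\<^sub>M D)" for i
        using meas[of i] by measurable
      have "\<pi> n \<in> borel \<rightarrow>\<^sub>M count_space (range (\<pi> n))"
        using simple[of n] by (auto simp: simple_function_def intro: measurable_count_space_eq2[THEN iffD2])
      then show "(\<lambda>yz. \<pi> n (fst yz)) \<in> borel \<Otimes>\<^sub>M D \<rightarrow>\<^sub>M count_space (range (\<pi> n))"
        by measurable
      show "countable (range (\<pi> n))"
        using simple[of n] by (auto simp: simple_function_def intro: countable_finite)
    qed
    then show "(\<lambda>(y, z). F (\<pi> n y) z) \<in> borel_measurable (borel \<Otimes>\<^sub>M D)"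
      by (simp add: split_beta')
  next
    fix yz assume "yz \<in> space (borel \<Otimes>\<^sub>M D :: ('a \<times> 'z) measure)"
    then obtain y z where yz: "yz = (y, z)" "z \<in> space D" by (auto simp: space_pair_measure)
    have "isCont (\<lambda>y. F y z) y"
      using cont[OF yz(2)] by (simp add: continuous_on_eq_continuous_at)
    from isCont_tendsto_compose[OF this lim]
    show "(\<lambda>n. case yz of (y, z) \<Rightarrow> F (\<pi> n y) z) \<longlonglongrightarrow> (case yz of (y, z) \<Rightarrow> F y z)"
      by (simp add: yz)
  qed
qed

text \<open>The gradient is a limit of difference quotients of a function that is continuous in the first and
measurable in the second argument.\<close>

lemma borel_measurable_gradient:
  fixes F :: "'a::euclidean_space \<Rightarrow> 'z \<Rightarrow> real"
  assumes grad: "\<And>y z. z \<in> space D \<Longrightarrow> GDERIV (\<lambda>y. F y z) y :> G y z"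
    and meas: "\<And>y. F y \<in> borel_measurable D"
  shows "(\<lambda>(y, z). G y z) \<in> borel_measurable (borel \<Otimes>\<^sub>M D)"
proof -
  have F [measurable]: "(\<lambda>(y, z). F y z) \<in> borel_measurable (borel \<Otimes>\<^sub>M D)"
    using grad meas
    by (intro borel_measurable_caratheodory differentiable_imp_continuous_on)
       (auto simp: differentiable_on_def differentiable_def gderiv_def)
  have "(\<lambda>yz. (case yz of (y, z) \<Rightarrow> G y z) \<bullet> b) \<in> borel_measurable (borel \<Otimes>\<^sub>M D)" for b :: 'a
  proof (rule borel_measurable_LIMSEQ_real)
    fix n
    have "(\<lambda>yz. (fst yz + (1 / Suc n) *\<^sub>R b, snd yz)) \<in> (borel \<Otimes>\<^sub>M D) \<rightarrow>\<^sub>M (borel \<Otimes>\<^sub>M D)"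
      by measurable
    from measurable_compose[OF this F]
    show "(\<lambda>(y, z). (F (y + (1 / Suc n) *\<^sub>R b) z - F y z) * Suc n) \<in> borel_measurable (borel \<Otimes>\<^sub>M D)"
      by (simp add: split_beta')
  next
    fix yz assume "yz \<in> space (borel \<Otimes>\<^sub>M D :: ('a \<times> 'z) measure)"
    then obtain y z where yz: "yz = (y, z)" "z \<in> space D" by (auto simp: space_pair_measure)
    have "((\<lambda>t. F (y + t *\<^sub>R b) z) has_derivative (\<lambda>t. (t *\<^sub>R b) \<bullet> G y z)) (at 0)"
      using grad[OF yz(2)] unfolding gderiv_def by (rule has_derivative_along_line)
    then have "((\<lambda>t. F (y + t *\<^sub>R b) z) has_field_derivative (G y z \<bullet> b)) (at 0)"
      by (rule has_derivative_imp_has_field_derivative) (simp add: inner_commute)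
    then have "((\<lambda>t. (F (y + t *\<^sub>R b) z - F y z) / t) \<longlongrightarrow> G y z \<bullet> b) (at 0)"
      by (simp add: has_field_derivative_iff)
    moreover have "filterlim (\<lambda>n. 1 / real (Suc n)) (at 0) sequentially"
      unfolding filterlim_at using LIMSEQ_Suc[OF lim_1_over_n] by simp
    ultimately have "(\<lambda>n. (F (y + (1 / Suc n) *\<^sub>R b) z - F y z) / (1 / real (Suc n))) \<longlonglongrightarrow> G y z \<bullet> b"
      by (rule filterlim_compose)
    then show "(\<lambda>n. case yz of (y, z) \<Rightarrow> (F (y + (1 / Suc n) *\<^sub>R b) z - F y z) * Suc n)
        \<longlonglongrightarrow> (case yz of (y, z) \<Rightarrow> G y z) \<bullet> b"
      by (simp add: yz)
  qed
  then show ?thesis by (subst borel_measurable_euclidean_space) auto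
qed


section \<open>The iterates as a Markov chain\<close>

locale random_projection_chain = M: prob_space M + D: prob_space D
  for M :: "'w measure" and D :: "'z measure" +
  fixes \<zeta> :: "nat \<Rightarrow> 'w \<Rightarrow> 'z" and \<omega> :: "nat \<Rightarrow> 'w \<Rightarrow> bool" and p \<eta> :: "nat \<Rightarrow> real"
    and G :: "'a::euclidean_space \<Rightarrow> 'z \<Rightarrow> 'a" and P :: "'a \<Rightarrow> 'a"
    and x :: "nat \<Rightarrow> 'w \<Rightarrow> 'a" and x1 :: 'a
  assumes G_measurable: "(\<lambda>(y, z). G y z) \<in> borel_measurable (borel \<Otimes>\<^sub>M D)"
    and P_measurable: "P \<in> borel_measurable borel"
    and \<zeta>_measurable: "1 \<le> n \<Longrightarrow> \<zeta> n \<in> measurable M D"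
    and \<zeta>_distr: "1 \<le> n \<Longrightarrow> distr M D (\<zeta> n) = D"
    and \<omega>_measurable: "1 \<le> n \<Longrightarrow> \<omega> n \<in> measurable M (count_space UNIV)"
    and \<omega>_distr: "1 \<le> n \<Longrightarrow> distr M (count_space UNIV) (\<omega> n) = measure_pmf (bernoulli_pmf (p n))"
    and p_range: "0 \<le> p n" "p n \<le> 1"
    and indep: "lpsa_indep M D \<zeta> \<omega>"
    and x_init: "w \<in> space M \<Longrightarrow> x 1 w = x1"
    and x_step: "1 \<le> n \<Longrightarrow> w \<in> space M \<Longrightarrow> x (Suc n) w =
      (if \<omega> n w then P (x n w - \<eta> n *\<^sub>R G (x n w) (\<zeta> n w)) else x n w - \<eta> n *\<^sub>R G (x n w) (\<zeta> n w))"
begin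

text \<open>The step mass since the last projection. It starts at \<open>0\<close> at time \<open>1\<close>, which is also what the
equation for \<open>Suc n\<close> gives at \<open>n = 0\<close>.\<close>

primrec s :: "nat \<Rightarrow> 'w \<Rightarrow> real" where
  "s 0 w = 0"
| "s (Suc n) w = (if 1 \<le> n \<and> \<not> \<omega> n w then s n w + \<eta> n else 0)"

definition gens :: "nat + nat \<Rightarrow> 'w set set" where
  "gens = case_sum (\<lambda>n. {\<zeta> n -` S \<inter> space M |S. S \<in> sets D})
    (\<lambda>n. {\<omega> n -` B \<inter> space M |B. B \<in> sets (count_space UNIV)})"

definition samples :: "(nat + nat) set" where "samples = Inl ` {1..} \<union> Inr ` {1..}"

text \<open>The space \<open>M\<close> with the sigma-algebra that is generated by the samples in \<open>J\<close> alone.\<close>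

definition info :: "(nat + nat) set \<Rightarrow> 'w measure" where
  "info J = sigma (space M) (\<Union>i\<in>J. gens i)"

lemma gens_Pow: "(\<Union>i\<in>J. gens i) \<subseteq> Pow (space M)"
  by (auto simp: gens_def split: sum.splits)

lemma space_info [simp]: "space (info J) = space M"
  unfolding info_def using gens_Pow by (rule space_measure_of)

lemma sets_info: "sets (info J) = sigma_sets (space M) (\<Union>i\<in>J. gens i)"
  unfolding info_def using gens_Pow by (rule sets_measure_of)

lemma \<zeta>_info: "Inl n \<in> J \<Longrightarrow> J \<subseteq> samples \<Longrightarrow> \<zeta> n \<in> measurable (info J) D"
proof (rule measurableI)
  assume J: "Inl n \<in> J" "J \<subseteq> samples"
  then have n: "1 \<le> n" by (auto simp: samples_def)
  show "\<zeta> n w \<in> space D" if "w \<in> space (info J)" for w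
    using measurable_space[OF \<zeta>_measurable[OF n]] that by simp
  show "\<zeta> n -` S \<inter> space (info J) \<in> sets (info J)" if "S \<in> sets D" for S
    unfolding sets_info space_info using J that
    by (intro sigma_sets.Basic UN_I[of "Inl n"]) (auto simp: gens_def)
qed

lemma \<omega>_info: "Inr n \<in> J \<Longrightarrow> \<omega> n \<in> measurable (info J) (count_space UNIV)"
proof (rule measurableI)
  assume J: "Inr n \<in> J"
  show "\<omega> n -` B \<inter> space (info J) \<in> sets (info J)" if "B \<in> sets (count_space UNIV)" for B
    unfolding sets_info space_info using J that
    by (intro sigma_sets.Basic UN_I[of "Inr n"]) (auto simp: gens_def)
qed simp

lemma info_subalgebra: "J \<subseteq> samples \<Longrightarrow> sets (info J) \<subseteq> sets M"
  unfolding sets_info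
proof (rule sets.sigma_sets_subset, rule UN_least)
  fix i assume "J \<subseteq> samples" "i \<in> J"
  then have "i \<in> samples" by blast
  then show "gens i \<subseteq> sets M"
    using measurable_sets[OF \<zeta>_measurable] measurable_sets[OF \<omega>_measurable]
    by (auto simp: samples_def gens_def)
qed

lemma measurable_info_M: "J \<subseteq> samples \<Longrightarrow> X \<in> measurable (info J) N \<Longrightarrow> X \<in> measurable M N"
  using info_subalgebra[of J] by (auto simp: measurable_def)

text \<open>Functions of disjoint sets of samples are independent, stated as a product of distributions because
the two codomains may differ.\<close>

lemma distr_pair_disjoint_info:
  assumes J: "J1 \<subseteq> samples" "J2 \<subseteq> samples" "J1 \<inter> J2 = {}"
    and X: "X \<in> measurable (info J1) N1" and Y: "Y \<in> measurable (info J2) N2"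
  shows "distr M (N1 \<Otimes>\<^sub>M N2) (\<lambda>w. (X w, Y w)) = distr M N1 X \<Otimes>\<^sub>M distr M N2 Y"
proof -
  have "M.indep_sets gens samples"
    using indep by (simp add: lpsa_indep_def gens_def samples_def)
  then have gens: "M.indep_sets gens (\<Union>j\<in>UNIV. case_bool J1 J2 j)"
    by (rule M.indep_sets_mono_index[rotated]) (use J in \<open>auto simp: UNIV_bool\<close>)
  have "M.indep_sets (\<lambda>j. sigma_sets (space M) (\<Union>i\<in>case_bool J1 J2 j. gens i)) UNIV"
  proof (rule M.indep_sets_collect_sigma[OF gens])
    show "disjoint_family_on (case_bool J1 J2) UNIV"
      using J by (auto simp: disjoint_family_on_def split: bool.splits)
    fix i :: "nat + nat"
    show "Int_stable (gens i)"
    proof (cases i)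
      case (Inl n)
      show ?thesis unfolding Inl gens_def Int_stable_def sum.case
      proof safe
        fix S S' assume "S \<in> sets D" "S' \<in> sets D"
        then show "\<exists>T. \<zeta> n -` S \<inter> space M \<inter> (\<zeta> n -` S' \<inter> space M) = \<zeta> n -` T \<inter> space M \<and> T \<in> sets D"
          by (intro exI[of _ "S \<inter> S'"]) auto
      qed
    next
      case (Inr n)
      show ?thesis unfolding Inr gens_def Int_stable_def sum.case
      proof safe
        fix S S' :: "bool set"
        show "\<exists>T. \<omega> n -` S \<inter> space M \<inter> (\<omega> n -` S' \<inter> space M) = \<omega> n -` T \<inter> space M
            \<and> T \<in> sets (count_space UNIV)"
          by (intro exI[of _ "S \<inter> S'"]) auto
      qed
    qed
  qed
  moreover have "(\<lambda>j. sigma_sets (space M) (\<Union>i\<in>case_bool J1 J2 j. gens i))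
      = case_bool (sets (info J1)) (sets (info J2))"
    by (auto simp: sets_info split: bool.splits)
  ultimately have ind: "M.indep_set (sets (info J1)) (sets (info J2))"
    by (simp add: M.indep_set_def)
  have XM [measurable]: "X \<in> measurable M N1" and YM [measurable]: "Y \<in> measurable M N2"
    using measurable_info_M J X Y by blast+
  have "distr M N1 X \<Otimes>\<^sub>M distr M N2 Y = distr M (N1 \<Otimes>\<^sub>M N2) (\<lambda>w. (X w, Y w))"
  proof (rule pair_measure_eqI)
    show "sigma_finite_measure (distr M N1 X)" "sigma_finite_measure (distr M N2 Y)"
      by (simp_all add: M.prob_space_distr prob_space_imp_sigma_finite)
    show "sets (distr M N1 X \<Otimes>\<^sub>M distr M N2 Y) = sets (distr M (N1 \<Otimes>\<^sub>M N2) (\<lambda>w. (X w, Y w)))"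
      by (simp cong: sets_pair_measure_cong)
    fix A B assume "A \<in> sets (distr M N1 X)" "B \<in> sets (distr M N2 Y)"
    then have AB [measurable]: "A \<in> sets N1" "B \<in> sets N2" by simp_all
    define a b where "a = X -` A \<inter> space M" and "b = Y -` B \<inter> space M"
    have "a \<in> sets (info J1)" "b \<in> sets (info J2)"
      using measurable_sets[OF X AB(1)] measurable_sets[OF Y AB(2)] by (simp_all add: a_def b_def)
    then have "M.prob (a \<inter> b) = M.prob a * M.prob b"
      by (rule M.indep_setD[OF ind])
    moreover have "(\<lambda>w. (X w, Y w)) -` (A \<times> B) \<inter> space M = a \<inter> b"
      by (auto simp: a_def b_def)
    ultimately show "emeasure (distr M N1 X) A * emeasure (distr M N2 Y) B
        = emeasure (distr M (N1 \<Otimes>\<^sub>M N2) (\<lambda>w. (X w, Y w))) (A \<times> B)"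
      by (simp add: emeasure_distr M.emeasure_eq_measure ennreal_mult flip: a_def b_def)
  qed
  then show ?thesis ..
qed

definition past :: "nat \<Rightarrow> (nat + nat) set" where "past n = Inl ` {1..<n} \<union> Inr ` {1..<n}"

lemma past_samples: "past n \<subseteq> samples" by (auto simp: past_def samples_def)

lemma state_past:
  assumes "1 \<le> k" "k \<le> n"
  shows "(\<lambda>w. (x k w, s k w)) \<in> measurable (info (past n)) (borel \<Otimes>\<^sub>M borel)"
  using assms
proof (induction k rule: dec_induct)
  case base
  have "(\<lambda>w. (x1, 0)) \<in> measurable (info (past n)) (borel \<Otimes>\<^sub>M (borel :: real measure))" by simp
  then show ?case
    by (rule measurable_cong[THEN iffD1, rotated]) (simp add: x_init[simplified])
next
  case (step k)
  have st: "(\<lambda>w. (x k w, s k w)) \<in> measurable (info (past n)) (borel \<Otimes>\<^sub>M borel)"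
    using step by simp
  have x [measurable]: "x k \<in> borel_measurable (info (past n))"
    using measurable_compose[OF st measurable_fst] by simp
  have s [measurable]: "s k \<in> borel_measurable (info (past n))"
    using measurable_compose[OF st measurable_snd] by simp
  have z [measurable]: "\<zeta> k \<in> measurable (info (past n)) D"
    using step past_samples by (intro \<zeta>_info) (auto simp: past_def)
  have o [measurable]: "\<omega> k \<in> measurable (info (past n)) (count_space UNIV)"
    using step by (intro \<omega>_info) (auto simp: past_def)
  have G [measurable]: "(\<lambda>w. G (x k w) (\<zeta> k w)) \<in> borel_measurable (info (past n))"
    using measurable_compose[OF measurable_Pair[OF x z] G_measurable] by simp
  note P_measurable [measurable]
  have "(\<lambda>w. (if \<omega> k w then P (x k w - \<eta> k *\<^sub>R G (x k w) (\<zeta> k w)) else x k w - \<eta> k *\<^sub>R G (x k w) (\<zeta> k w),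
      s (Suc k) w)) \<in> measurable (info (past n)) (borel \<Otimes>\<^sub>M borel)"
    unfolding s.simps by measurable
  then show ?case
    by (rule measurable_cong[THEN iffD1, rotated]) (use step in \<open>simp add: x_step\<close>)
qed

lemma state_measurable:
  assumes "1 \<le> n"
  shows "(\<lambda>w. (x n w, s n w)) \<in> measurable M (borel \<Otimes>\<^sub>M borel)"
    and "x n \<in> borel_measurable M" and "s n \<in> borel_measurable M"
proof -
  show st: "(\<lambda>w. (x n w, s n w)) \<in> measurable M (borel \<Otimes>\<^sub>M borel)"
    using state_past[OF assms order_refl] past_samples by (rule measurable_info_M[rotated])
  show "x n \<in> borel_measurable M" using measurable_compose[OF st measurable_fst] by simp
  show "s n \<in> borel_measurable M" using measurable_compose[OF st measurable_snd] by simp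
qed

lemma joint_distr:
  assumes n: "1 \<le> n"
  shows "distr M ((borel \<Otimes>\<^sub>M borel) \<Otimes>\<^sub>M (D \<Otimes>\<^sub>M count_space UNIV)) (\<lambda>w. ((x n w, s n w), (\<zeta> n w, \<omega> n w)))
    = distr M (borel \<Otimes>\<^sub>M borel) (\<lambda>w. (x n w, s n w))
      \<Otimes>\<^sub>M (D \<Otimes>\<^sub>M distr M (count_space UNIV) (\<omega> n))"
proof -
  have sub: "{Inl n, Inr n} \<subseteq> samples" using n by (auto simp: samples_def)
  have z: "\<zeta> n \<in> measurable (info {Inl n, Inr n}) D" "\<zeta> n \<in> measurable (info {Inl n}) D"
    using sub by (auto intro!: \<zeta>_info)
  have o: "\<omega> n \<in> measurable (info {Inl n, Inr n}) (count_space UNIV)"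
    "\<omega> n \<in> measurable (info {Inr n}) (count_space UNIV)"
    by (auto intro!: \<omega>_info)
  have "distr M ((borel \<Otimes>\<^sub>M borel) \<Otimes>\<^sub>M (D \<Otimes>\<^sub>M count_space UNIV)) (\<lambda>w. ((x n w, s n w), (\<zeta> n w, \<omega> n w)))
    = distr M (borel \<Otimes>\<^sub>M borel) (\<lambda>w. (x n w, s n w))
      \<Otimes>\<^sub>M distr M (D \<Otimes>\<^sub>M count_space UNIV) (\<lambda>w. (\<zeta> n w, \<omega> n w))"
    by (rule distr_pair_disjoint_info[OF past_samples sub _ state_past[OF n order_refl] measurable_Pair[OF z(1) o(1)]])
      (auto simp: past_def)
  moreover have "distr M (D \<Otimes>\<^sub>M count_space UNIV) (\<lambda>w. (\<zeta> n w, \<omega> n w))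
      = distr M D (\<zeta> n) \<Otimes>\<^sub>M distr M (count_space UNIV) (\<omega> n)"
    by (rule distr_pair_disjoint_info[OF _ _ _ z(2) o(2)]) (use sub in auto)
  ultimately show ?thesis
    using \<zeta>_distr[OF n] by simp
qed

text \<open>The Markov property: the current state is a function of past samples, so the new samples can be
integrated out with the state held fixed.\<close>

lemma nn_integral_transition:
  assumes n: "1 \<le> n"
    and \<phi>: "(\<lambda>((y, t), (z, b)). \<phi> y t z b) \<in> borel_measurable ((borel \<Otimes>\<^sub>M borel) \<Otimes>\<^sub>M (D \<Otimes>\<^sub>M count_space UNIV))"
  shows "(\<integral>\<^sup>+w. \<phi> (x n w) (s n w) (\<zeta> n w) (\<omega> n w) \<partial>M)
    = (\<integral>\<^sup>+w. (\<integral>\<^sup>+z. \<phi> (x n w) (s n w) z True * p n + \<phi> (x n w) (s n w) z False * (1 - p n) \<partial>D) \<partial>M)"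
proof -
  let ?N = "borel \<Otimes>\<^sub>M borel :: ('a \<times> real) measure" and ?C = "count_space UNIV :: bool measure"
  let ?B = "distr M ?C (\<omega> n)" and ?S = "distr M ?N (\<lambda>w. (x n w, s n w))"
  define \<Phi> where "\<Phi> = (\<lambda>((y, t), (z, b)). \<phi> y t z b)"
  have \<Phi>: "\<Phi> \<in> borel_measurable (?N \<Otimes>\<^sub>M (D \<Otimes>\<^sub>M ?C))" using \<phi> by (simp add: \<Phi>_def)
  note [measurable] = state_measurable(1)[OF n] \<zeta>_measurable[OF n] \<omega>_measurable[OF n]
  interpret B: prob_space ?B by (rule M.prob_space_distr) simp
  interpret S: prob_space ?S by (rule M.prob_space_distr) simp
  interpret DB: pair_prob_space D ?B ..
  have sets: "sets (?S \<Otimes>\<^sub>M (D \<Otimes>\<^sub>M ?B)) = sets (?N \<Otimes>\<^sub>M (D \<Otimes>\<^sub>M ?C))"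
    by (intro sets_pair_measure_cong) auto
  have \<Phi>': "\<Phi> \<in> borel_measurable (?S \<Otimes>\<^sub>M (D \<Otimes>\<^sub>M ?B))"
    using \<Phi> measurable_cong_sets[OF sets refl] by blast
  have "(\<lambda>(u, z). \<Phi> (u, z, b)) \<in> borel_measurable (?N \<Otimes>\<^sub>M D)" for b
    using measurable_compose[of "\<lambda>(u, z). (u, z, b)" "?N \<Otimes>\<^sub>M D" _ \<Phi>, OF _ \<Phi>] by (simp add: split_beta')
  from this[of True] this[of False]
  have inner: "(\<lambda>u. \<integral>\<^sup>+z. \<Phi> (u, z, True) * p n + \<Phi> (u, z, False) * (1 - p n) \<partial>D) \<in> borel_measurable ?N"
    by (intro D.borel_measurable_nn_integral) (simp add: split_beta')
  have "(\<integral>\<^sup>+w. \<phi> (x n w) (s n w) (\<zeta> n w) (\<omega> n w) \<partial>M)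
      = (\<integral>\<^sup>+v. \<Phi> v \<partial>distr M (?N \<Otimes>\<^sub>M (D \<Otimes>\<^sub>M ?C)) (\<lambda>w. ((x n w, s n w), (\<zeta> n w, \<omega> n w))))"
    using \<Phi> by (subst nn_integral_distr) (auto simp: \<Phi>_def)
  also have "\<dots> = (\<integral>\<^sup>+v. \<Phi> v \<partial>(?S \<Otimes>\<^sub>M (D \<Otimes>\<^sub>M ?B)))"
    by (simp only: joint_distr[OF n])
  also have "\<dots> = (\<integral>\<^sup>+u. (\<integral>\<^sup>+zb. \<Phi> (u, zb) \<partial>(D \<Otimes>\<^sub>M ?B)) \<partial>?S)"
    using \<Phi>' by (rule DB.P.nn_integral_fst[symmetric])
  also have "\<dots> = (\<integral>\<^sup>+u. (\<integral>\<^sup>+z. \<Phi> (u, z, True) * p n + \<Phi> (u, z, False) * (1 - p n) \<partial>D) \<partial>?S)"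
  proof (intro nn_integral_cong)
    fix u assume u: "u \<in> space ?S"
    have "(\<lambda>zb. \<Phi> (u, zb)) \<in> borel_measurable (D \<Otimes>\<^sub>M ?B)"
      using \<Phi>' u by (rule measurable_Pair2)
    then have "(\<integral>\<^sup>+zb. \<Phi> (u, zb) \<partial>(D \<Otimes>\<^sub>M ?B)) = (\<integral>\<^sup>+z. (\<integral>\<^sup>+b. \<Phi> (u, z, b) \<partial>?B) \<partial>D)"
      by (rule B.nn_integral_fst[symmetric])
    also have "\<dots> = (\<integral>\<^sup>+z. \<Phi> (u, z, True) * p n + \<Phi> (u, z, False) * (1 - p n) \<partial>D)"
      using p_range by (simp add: \<omega>_distr[OF n])
    finally show "(\<integral>\<^sup>+zb. \<Phi> (u, zb) \<partial>(D \<Otimes>\<^sub>M ?B)) = \<dots>" .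
  qed
  also have "\<dots> = (\<integral>\<^sup>+w. (\<integral>\<^sup>+z. \<Phi> ((x n w, s n w), z, True) * p n
      + \<Phi> ((x n w, s n w), z, False) * (1 - p n) \<partial>D) \<partial>M)"
    using inner by (subst nn_integral_distr) simp_all
  finally show ?thesis by (simp add: \<Phi>_def)
qed

end

section \<open>Convergence of the Lyapunov function\<close>

locale lpsa_process =
  step_sizes \<eta>0 \<alpha> \<beta> \<gamma> +
  corrected_frame P g H xs \<mu> L L' m h +
  random_projection_chain M D \<zeta> \<omega> "step_sizes.p \<eta>0 \<alpha> \<beta> \<gamma>" "step_sizes.\<eta> \<eta>0 \<alpha>" G P x x1
  for \<eta>0 \<alpha> \<beta> \<gamma> :: real
    and P g H :: "'a::euclidean_space \<Rightarrow> 'a" and xs :: 'a and \<mu> L L' :: real and m h :: 'a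
    and M :: "'w measure" and D :: "'z measure"
    and \<zeta> :: "nat \<Rightarrow> 'w \<Rightarrow> 'z" and \<omega> :: "nat \<Rightarrow> 'w \<Rightarrow> bool"
    and G :: "'a \<Rightarrow> 'z \<Rightarrow> 'a" and x :: "nat \<Rightarrow> 'w \<Rightarrow> 'a" and x1 :: 'a +
  fixes N :: real
  assumes G_integrable: "integrable D (G y)"
    and G_unbiased: "(LINT z|D. G y z) = g y"
    and G_square_integrable: "integrable D (\<lambda>z. (norm (G y z))\<^sup>2)"
    and noise_bound: "1 \<le> n \<Longrightarrow>
      (\<integral>\<^sup>+w. ennreal ((norm (g (x n w) - G (x n w) (\<zeta> n w)))\<^sup>2) \<partial>M) \<le> ennreal N"
    and N_nonneg: "0 \<le> N"
    and \<eta>0_large: "2 * of_bool (\<alpha> = 1) / \<mu> < \<eta>0"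
    and m_equation: "P (H m) - \<nu> *\<^sub>R m = (1 / \<gamma>) *\<^sub>R h"
begin

lemma s_nonneg: "0 \<le> s n w"
  by (induction n) (auto simp: \<eta>_nonneg)

lemma s_le: "s n w \<le> (\<Sum>k<n. \<eta> k)"
proof (induction n)
  case (Suc n)
  have "0 \<le> (\<Sum>k<n. \<eta> k)" by (intro sum_nonneg) (auto simp: \<eta>_nonneg)
  with Suc \<eta>_nonneg[of n] show ?case by auto
qed simp

lemma s_poly_integrable: "1 \<le> n \<Longrightarrow> integrable M (\<lambda>w. (s n w + c) ^ k)"
proof -
  assume n: "1 \<le> n"
  note [measurable] = state_measurable(3)[OF n]
  show ?thesis
  proof (rule M.integrable_const_bound)
    show "AE w in M. norm ((s n w + c) ^ k) \<le> ((\<Sum>k<n. \<eta> k) + \<bar>c\<bar>) ^ k"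
    proof (rule AE_I2)
      fix w
      have "\<bar>s n w + c\<bar> \<le> (\<Sum>k<n. \<eta> k) + \<bar>c\<bar>" using s_nonneg[of n w] s_le[of n w] by linarith
      then show "norm ((s n w + c) ^ k) \<le> ((\<Sum>k<n. \<eta> k) + \<bar>c\<bar>) ^ k"
        by (simp add: power_abs power_mono)
    qed
  qed measurable
qed

text \<open>The coin toss is independent of the accumulated mass.\<close>

lemma s_fourth_step:
  assumes n: "1 \<le> n"
  shows "(LINT w|M. s (Suc n) w ^ 4) = (1 - p n) * (LINT w|M. (s n w + \<eta> n) ^ 4)"
proof -
  have "(\<integral>\<^sup>+w. ennreal (s (Suc n) w ^ 4) \<partial>M)
      = (\<integral>\<^sup>+w. (\<lambda>y t z b. ennreal ((if b then 0 else t + \<eta> n) ^ 4)) (x n w) (s n w) (\<zeta> n w) (\<omega> n w) \<partial>M)"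
    using n by (intro nn_integral_cong) auto
  also have "\<dots> = (\<integral>\<^sup>+w. (\<integral>\<^sup>+z. ennreal ((s n w + \<eta> n) ^ 4) * ennreal (1 - p n) \<partial>D) \<partial>M)"
    by (subst nn_integral_transition[OF n]) (auto simp: split_beta')
  also have "\<dots> = (\<integral>\<^sup>+w. ennreal ((1 - p n) * (s n w + \<eta> n) ^ 4) \<partial>M)"
    using p_bounds[of n] by (intro nn_integral_cong)
      (simp add: D.emeasure_space_1 mult.commute flip: ennreal_mult)
  finally have eq: "(\<integral>\<^sup>+w. ennreal (s (Suc n) w ^ 4) \<partial>M)
      = (\<integral>\<^sup>+w. ennreal ((1 - p n) * (s n w + \<eta> n) ^ 4) \<partial>M)" .
  have int: "integrable M (\<lambda>w. s (Suc n) w ^ 4)" "integrable M (\<lambda>w. (s n w + \<eta> n) ^ 4)"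
    using s_poly_integrable[of "Suc n" 0 4] s_poly_integrable[OF n, of "\<eta> n" 4] by auto
  have "(LINT w|M. s (Suc n) w ^ 4) = enn2real (\<integral>\<^sup>+w. ennreal (s (Suc n) w ^ 4) \<partial>M)"
    using int(1) by (intro integral_eq_nn_integral borel_measurable_integrable AE_I2) simp_all
  also have "\<dots> = (LINT w|M. (1 - p n) * (s n w + \<eta> n) ^ 4)"
    unfolding eq using int(2) p_bounds[of n]
    by (intro integral_eq_nn_integral[symmetric] borel_measurable_integrable AE_I2) simp_all
  finally show ?thesis by simp
qed

definition fourth_moment :: "nat \<Rightarrow> real" where "fourth_moment n = (LINT w|M. s n w ^ 4)"

text \<open>By induction: the recursion leaves a quarter of the loss \<open>p\<close> unused, and this pays for the decay of \<open>\<kappa>\<close>.\<close>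

lemma fourth_moment_bound: "\<exists>C\<ge>0. \<forall>\<^sub>F n in sequentially. fourth_moment n \<le> C * \<kappa> n ^ 4"
proof -
  obtain n0 where n0: "\<And>n. n0 \<le> n \<Longrightarrow> 1 \<le> n \<and> \<kappa> n * p n = \<eta> n \<and> (1 - p n / 4) * \<kappa> n ^ 4 \<le> \<kappa> (Suc n) ^ 4"
    using eventually_conj[OF eventually_ge_at_top[of 1] eventually_conj[OF eventually_p_\<kappa> \<kappa>_fourth_ratio]]
    unfolding eventually_sequentially by blast
  \<comment> \<open>A quarter of \<open>2048\<close> is the constant \<open>512\<close> of the moment recursion; the other entry starts the induction.\<close>
  define C where "C = max 2048 (fourth_moment n0 / \<kappa> n0 ^ 4)"
  have "fourth_moment n \<le> C * \<kappa> n ^ 4" if "n0 \<le> n" for n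
    using that
  proof (induction n rule: dec_induct)
    case base
    have "0 < \<kappa> n0 ^ 4" using n0[of n0] \<kappa>_pos[of n0] by simp
    then show ?case by (simp add: C_def flip: pos_divide_le_eq)
  next
    case (step n)
    have n: "1 \<le> n" "\<kappa> n * p n = \<eta> n" using n0 step by auto
    have p: "0 < p n" "p n \<le> 1" using p_pos n p_bounds by auto
    have int: "integrable M (\<lambda>w. s n w ^ 4)" "integrable M (\<lambda>w. (s n w + \<eta> n) ^ 4)"
      using s_poly_integrable[OF n(1), of 0 4] s_poly_integrable[OF n(1), of "\<eta> n" 4] by auto
    have "fourth_moment (Suc n) = (LINT w|M. (1 - p n) * (s n w + \<eta> n) ^ 4)"
      unfolding fourth_moment_def s_fourth_step[OF n(1)] by simp
    also have "\<dots> \<le> (LINT w|M. (1 - p n / 2) * s n w ^ 4 + 512 * \<eta> n ^ 4 / p n ^ 3)"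
      using int p s_nonneg \<eta>_nonneg by (intro integral_mono fourth_power_reset_step) auto
    also have "\<dots> = (1 - p n / 2) * fourth_moment n + 512 * \<eta> n ^ 4 / p n ^ 3"
      using int by (simp add: fourth_moment_def M.prob_space)
    also have "512 * \<eta> n ^ 4 / p n ^ 3 = 512 * p n * \<kappa> n ^ 4"
      unfolding n(2)[symmetric] using p by (simp add: power_mult_distrib power_numeral_reduce)
    also have "(1 - p n / 2) * fourth_moment n + 512 * p n * \<kappa> n ^ 4 \<le> (1 - p n / 2) * (C * \<kappa> n ^ 4) + (C / 4) * p n * \<kappa> n ^ 4"
      using step p by (intro add_mono mult_left_mono mult_right_mono) (auto simp: C_def)
    also have "\<dots> = C * ((1 - p n / 4) * \<kappa> n ^ 4)" by (simp add: algebra_simps)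
    also have "\<dots> \<le> C * \<kappa> (Suc n) ^ 4"
      using n0[of n] step by (intro mult_left_mono) (auto simp: C_def)
    finally show ?case .
  qed
  then show ?thesis
    unfolding eventually_sequentially by (intro exI[of _ C]) (auto simp: C_def)
qed

lemma g_measurable [measurable]: "g \<in> borel_measurable borel"
proof -
  have "(\<lambda>y. LINT z|D. G y z) \<in> borel_measurable borel"
    using G_measurable by (rule D.borel_measurable_lebesgue_integral)
  then show ?thesis by (simp add: G_unbiased)
qed

lemma noise_state_measurable [measurable]: "(\<lambda>(y, z). g y - G y z) \<in> borel_measurable (borel \<Otimes>\<^sub>M D)"
proof -
  note [measurable] = G_measurable
  have "(\<lambda>yz. g (fst yz) - (case yz of (y, z) \<Rightarrow> G y z)) \<in> borel_measurable (borel \<Otimes>\<^sub>M D)" by measurable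
  then show ?thesis by (simp add: split_beta')
qed

lemma noise_centred:
  "integrable D (\<lambda>z. g y - G y z)" "(LINT z|D. g y - G y z) = 0"
  using G_integrable[of y] by (simp_all add: G_unbiased D.prob_space)

lemma noise_square_integrable: "integrable D (\<lambda>z. (norm (g y - G y z))\<^sup>2)"
proof (rule Bochner_Integration.integrable_bound)
  show "integrable D (\<lambda>z. 2 * (norm (g y))\<^sup>2 + 2 * (norm (G y z))\<^sup>2)"
    using G_square_integrable[of y] by simp
  show "(\<lambda>z. (norm (g y - G y z))\<^sup>2) \<in> borel_measurable D"
    using noise_centred(1)[of y] by measurable
  show "AE z in D. norm ((norm (g y - G y z))\<^sup>2) \<le> norm (2 * (norm (g y))\<^sup>2 + 2 * (norm (G y z))\<^sup>2)"
    using norm_add_sq_le[of 1 "g y" "- G y _"] by (intro AE_I2) simp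
qed

definition \<sigma>2 :: "'a \<Rightarrow> real" where "\<sigma>2 y = (LINT z|D. (norm (g y - G y z))\<^sup>2)"

lemma \<sigma>2_nonneg: "0 \<le> \<sigma>2 y" by (simp add: \<sigma>2_def)

lemma \<sigma>2_measurable [measurable]: "\<sigma>2 \<in> borel_measurable borel"
  unfolding \<sigma>2_def[abs_def]
  by (rule D.borel_measurable_lebesgue_integral) (use noise_state_measurable in \<open>simp add: split_beta'\<close>)

text \<open>The conditional second moment of the noise integrates to the unconditional one.\<close>

lemma \<sigma>2_state:
  assumes n: "1 \<le> n"
  shows "integrable M (\<lambda>w. \<sigma>2 (x n w))" and "(LINT w|M. \<sigma>2 (x n w)) \<le> N"
proof -
  note [measurable] = state_measurable(2)[OF n]
  have "(\<integral>\<^sup>+w. ennreal (\<sigma>2 (x n w)) \<partial>M)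
      = (\<integral>\<^sup>+w. (\<integral>\<^sup>+z. ennreal ((norm (g (x n w) - G (x n w) z))\<^sup>2) \<partial>D) \<partial>M)"
    unfolding \<sigma>2_def by (intro nn_integral_cong nn_integral_eq_integral[symmetric] noise_square_integrable) auto
  also have "\<dots> = (\<integral>\<^sup>+w. (\<integral>\<^sup>+z. (\<lambda>y t z b. ennreal ((norm (g y - G y z))\<^sup>2)) (x n w) (s n w) z True * p n
      + (\<lambda>y t z b. ennreal ((norm (g y - G y z))\<^sup>2)) (x n w) (s n w) z False * (1 - p n) \<partial>D) \<partial>M)"
    using p_bounds[of n] by (intro nn_integral_cong) (simp flip: distrib_left ennreal_plus)
  also have "\<dots> = (\<integral>\<^sup>+w. ennreal ((norm (g (x n w) - G (x n w) (\<zeta> n w)))\<^sup>2) \<partial>M)"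
  proof (rule nn_integral_transition[OF n, symmetric])
    have "(\<lambda>v. (fst (fst v), fst (snd v))) \<in> ((borel \<Otimes>\<^sub>M borel) \<Otimes>\<^sub>M (D \<Otimes>\<^sub>M count_space UNIV)) \<rightarrow>\<^sub>M (borel \<Otimes>\<^sub>M D :: ('a \<times> 'z) measure)"
      by measurable
    from measurable_compose[OF this noise_state_measurable]
    show "(\<lambda>((y, t), z, b). ennreal ((norm (g y - G y z))\<^sup>2))
        \<in> borel_measurable ((borel \<Otimes>\<^sub>M borel) \<Otimes>\<^sub>M (D \<Otimes>\<^sub>M count_space UNIV))"
      by (simp add: split_beta')
  qed
  also have "\<dots> \<le> ennreal N" using n by (rule noise_bound)
  finally have le: "(\<integral>\<^sup>+w. ennreal (\<sigma>2 (x n w)) \<partial>M) \<le> ennreal N" .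
  show int: "integrable M (\<lambda>w. \<sigma>2 (x n w))"
    using le by (intro integrableI_nonneg) (auto simp: \<sigma>2_nonneg intro: le_less_trans)
  show "(LINT w|M. \<sigma>2 (x n w)) \<le> N"
    using le N_nonneg by (subst integral_eq_nn_integral) (auto simp: \<sigma>2_nonneg intro: enn2real_leI)
qed

text \<open>One step enlarges the distance to the minimiser at most linearly, up to square integrable noise.\<close>

lemma x_square_integrable: "1 \<le> n \<Longrightarrow> integrable M (\<lambda>w. (norm (x n w - xs))\<^sup>2)"
proof (induction n rule: dec_induct)
  case base
  have "integrable M (\<lambda>w. (norm (x 1 w - xs))\<^sup>2) \<longleftrightarrow> integrable M (\<lambda>w. (norm (x1 - xs))\<^sup>2)"
    by (intro Bochner_Integration.integrable_cong refl) (simp only: x_init)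
  then show ?case by simp
next
  case (step n)
  note [measurable] = state_measurable(2)[OF step(1)] state_measurable(2)[of "Suc n"] \<zeta>_measurable[OF step(1)]
  define \<xi> where "\<xi> w = g (x n w) - G (x n w) (\<zeta> n w)" for w
  have [measurable]: "\<xi> \<in> borel_measurable M"
    unfolding \<xi>_def[abs_def]
    using measurable_compose[OF measurable_Pair[OF state_measurable(2)[OF step(1)] \<zeta>_measurable[OF step(1)]]
        noise_state_measurable] by simp
  have int\<xi>: "integrable M (\<lambda>w. (norm (\<xi> w))\<^sup>2)"
    using noise_bound[OF step(1)] by (intro integrableI_nonneg) (auto simp: \<xi>_def intro: le_less_trans)
  define B where "B w = 4 * ((1 + \<eta> n * L)\<^sup>2 * (norm (x n w - xs))\<^sup>2) + 4 * (\<eta> n * norm (g xs))\<^sup>2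
      + 2 * ((\<eta> n)\<^sup>2 * (norm (\<xi> w))\<^sup>2)" for w
  have triangle: "norm (a - b - c + d) \<le> norm a + norm b + norm c + norm d" for a b c d :: 'a
    using norm_triangle_ineq[of "a - b - c" d] norm_triangle_ineq4[of "a - b" c] norm_triangle_ineq4[of a b]
    by linarith
  have bound: "(norm (x (Suc n) w - xs))\<^sup>2 \<le> B w" if w: "w \<in> space M" for w
  proof -
    define y where "y = x n w - \<eta> n *\<^sub>R G (x n w) (\<zeta> n w)"
    have "norm (x (Suc n) w - xs) \<le> norm (y - xs)"
      using x_step[OF step(1) w] norm_P_le[of "y - xs"] by (simp add: y_def P_simps)
    also have "y - xs = (x n w - xs) - \<eta> n *\<^sub>R (g (x n w) - g xs) - \<eta> n *\<^sub>R g xs + \<eta> n *\<^sub>R \<xi> w"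
      by (simp add: y_def \<xi>_def algebra_simps)
    also have "norm \<dots> \<le> norm (x n w - xs) + \<eta> n * (L * norm (x n w - xs)) + \<eta> n * norm (g xs) + \<eta> n * norm (\<xi> w)"
      using lipschitz[of "x n w" xs] \<eta>_nonneg[of n]
      by (intro order_trans[OF triangle] add_mono) (auto intro: mult_left_mono)
    also have "\<dots> = (1 + \<eta> n * L) * norm (x n w - xs) + \<eta> n * norm (g xs) + \<eta> n * norm (\<xi> w)" (is "_ = ?a + ?b + ?c")
      by (simp add: algebra_simps)
    finally have "(norm (x (Suc n) w - xs))\<^sup>2 \<le> (?a + ?b + ?c)\<^sup>2" by (intro power_mono) auto
    also have "\<dots> \<le> 2 * (?a + ?b)\<^sup>2 + 2 * ?c\<^sup>2" using norm_add_sq_le[of 1 "?a + ?b" ?c] by simp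
    also have "\<dots> \<le> 2 * (2 * ?a\<^sup>2 + 2 * ?b\<^sup>2) + 2 * ?c\<^sup>2" using norm_add_sq_le[of 1 ?a ?b] by simp
    finally show ?thesis by (simp add: B_def power_mult_distrib)
  qed
  have "integrable M B" unfolding B_def[abs_def] using step int\<xi> by auto
  then show ?case
  proof (rule Bochner_Integration.integrable_bound)
    show "AE w in M. norm ((norm (x (Suc n) w - xs))\<^sup>2) \<le> norm (B w)"
      using bound by (intro AE_I2) fastforce
  qed measurable
qed

text \<open>The scale by which the tangent component is measured at time \<open>n\<close>; it equals \<open>\<eta> (n - 1) powr (1 - \<beta>)\<close>.\<close>

definition \<rho> :: "nat \<Rightarrow> real" where "\<rho> n = \<gamma> * \<kappa> (n - 1)"

definition EV :: "nat \<Rightarrow> real" where "EV n = (LINT w|M. V (\<rho> n) (\<kappa> n) (x n w) (s n w))"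

lemma \<rho>_nonneg: "0 \<le> \<rho> n" using \<gamma>_pos \<kappa>_nonneg by (simp add: \<rho>_def)

lemma P_borel [measurable]: "P \<in> borel_measurable borel" by (rule P_measurable)

lemma V_borel: "(\<lambda>(y, t). V r k y t) \<in> borel_measurable (borel \<Otimes>\<^sub>M borel)"
  unfolding V_def tangent_error_def normal_error_def by measurable

lemma V_integrable:
  assumes n: "1 \<le> n"
  shows "integrable M (\<lambda>w. V (\<rho> n) (\<kappa> n) (x n w) (s n w))"
proof (rule Bochner_Integration.integrable_bound)
  note [measurable] = state_measurable[OF n]
  define S where "S = (\<Sum>k<n. \<eta> k)"
  define R where "R = \<rho> n * norm m + \<kappa> n * S * norm h + S * norm (g xs)"
  define B where "B w = (1 + K * \<kappa> n) * (2 * (norm (x n w - xs))\<^sup>2 + 2 * R\<^sup>2)" for w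
  show "integrable M B" unfolding B_def[abs_def] using x_square_integrable[OF n] by auto
  show "(\<lambda>w. V (\<rho> n) (\<kappa> n) (x n w) (s n w)) \<in> borel_measurable M"
    using measurable_compose[OF state_measurable(1)[OF n] V_borel] by simp
  show "AE w in M. norm (V (\<rho> n) (\<kappa> n) (x n w) (s n w)) \<le> norm (B w)"
  proof (rule AE_I2)
    fix w
    define c where "c = centre (\<rho> n) (\<kappa> n) (s n w)"
    have "norm (xs - c) = norm (- (\<rho> n *\<^sub>R m) + (\<kappa> n * s n w) *\<^sub>R h + s n w *\<^sub>R g xs)"
      by (simp add: c_def centre_def algebra_simps)
    also have "\<dots> \<le> R"
      unfolding R_def using s_nonneg[of n w] s_le[of n w] \<rho>_nonneg[of n] \<kappa>_nonneg[of n]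
      by (intro order_trans[OF norm_triangle_ineq] add_mono)
        (auto simp: S_def intro!: mult_right_mono mult_left_mono)
    finally have "(norm (xs - c))\<^sup>2 \<le> R\<^sup>2" by (intro power_mono) auto
    then have d: "(norm (x n w - c))\<^sup>2 \<le> 2 * (norm (x n w - xs))\<^sup>2 + 2 * R\<^sup>2"
      using norm_add_sq_le[of 1 "x n w - xs" "xs - c"] by simp
    have "(norm (tangent_error (\<rho> n) (\<kappa> n) (x n w) (s n w)))\<^sup>2 \<le> (norm (x n w - c))\<^sup>2"
      "(norm (normal_error (x n w) (s n w)))\<^sup>2 \<le> (norm (x n w - c))\<^sup>2"
      using pythagoras[of "x n w - c"] unfolding c_def P_centre minus_tangent_error by auto
    then have "V (\<rho> n) (\<kappa> n) (x n w) (s n w) \<le> (norm (x n w - c))\<^sup>2 + K * \<kappa> n * (norm (x n w - c))\<^sup>2"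
      unfolding V_def using K_nonneg \<kappa>_nonneg by (intro add_mono mult_left_mono) auto
    also have "\<dots> = (1 + K * \<kappa> n) * (norm (x n w - c))\<^sup>2" by (simp add: algebra_simps)
    also have "\<dots> \<le> B w"
      unfolding B_def using d K_nonneg \<kappa>_nonneg by (intro mult_left_mono) auto
    finally show "norm (V (\<rho> n) (\<kappa> n) (x n w) (s n w)) \<le> norm (B w)"
      using V_nonneg[OF \<kappa>_nonneg] by simp
  qed
qed

lemma \<rho>_ratio_lim: "(\<lambda>n. \<rho> n / \<kappa> n) \<longlonglongrightarrow> \<gamma>"
  using tendsto_mult_left[OF \<kappa>_pred_ratio_lim, of \<gamma>] by (simp add: \<rho>_def)

definition \<delta> :: "nat \<Rightarrow> real" where
  "\<delta> n = norm (defect (\<eta> n) (p n) (\<kappa> n) (\<rho> n) (\<rho> (Suc n))) / (\<eta> n * \<kappa> n)"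

text \<open>The equation for \<open>m\<close> says that \<open>\<rho> n *\<^sub>R m\<close> balances the Hessian force, the mean force \<open>\<kappa> n *\<^sub>R h\<close> and
the change of the scale, so the defect vanishes relative to \<open>\<eta> * \<kappa>\<close>.\<close>

lemma \<delta>_lim: "\<delta> \<longlonglongrightarrow> 0"
proof -
  define d where "d n = (1 - p n) *\<^sub>R h - (\<rho> n / \<kappa> n) *\<^sub>R P (H m)
      - (\<gamma> * ((\<kappa> n - \<kappa> (n - 1)) / (\<eta> n * \<kappa> n))) *\<^sub>R m" for n
  have "d \<longlonglongrightarrow> (1 - 0) *\<^sub>R h - \<gamma> *\<^sub>R P (H m) - (\<gamma> * - \<nu>) *\<^sub>R m"
    unfolding d_def by (intro tendsto_intros p_lim \<rho>_ratio_lim \<kappa>_pred_increment_lim)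
  also have "(1 - 0) *\<^sub>R h - \<gamma> *\<^sub>R P (H m) - (\<gamma> * - \<nu>) *\<^sub>R m = h - \<gamma> *\<^sub>R (P (H m) - \<nu> *\<^sub>R m)"
    by (simp add: algebra_simps)
  also have "\<dots> = 0" unfolding m_equation using \<gamma>_pos by simp
  finally have "(\<lambda>n. norm (d n)) \<longlonglongrightarrow> 0" by (rule tendsto_norm_zero)
  moreover have "\<forall>\<^sub>F n in sequentially. norm (d n) = \<delta> n"
    using eventually_ge_at_top[of 1]
  proof eventually_elim
    case (elim n)
    then have pos: "0 < \<eta> n" "0 < \<kappa> n" using \<eta>_pos \<kappa>_pos by auto
    have "defect (\<eta> n) (p n) (\<kappa> n) (\<rho> n) (\<rho> (Suc n)) = (\<eta> n * \<kappa> n) *\<^sub>R d n"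
    proof -
      have cancel: "\<eta> n * \<kappa> n * (\<rho> n / \<kappa> n) = \<eta> n * \<rho> n"
        "\<eta> n * \<kappa> n * (\<gamma> * (r / (\<eta> n * \<kappa> n))) = \<gamma> * r" for r
        using pos by simp_all
      have "\<rho> (Suc n) - \<rho> n = \<gamma> * (\<kappa> n - \<kappa> (n - 1))" by (simp add: \<rho>_def right_diff_distrib)
      then show ?thesis
        unfolding defect_def d_def scaleR_diff_right scaleR_scaleR cancel by (simp add: mult_ac)
    qed
    then show ?case using pos by (simp add: \<delta>_def)
  qed
  ultimately show ?thesis by (rule Lim_transform_eventually)
qed

text \<open>Source of the Lyapunov recursion relative to \<open>\<eta> * \<kappa>\<^sup>2\<close>: averaging and linearisation errors, defect, and
gradient noise.\<close>

definition \<epsilon> :: "real \<Rightarrow> nat \<Rightarrow> real" where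
  "\<epsilon> C n = C * \<kappa> n + 20 / \<mu> * (\<delta> n)\<^sup>2 + (1 + K) * N * (\<eta> n / (\<kappa> n)\<^sup>2)"

lemma \<epsilon>_lim: "\<epsilon> C \<longlonglongrightarrow> 0"
proof -
  have "\<epsilon> C \<longlonglongrightarrow> C * 0 + 20 / \<mu> * 0\<^sup>2 + (1 + K) * N * 0"
    unfolding \<epsilon>_def[abs_def] by (intro tendsto_intros \<kappa>_lim \<delta>_lim \<eta>_over_\<kappa>_sq_lim)
  then show ?thesis by simp
qed

lemma state_small: "\<forall>\<^sub>F n in sequentially. 1 \<le> n \<and> small (\<kappa> n)"
  using \<kappa>_pos by (intro eventually_conj eventually_ge_at_top eventually_small \<kappa>_lim)
    (auto intro: eventually_sequentiallyI[of 1])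

text \<open>By the Markov property the one-step bound holds with the state held fixed. Integrating it over the state,
the term \<open>s ^ 4 / \<kappa>\<close> becomes a multiple of \<open>\<kappa> ^ 3\<close> by the bound on the fourth moment.\<close>

lemma EV_recursion:
  "\<exists>C. \<forall>\<^sub>F n in sequentially. EV (Suc n) \<le> (1 - \<mu> / 2 * \<eta> n) * EV n + \<eta> n * ((\<kappa> n)\<^sup>2 * \<epsilon> C n)"
proof -
  obtain C where C: "0 \<le> C" "\<forall>\<^sub>F n in sequentially. fourth_moment n \<le> C * \<kappa> n ^ 4"
    using fourth_moment_bound by blast
  \<comment> \<open>One constant bounds both the ratio of \<open>\<rho>\<close> to \<open>\<kappa>\<close>, which tends to \<open>\<gamma>\<close>, and the relative increment of \<open>\<kappa>\<close> in units of \<open>\<eta>\<close>.\<close>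
  define c where "c = 2 * \<gamma> + \<alpha> * (1 - \<beta>) / \<eta>0"
  have c_ge: "2 * \<gamma> \<le> c" "\<alpha> * (1 - \<beta>) / \<eta>0 \<le> c"
    using \<gamma>_pos \<alpha> \<beta> \<eta>0_pos by (auto simp: c_def)
  define R where "R = remainder_const c"
  have "0 \<le> R" using \<mu>_pos K_nonneg by (simp add: R_def remainder_const_def)
  have "\<forall>\<^sub>F n in sequentially. \<rho> n / \<kappa> n < 2 * \<gamma>"
    using \<gamma>_pos by (intro order_tendstoD(2)[OF \<rho>_ratio_lim]) auto
  with state_small eventually_p_\<kappa> C(2)
  have "\<forall>\<^sub>F n in sequentially.
      EV (Suc n) \<le> (1 - \<mu> / 2 * \<eta> n) * EV n + \<eta> n * ((\<kappa> n)\<^sup>2 * \<epsilon> (R * (1 + C)) n)"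
  proof eventually_elim
    case (elim n)
    then have n: "1 \<le> n" and small: "small (\<kappa> n)" by auto
    have pos: "0 < \<kappa> n" "0 < \<eta> n" "0 < p n" using n \<kappa>_pos \<eta>_pos p_pos by auto
    have \<rho>: "\<rho> n \<le> c * \<kappa> n"
    proof -
      have "\<rho> n \<le> 2 * \<gamma> * \<kappa> n" using elim pos by (simp add: pos_divide_less_eq)
      also have "\<dots> \<le> c * \<kappa> n" using c_ge pos by (intro mult_right_mono) auto
      finally show ?thesis .
    qed
    have \<kappa>': "\<bar>\<kappa> (Suc n) - \<kappa> n\<bar> \<le> c * (\<kappa> n * \<eta> n)"
      using \<kappa>_increment[OF n] c_ge pos by (elim order_trans) (intro mult_right_mono, auto)
    have d: "norm (defect (\<eta> n) (p n) (\<kappa> n) (\<rho> n) (\<rho> (Suc n))) \<le> \<eta> n * \<kappa> n * \<delta> n"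
      using pos by (simp add: \<delta>_def)
    define b where "b w = (1 - \<mu> / 2 * \<eta> n) * V (\<rho> n) (\<kappa> n) (x n w) (s n w)
        + \<eta> n * (R * (\<kappa> n ^ 3 + s n w ^ 4 / \<kappa> n) + 20 / \<mu> * (\<kappa> n)\<^sup>2 * (\<delta> n)\<^sup>2)
        + (1 + K) * (\<eta> n)\<^sup>2 * \<sigma>2 (x n w)" for w
    define Vnext where "Vnext y t z a = V (\<rho> (Suc n)) (\<kappa> (Suc n))
        (if a then P (y - \<eta> n *\<^sub>R G y z) else y - \<eta> n *\<^sub>R G y z) (if a then 0 else t + \<eta> n)" for y t z and a :: bool
    have "(\<integral>\<^sup>+w. ennreal (V (\<rho> (Suc n)) (\<kappa> (Suc n)) (x (Suc n) w) (s (Suc n) w)) \<partial>M)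
        = (\<integral>\<^sup>+w. (\<lambda>y t z a. ennreal (Vnext y t z a)) (x n w) (s n w) (\<zeta> n w) (\<omega> n w) \<partial>M)"
      using n by (intro nn_integral_cong) (auto simp: Vnext_def x_step)
    also have "\<dots> = (\<integral>\<^sup>+w. (\<integral>\<^sup>+z. ennreal (Vnext (x n w) (s n w) z True) * p n
        + ennreal (Vnext (x n w) (s n w) z False) * (1 - p n) \<partial>D) \<partial>M)"
    proof (rule nn_integral_transition[OF n])
      let ?S = "(borel \<Otimes>\<^sub>M borel) \<Otimes>\<^sub>M (D \<Otimes>\<^sub>M count_space UNIV) :: (('a \<times> real) \<times> 'z \<times> bool) measure"
      have "(\<lambda>v. (fst (fst v), fst (snd v))) \<in> ?S \<rightarrow>\<^sub>M (borel \<Otimes>\<^sub>M D :: ('a \<times> 'z) measure)" by measurable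
      from measurable_compose[OF this G_measurable]
      have [measurable]: "(\<lambda>v. G (fst (fst v)) (fst (snd v))) \<in> borel_measurable ?S" by simp
      define y where "y v = fst (fst v) - \<eta> n *\<^sub>R G (fst (fst v)) (fst (snd v))" for v :: "('a \<times> real) \<times> 'z \<times> bool"
      have [measurable]: "y \<in> borel_measurable ?S" unfolding y_def[abs_def] by measurable
      have "(\<lambda>v. (if snd (snd v) then P (y v) else y v, if snd (snd v) then 0 else snd (fst v) + \<eta> n))
          \<in> ?S \<rightarrow>\<^sub>M (borel \<Otimes>\<^sub>M borel)" by measurable
      from measurable_compose[OF this V_borel]
      have "(\<lambda>v. Vnext (fst (fst v)) (snd (fst v)) (fst (snd v)) (snd (snd v))) \<in> borel_measurable ?S"
        unfolding Vnext_def y_def by simp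
      then show "(\<lambda>((y, t), z, a). ennreal (Vnext y t z a)) \<in> borel_measurable ?S"
        by (simp add: split_beta')
    qed
    also have "\<dots> \<le> (\<integral>\<^sup>+w. ennreal (b w) \<partial>M)"
    proof (rule nn_integral_mono)
      fix w
      have "(\<integral>\<^sup>+z. ennreal (Vnext (x n w) (s n w) z True) * p n
          + ennreal (Vnext (x n w) (s n w) z False) * (1 - p n) \<partial>D)
        = (\<integral>\<^sup>+z. ennreal (p n * V (\<rho> (Suc n)) (\<kappa> (Suc n)) (P (x n w - \<eta> n *\<^sub>R (g (x n w) - (g (x n w) - G (x n w) z)))) 0
          + (1 - p n) * V (\<rho> (Suc n)) (\<kappa> (Suc n)) (x n w - \<eta> n *\<^sub>R (g (x n w) - (g (x n w) - G (x n w) z))) (s n w + \<eta> n)) \<partial>D)"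
        using p_bounds[of n] V_nonneg[OF \<kappa>_nonneg]
        by (intro nn_integral_cong) (simp add: Vnext_def ennreal_mult'' mult.commute)
      also have "\<dots> \<le> ennreal (b w)"
        unfolding b_def R_def \<sigma>2_def
        by (rule averaged_drift)
          (use n small pos \<rho> \<kappa>' d elim p_bounds[of n] \<rho>_nonneg \<kappa>_nonneg s_nonneg \<kappa>_antimono[OF n]
            noise_centred noise_square_integrable D.prob_space_axioms in auto)
      finally show "(\<integral>\<^sup>+z. ennreal (Vnext (x n w) (s n w) z True) * p n
          + ennreal (Vnext (x n w) (s n w) z False) * (1 - p n) \<partial>D) \<le> ennreal (b w)" .
    qed
    finally have le: "(\<integral>\<^sup>+w. ennreal (V (\<rho> (Suc n)) (\<kappa> (Suc n)) (x (Suc n) w) (s (Suc n) w)) \<partial>M)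
        \<le> (\<integral>\<^sup>+w. ennreal (b w) \<partial>M)" .
    have int: "integrable M (\<lambda>w. s n w ^ 4)" "integrable M (\<lambda>w. \<sigma>2 (x n w))"
      "integrable M (\<lambda>w. V (\<rho> n) (\<kappa> n) (x n w) (s n w))"
      using s_poly_integrable[OF n, of 0 4] \<sigma>2_state(1)[OF n] V_integrable[OF n] by auto
    have intb: "integrable M b" unfolding b_def[abs_def] using int by auto
    have \<eta>\<mu>: "\<mu> / 2 * \<eta> n \<le> 1"
    proof -
      have "\<eta> n * \<mu> \<le> \<kappa> n * \<mu>"
        using elim pos p_bounds[of n] \<mu>_pos mult_left_le[of "p n" "\<kappa> n"] by (intro mult_right_mono) auto
      also have "\<dots> \<le> 1 / 4" using small unfolding small_def by blast
      finally show ?thesis by (simp add: mult.commute)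
    qed
    have b_nonneg: "0 \<le> b w" for w
      unfolding b_def using \<eta>\<mu> V_nonneg[OF \<kappa>_nonneg] \<open>0 \<le> R\<close> pos K_nonneg \<sigma>2_nonneg \<mu>_pos
      by (intro add_nonneg_nonneg mult_nonneg_nonneg) auto
    have "ennreal (EV (Suc n)) \<le> ennreal (LINT w|M. b w)"
      using le V_integrable[of "Suc n"] intb b_nonneg V_nonneg[OF \<kappa>_nonneg]
      unfolding EV_def by (simp add: nn_integral_eq_integral del: s.simps)
    then have "EV (Suc n) \<le> (LINT w|M. b w)"
      using b_nonneg by (simp add: ennreal_le_iff Bochner_Integration.integral_nonneg)
    also have "\<dots> = (1 - \<mu> / 2 * \<eta> n) * EV n
        + \<eta> n * (R * (\<kappa> n ^ 3 + fourth_moment n / \<kappa> n) + 20 / \<mu> * (\<kappa> n)\<^sup>2 * (\<delta> n)\<^sup>2)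
        + (1 + K) * (\<eta> n)\<^sup>2 * (LINT w|M. \<sigma>2 (x n w))"
      unfolding b_def EV_def fourth_moment_def using int by (simp add: M.prob_space)
    also have "\<dots> \<le> (1 - \<mu> / 2 * \<eta> n) * EV n
        + \<eta> n * (R * (\<kappa> n ^ 3 + C * \<kappa> n ^ 3) + 20 / \<mu> * (\<kappa> n)\<^sup>2 * (\<delta> n)\<^sup>2)
        + (1 + K) * (\<eta> n)\<^sup>2 * N"
    proof -
      have "fourth_moment n / \<kappa> n \<le> C * \<kappa> n ^ 3"
        using elim pos by (simp add: pos_divide_le_eq power_numeral_reduce mult_ac)
      then show ?thesis
        using \<sigma>2_state(2)[OF n] pos \<open>0 \<le> R\<close> K_nonneg
        by (intro add_mono mult_left_mono order_refl) auto
    qed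
    also have "\<dots> = (1 - \<mu> / 2 * \<eta> n) * EV n + \<eta> n * ((\<kappa> n)\<^sup>2 * \<epsilon> (R * (1 + C)) n)"
      using pos by (simp add: \<epsilon>_def field_simps power2_eq_square power3_eq_cube)
    finally show ?case .
  qed
  then show ?thesis by blast
qed

lemma EV_nonneg: "0 \<le> EV n"
  unfolding EV_def by (intro Bochner_Integration.integral_nonneg V_nonneg \<kappa>_nonneg)

text \<open>Dividing the recursion by \<open>\<kappa>\<^sup>2\<close> costs part of the contraction rate. The decay rate of \<open>\<kappa>\<^sup>2\<close> is less than
\<open>\<mu> / 2 * \<eta>\<close>: for \<open>\<alpha> < 1\<close> it is of smaller order than \<open>\<eta>\<close>, and for \<open>\<alpha> = 1\<close> this is ensured by
\<open>\<eta>0 > 2 / \<mu>\<close>.\<close>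

lemma EV_lim: "(\<lambda>n. EV n / (\<kappa> n)\<^sup>2) \<longlonglongrightarrow> 0"
proof -
  obtain C where C: "\<forall>\<^sub>F n in sequentially.
      EV (Suc n) \<le> (1 - \<mu> / 2 * \<eta> n) * EV n + \<eta> n * ((\<kappa> n)\<^sup>2 * \<epsilon> C n)"
    using EV_recursion by blast
  have "max 0 (2 * (1 - \<beta>) * of_bool (\<alpha> = 1) / \<eta>0) < \<mu> / 2"
  proof (cases "\<alpha> = 1")
    case True
    have "2 * (1 - \<beta>) / \<eta>0 < 1 / \<eta>0" using \<beta> \<eta>0_pos by (intro divide_strict_right_mono) auto
    also have "\<dots> < \<mu> / 2" using \<eta>0_large True \<mu>_pos \<eta>0_pos by (simp add: field_simps)
    finally show ?thesis using \<mu>_pos unfolding max_less_iff_conj by (simp add: True)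
  qed (use \<mu>_pos in auto)
  then obtain \<theta> where \<theta>: "0 < \<theta>" "2 * (1 - \<beta>) * of_bool (\<alpha> = 1) / \<eta>0 < \<theta>" "\<theta> < \<mu> / 2"
    using dense[of "max 0 (2 * (1 - \<beta>) * of_bool (\<alpha> = 1) / \<eta>0)" "\<mu> / 2"] by auto
  have "(\<lambda>n. \<mu> / 2 * \<eta> n) \<longlonglongrightarrow> \<mu> / 2 * 0" by (intro tendsto_intros \<eta>_lim)
  then have small\<eta>: "\<forall>\<^sub>F n in sequentially. \<mu> / 2 * \<eta> n < 1" by (rule order_tendstoD(2)) simp
  show ?thesis
  proof (rule contraction_tendsto_0[where c = "\<mu> / 2 - \<theta>" and \<eta> = \<eta> and \<epsilon> = "\<lambda>n. (1 + \<theta> * \<eta> n) * \<bar>\<epsilon> C n\<bar>"])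
    show "\<forall>\<^sub>F n in sequentially. EV (Suc n) / (\<kappa> (Suc n))\<^sup>2
        \<le> (1 - (\<mu> / 2 - \<theta>) * \<eta> n) * (EV n / (\<kappa> n)\<^sup>2) + \<eta> n * ((1 + \<theta> * \<eta> n) * \<bar>\<epsilon> C n\<bar>)"
      using C \<kappa>_sq_ratio[OF \<theta>(2,1)] small\<eta> eventually_ge_at_top[of 1]
    proof eventually_elim
      case (elim n)
      have pos: "0 < \<kappa> n" "0 < \<kappa> (Suc n)" "0 < \<eta> n" using elim \<kappa>_pos \<eta>_pos by auto
      define W where "W = EV n / (\<kappa> n)\<^sup>2"
      have W: "0 \<le> W" "EV n = W * (\<kappa> n)\<^sup>2" using EV_nonneg pos by (auto simp: W_def)
      define X where "X = (1 - \<mu> / 2 * \<eta> n) * W + \<eta> n * \<bar>\<epsilon> C n\<bar>"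
      have X: "0 \<le> X" using elim W pos by (auto simp: X_def)
      have "EV (Suc n) \<le> (1 - \<mu> / 2 * \<eta> n) * EV n + \<eta> n * ((\<kappa> n)\<^sup>2 * \<bar>\<epsilon> C n\<bar>)"
        using elim(1) pos by (elim order_trans) (intro add_left_mono mult_left_mono, auto)
      also have "\<dots> = X * (\<kappa> n)\<^sup>2" by (simp add: X_def W algebra_simps)
      also have "\<dots> \<le> X * ((1 + \<theta> * \<eta> n) * (\<kappa> (Suc n))\<^sup>2)" using elim X by (intro mult_left_mono) auto
      finally have "EV (Suc n) / (\<kappa> (Suc n))\<^sup>2 \<le> X * (1 + \<theta> * \<eta> n)"
        using pos by (simp add: pos_divide_le_eq mult.assoc)
      also have "\<dots> = (1 - (\<mu> / 2 - \<theta>) * \<eta> n - \<theta> * \<mu> / 2 * (\<eta> n)\<^sup>2) * W + \<eta> n * ((1 + \<theta> * \<eta> n) * \<bar>\<epsilon> C n\<bar>)"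
        by (simp add: X_def algebra_simps power2_eq_square)
      also have "\<dots> \<le> (1 - (\<mu> / 2 - \<theta>) * \<eta> n) * W + \<eta> n * ((1 + \<theta> * \<eta> n) * \<bar>\<epsilon> C n\<bar>)"
        using W \<theta> \<mu>_pos by (intro add_right_mono mult_right_mono) auto
      finally show ?case by (simp add: W_def)
    qed
    have "(\<lambda>n. (1 + \<theta> * \<eta> n) * \<bar>\<epsilon> C n\<bar>) \<longlonglongrightarrow> (1 + \<theta> * 0) * \<bar>0\<bar>"
      by (intro tendsto_intros \<eta>_lim \<epsilon>_lim)
    then show "(\<lambda>n. (1 + \<theta> * \<eta> n) * \<bar>\<epsilon> C n\<bar>) \<longlonglongrightarrow> 0" by simp
  qed (use \<theta> EV_nonneg \<eta>_nonneg \<eta>_lim \<eta>_not_summable in auto)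
qed

text \<open>The rescaled deviation is the tangent error minus the corrector, divided by \<open>\<rho>\<close>. The Lyapunov function
bounds the first, and the corrector has size \<open>\<kappa> * s\<close>, which is of order \<open>\<kappa>\<^sup>2\<close> in the mean square norm.\<close>

lemma rescaled_tangent_tendsto:
  "(\<lambda>n. \<integral>\<^sup>+w. ennreal ((norm ((1 / \<rho> n) *\<^sub>R (P (x n w) - xs) - m))\<^sup>2) \<partial>M) \<longlonglongrightarrow> 0"
proof -
  obtain C where C: "0 \<le> C" "\<forall>\<^sub>F n in sequentially. fourth_moment n \<le> C * \<kappa> n ^ 4"
    using fourth_moment_bound by blast
  define B where "B n = (1 / (\<rho> n / \<kappa> n))\<^sup>2 * (2 * (EV n / (\<kappa> n)\<^sup>2) + 2 * (norm h)\<^sup>2 * (1 + C) * (\<kappa> n)\<^sup>2)" for n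
  have "B \<longlonglongrightarrow> (1 / \<gamma>)\<^sup>2 * (2 * 0 + 2 * (norm h)\<^sup>2 * (1 + C) * 0\<^sup>2)"
    unfolding B_def using \<gamma>_pos by (intro tendsto_intros \<rho>_ratio_lim EV_lim \<kappa>_lim) auto
  then have "B \<longlonglongrightarrow> 0" by simp
  then have B_lim: "(\<lambda>n. ennreal (B n)) \<longlonglongrightarrow> 0" using tendsto_ennrealI by fastforce
  have B_le: "\<forall>\<^sub>F n in sequentially.
      (\<integral>\<^sup>+w. ennreal ((norm ((1 / \<rho> n) *\<^sub>R (P (x n w) - xs) - m))\<^sup>2) \<partial>M) \<le> ennreal (B n)"
    using C(2) eventually_ge_at_top[of 2]
  proof eventually_elim
    case (elim n)
    then have n: "1 \<le> n" by simp
    have pos: "0 < \<kappa> n" "0 < \<rho> n" using elim \<kappa>_pos[of n] \<kappa>_pos[of "n - 1"] \<gamma>_pos by (auto simp: \<rho>_def)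
    define b where "b w = (1 / \<rho> n)\<^sup>2 * (2 * V (\<rho> n) (\<kappa> n) (x n w) (s n w)
        + 2 * (norm h)\<^sup>2 * (\<kappa> n ^ 4 + s n w ^ 4))" for w
    have int: "integrable M (\<lambda>w. s n w ^ 4)" "integrable M (\<lambda>w. V (\<rho> n) (\<kappa> n) (x n w) (s n w))"
      using s_poly_integrable[OF n, of 0 4] V_integrable[OF n] by auto
    have le: "(norm ((1 / \<rho> n) *\<^sub>R (P (x n w) - xs) - m))\<^sup>2 \<le> b w" for w
    proof -
      define a where "a = tangent_error (\<rho> n) (\<kappa> n) (x n w) (s n w)"
      have "(1 / \<rho> n) *\<^sub>R (P (x n w) - xs) - m = (1 / \<rho> n) *\<^sub>R (a + - ((\<kappa> n * s n w) *\<^sub>R h))"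
        using pos by (simp add: a_def tangent_error_def scaleR_diff_right)
      then have "(norm ((1 / \<rho> n) *\<^sub>R (P (x n w) - xs) - m))\<^sup>2 = (1 / \<rho> n)\<^sup>2 * (norm (a + - ((\<kappa> n * s n w) *\<^sub>R h)))\<^sup>2"
        by (simp add: power_mult_distrib power_divide)
      also have "\<dots> \<le> (1 / \<rho> n)\<^sup>2 * (2 * (norm a)\<^sup>2 + 2 * ((norm h)\<^sup>2 * (\<kappa> n * s n w)\<^sup>2))"
        using norm_add_sq_le[of 1 a "- ((\<kappa> n * s n w) *\<^sub>R h)"]
        by (intro mult_left_mono) (auto simp: power_mult_distrib mult.commute)
      also have "\<dots> \<le> (1 / \<rho> n)\<^sup>2 * (2 * V (\<rho> n) (\<kappa> n) (x n w) (s n w) + 2 * ((norm h)\<^sup>2 * (\<kappa> n ^ 4 + s n w ^ 4)))"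
      proof (intro mult_left_mono add_mono)
        show "(norm a)\<^sup>2 \<le> V (\<rho> n) (\<kappa> n) (x n w) (s n w)"
          using K_nonneg \<kappa>_nonneg by (simp add: V_def a_def)
        have "2 * ((\<kappa> n)\<^sup>2 * (s n w)\<^sup>2) \<le> \<kappa> n ^ 4 + s n w ^ 4"
          using sum_squares_bound[of "(\<kappa> n)\<^sup>2" "(s n w)\<^sup>2"] by simp
        moreover have "0 \<le> (\<kappa> n)\<^sup>2 * (s n w)\<^sup>2" by simp
        ultimately show "(\<kappa> n * s n w)\<^sup>2 \<le> \<kappa> n ^ 4 + s n w ^ 4"
          unfolding power_mult_distrib by linarith
      qed auto
      finally show ?thesis by (simp add: b_def mult.assoc)
    qed
    have "(\<integral>\<^sup>+w. ennreal ((norm ((1 / \<rho> n) *\<^sub>R (P (x n w) - xs) - m))\<^sup>2) \<partial>M) \<le> (\<integral>\<^sup>+w. ennreal (b w) \<partial>M)"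
      by (intro nn_integral_mono ennreal_leI le)
    also have "\<dots> = ennreal (LINT w|M. b w)"
      using int order_trans[OF zero_le_power2 le] by (intro nn_integral_eq_integral) (auto simp: b_def[abs_def])
    also have "(LINT w|M. b w) = (1 / \<rho> n)\<^sup>2 * (2 * EV n + 2 * (norm h)\<^sup>2 * (\<kappa> n ^ 4 + fourth_moment n))"
      unfolding b_def EV_def fourth_moment_def using int by (simp add: M.prob_space)
    also have "\<dots> \<le> (1 / \<rho> n)\<^sup>2 * (2 * EV n + 2 * (norm h)\<^sup>2 * (\<kappa> n ^ 4 + C * \<kappa> n ^ 4))"
      using elim by (intro mult_left_mono add_left_mono) auto
    also have "\<dots> = B n"
      using pos by (simp add: B_def field_simps power2_eq_square power4_eq_xxxx)
    finally show ?case by (simp add: ennreal_leI)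
  qed
  show ?thesis
    by (rule tendsto_sandwich[OF _ B_le tendsto_const B_lim]) simp
qed

end

section \<open>Convergence of the rescaled iterates\<close>

theorem theorem3p5:
  fixes A :: "real^'k^'d"
    and M :: "'w measure" and D :: "'z measure"
    and F :: "real^'d \<Rightarrow> 'z \<Rightarrow> real" and gradF :: "real^'d \<Rightarrow> 'z \<Rightarrow> real^'d"
    and f :: "real^'d \<Rightarrow> real" and gradf :: "real^'d \<Rightarrow> real^'d"
    and hessf :: "real^'d \<Rightarrow> real^'d^'d"
    and \<zeta> :: "nat \<Rightarrow> 'w \<Rightarrow> 'z" and \<omega> :: "nat \<Rightarrow> 'w \<Rightarrow> bool"
    and x xhalf \<xi> u uhat :: "nat \<Rightarrow> 'w \<Rightarrow> real^'d"
    and x1 xstar m :: "real^'d"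
    and \<eta> p :: "nat \<Rightarrow> real"
    and \<eta>0 \<alpha> \<beta> \<gamma> \<mu> L L' q :: real
  assumes "prob_space M" and "prob_space D"
    \<comment> \<open>the objective and its stochastic gradients\<close>
    and F_integrable: "\<And>y. integrable D (F y)"
    and f_def: "\<And>y. f y = (LINT z|D. F y z)"
    and F_gradient: "\<And>y z. z \<in> space D \<Longrightarrow> GDERIV (\<lambda>y. F y z) y :> gradF y z"
    and f_gradient: "\<And>y. GDERIV f y :> gradf y"
    and f_hessian: "\<And>y. (gradf has_derivative (\<lambda>h. hessf y *v h)) (at y)"
    and gradF_integrable: "\<And>y. integrable D (gradF y)"
    and gradF_unbiased: "\<And>y. (LINT z|D. gradF y z) = gradf y"
    and gradF_square_integrable: "\<And>y. integrable D (\<lambda>z. (norm (gradF y z))\<^sup>2)"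
    \<comment> \<open>the unique constrained minimiser\<close>
    and xstar_min: "is_arg_min f (\<lambda>y. transpose A *v y = 0) xstar"
    and xstar_unique: "\<And>y. is_arg_min f (\<lambda>y. transpose A *v y = 0) y \<Longrightarrow> y = xstar"
    \<comment> \<open>parameters\<close>
    and "0 < \<gamma>" and "0 < \<alpha>" and "\<alpha> \<le> 1" and "1 / 2 < \<beta>" and "\<beta> < 1"
    and "0 < \<eta>0" and "2 * of_bool (\<alpha> = 1) / \<mu> < \<eta>0"
    and eta_def: "\<And>n. \<eta> n = lpsa_eta \<eta>0 \<alpha> n"
    and p_def: "\<And>n. p n = lpsa_prob \<gamma> \<eta>0 \<alpha> \<beta> n"
    \<comment> \<open>sampling\<close>
    and zeta_measurable: "\<And>n. 1 \<le> n \<Longrightarrow> \<zeta> n \<in> measurable M D"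
    and zeta_distr: "\<And>n. 1 \<le> n \<Longrightarrow> distr M D (\<zeta> n) = D"
    and omega_measurable: "\<And>n. 1 \<le> n \<Longrightarrow> \<omega> n \<in> measurable M (count_space UNIV)"
    and omega_distr: "\<And>n. 1 \<le> n \<Longrightarrow>
          distr M (count_space UNIV) (\<omega> n) = measure_pmf (bernoulli_pmf (p n))"
    and indep: "lpsa_indep M D \<zeta> \<omega>"
    \<comment> \<open>the iterates\<close>
    and x_init: "\<And>w. w \<in> space M \<Longrightarrow> x 1 w = x1"
    and x_half_step: "\<And>n w. 1 \<le> n \<Longrightarrow> w \<in> space M \<Longrightarrow>
          xhalf n w = x n w - \<eta> n *\<^sub>R gradF (x n w) (\<zeta> n w)"
    and x_step: "\<And>n w. 1 \<le> n \<Longrightarrow> w \<in> space M \<Longrightarrow>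
          x (Suc n) w = (if \<omega> n w then perp_proj A *v xhalf n w else xhalf n w)"
    and xi_def: "\<And>n w. \<xi> n w = gradf (x n w) - gradF (x n w) (\<zeta> n w)"
    \<comment> \<open>regularity, strong convexity and noise moments\<close>
    and gradf_lipschitz: "\<And>y y'. norm (gradf y - gradf y') \<le> L * norm (y - y')"
    and "0 < \<mu>" and f_strongly_convex: "strongly_convex \<mu> f"
    and hessf_lipschitz: "\<And>y y'. spectral_norm (hessf y - hessf y') \<le> L' * norm (y - y')"
    and cov_lipschitz: "\<And>y y'.
          spectral_norm (cov_matrix D (gradF y) - cov_matrix D (gradF y')) \<le> L * norm (y - y')"
    and "2 < q" and xi_moment: "(SUP n\<in>{1..}. \<integral>\<^sup>+w. ennreal (norm (\<xi> n w) powr q) \<partial>M) < \<infinity>"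
    \<comment> \<open>the limit and the rescaled sequence\<close>
    and m_def: "m = lpsa_limit A \<gamma> \<eta>0 \<alpha> \<beta> (gradf xstar) (hessf xstar)"
    and "m \<noteq> 0"
    and u_def: "\<And>n w. u n w = perp_proj A *v x n w"
    and uhat_def: "\<And>n w. 2 \<le> n \<Longrightarrow>
          uhat n w = \<eta> (n - 1) powr (- (1 - \<beta>)) *\<^sub>R (u n w - xstar)"
  shows "(\<lambda>n. \<integral>\<^sup>+w. ennreal ((norm (uhat n w - m))\<^sup>2) \<partial>M) \<longlonglongrightarrow> 0"
proof -
  interpret M: prob_space M by fact
  interpret D: prob_space D by fact
  interpret step: step_sizes \<eta>0 \<alpha> \<beta> \<gamma>
    by unfold_locales fact+
  have \<eta>_eq: "\<eta> = step.\<eta>" and p_eq: "p = step.p"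
    by (simp_all add: fun_eq_iff eta_def p_def lpsa_eta_def lpsa_prob_def step.\<eta>_def step.p_def)
  let ?P = "\<lambda>v. perp_proj A *v v" and ?H = "\<lambda>v. hessf xstar *v v"
  define h where "h = ?P (?H (gradf xstar))"
  have monotone: "\<mu> * (norm (y - y'))\<^sup>2 \<le> (gradf y - gradf y') \<bullet> (y - y')" for y y'
    using f_strongly_convex f_gradient by (rule strongly_convex_gradient_monotone)
  have feasible: "transpose A *v xstar = 0" and minimal: "\<And>y. transpose A *v y = 0 \<Longrightarrow> f xstar \<le> f y"
    using xstar_min by (auto simp: is_arg_min_def not_less)
  have stationary: "?P (gradf xstar) = 0"
  proof -
    let ?v = "?P (gradf xstar)"
    have "f xstar \<le> f (xstar + t *\<^sub>R ?v)" for t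
      by (intro minimal)
        (simp only: matrix_vector_right_distrib matrix_vector_mult_scaleR feasible
          transpose_mult_perp_proj scaleR_zero_right add_0)
    then have "gradf xstar \<bullet> ?v = 0"
      using f_gradient by (rule stationary_at_constrained_min)
    then have "?v \<bullet> ?v = 0" by (metis perp_proj_self_adjoint perp_proj_idem)
    then show ?thesis by simp
  qed
  have taylor: "norm (gradf y - gradf xstar - ?H (y - xstar)) \<le> \<bar>L'\<bar> * (norm (y - xstar))\<^sup>2" for y
    using f_hessian hessf_lipschitz by (rule gradient_taylor_quadratic)
  have lipschitz: "norm (gradf y - gradf y') \<le> \<bar>L\<bar> * norm (y - y')" for y y'
    using gradf_lipschitz mult_right_mono[OF abs_ge_self norm_ge_zero] by (rule order_trans)
  define c where "c = (1 - \<beta>) / \<eta>0 * of_bool (\<alpha> = 1)"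
  \<comment> \<open>The step-size condition keeps the shifted Hessian coercive, so the pseudoinverse in the limit is an inverse on the feasible subspace.\<close>
  have "c < \<mu>"
  proof (cases "\<alpha> = 1")
    case True
    have "(1 - \<beta>) / \<eta>0 < 1 / \<eta>0" using \<open>1 / 2 < \<beta>\<close> \<open>0 < \<eta>0\<close>
      by (intro divide_strict_right_mono) auto
    also have "\<dots> < \<mu>" using \<open>2 * of_bool (\<alpha> = 1) / \<mu> < \<eta>0\<close> True \<open>0 < \<mu>\<close> \<open>0 < \<eta>0\<close>
      by (simp add: field_simps)
    finally show ?thesis by (simp add: c_def True)
  qed (use \<open>0 < \<mu>\<close> in \<open>simp add: c_def\<close>)
  let ?B = "hessf xstar - mat c" and ?G = "perp_proj A ** (hessf xstar - mat c) ** perp_proj A"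
  have B: "?B *v v = ?H v - c *\<^sub>R v" for v
    by (simp add: matrix_vector_mult_diff_rdistrib mat_mult_vec)
  have coercive: "(\<mu> - c) * (norm v)\<^sup>2 \<le> (?B *v v) \<bullet> v" for v
    using monotone_derivative_coercive[OF monotone f_hessian, of v xstar]
    by (simp add: B inner_diff_left left_diff_distrib power2_norm_eq_inner)
  have pinv: "perp_proj A ** pseudo_inverse ?G = pseudo_inverse ?G" "?G ** pseudo_inverse ?G = perp_proj A"
    using pseudo_inverse_compression[of "perp_proj A" "\<mu> - c" ?B] coercive \<open>c < \<mu>\<close> by simp_all
  have m: "m = (1 / \<gamma>) *\<^sub>R (pseudo_inverse ?G *v h)"
    by (simp add: m_def lpsa_limit_def c_def h_def flip: matrix_vector_mul_assoc)
  have Pm: "?P m = m"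
    by (simp add: m matrix_vector_mult_scaleR matrix_vector_mul_assoc pinv)
  have "?G *v m = (1 / \<gamma>) *\<^sub>R ?P h"
    by (simp add: m matrix_vector_mult_scaleR matrix_vector_mul_assoc pinv)
  moreover have "?G *v m = ?P (?H m) - c *\<^sub>R m"
    by (simp add: Pm B matrix_vector_mult_diff_distrib matrix_vector_mult_scaleR flip: matrix_vector_mul_assoc)
  ultimately have m_equation: "?P (?H m) - c *\<^sub>R m = (1 / \<gamma>) *\<^sub>R h"
    by (simp add: h_def perp_proj_idem)
  interpret chain: random_projection_chain M D \<zeta> \<omega> step.p step.\<eta> gradF ?P x x1
  proof
    show "(\<lambda>(y, z). gradF y z) \<in> borel_measurable (borel \<Otimes>\<^sub>M D)"
      using F_gradient F_integrable by (intro borel_measurable_gradient[where F = F]) auto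
    show "?P \<in> borel_measurable borel"
      by (intro borel_measurable_continuous_onI linear_continuous_on) simp
    show "x (Suc n) w = (if \<omega> n w then ?P (x n w - step.\<eta> n *\<^sub>R gradF (x n w) (\<zeta> n w))
        else x n w - step.\<eta> n *\<^sub>R gradF (x n w) (\<zeta> n w))" if "1 \<le> n" "w \<in> space M" for n w
      using x_step[OF that] x_half_step[OF that] by (simp add: \<eta>_eq)
    show "distr M (count_space UNIV) (\<omega> n) = measure_pmf (bernoulli_pmf (step.p n))" if "1 \<le> n" for n
      using omega_distr[OF that] by (simp add: p_eq)
  qed (use zeta_measurable zeta_distr omega_measurable indep x_init step.p_bounds in auto)
  \<comment> \<open>A moment of order above two bounds the second moment uniformly.\<close>
  define N where "N = enn2real (1 + (SUP n\<in>{1..}. \<integral>\<^sup>+w. ennreal (norm (\<xi> n w) powr q) \<partial>M))"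
  have noise: "(\<integral>\<^sup>+w. ennreal ((norm (gradf (x n w) - gradF (x n w) (\<zeta> n w)))\<^sup>2) \<partial>M) \<le> ennreal N"
    if n: "1 \<le> n" for n
  proof -
    have "continuous_on UNIV gradf"
      using f_hessian by (intro differentiable_imp_continuous_on) (auto simp: differentiable_on_def differentiable_def)
    then have [measurable]: "gradf \<in> borel_measurable borel" by (rule borel_measurable_continuous_onI)
    note [measurable] = chain.state_measurable(2)[OF n]
    have [measurable]: "(\<lambda>w. gradF (x n w) (\<zeta> n w)) \<in> borel_measurable M"
      using measurable_compose[OF measurable_Pair[OF chain.state_measurable(2)[OF n] zeta_measurable[OF n]]
          chain.G_measurable] by simp
    have [measurable]: "\<xi> n \<in> borel_measurable M" unfolding xi_def[abs_def] by measurable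
    have "(norm v)\<^sup>2 \<le> 1 + norm v powr q" for v :: "real^'d"
    proof (cases "norm v \<le> 1")
      case True
      then have "(norm v)\<^sup>2 \<le> 1" by (simp add: power_le_one)
      then show ?thesis using powr_ge_zero[of "norm v" q] by linarith
    next
      case False
      then have "norm v powr 2 \<le> norm v powr q" using \<open>2 < q\<close> by (intro powr_mono) auto
      then show ?thesis using False by simp
    qed
    then have "(\<integral>\<^sup>+w. ennreal ((norm (\<xi> n w))\<^sup>2) \<partial>M) \<le> (\<integral>\<^sup>+w. 1 + ennreal (norm (\<xi> n w) powr q) \<partial>M)"
      by (intro nn_integral_mono) (simp flip: ennreal_1 ennreal_plus del: ennreal_1)
    also have "\<dots> = 1 + (\<integral>\<^sup>+w. ennreal (norm (\<xi> n w) powr q) \<partial>M)"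
      by (subst nn_integral_add) (auto simp: M.emeasure_space_1)
    also have "\<dots> \<le> 1 + (SUP n\<in>{1..}. \<integral>\<^sup>+w. ennreal (norm (\<xi> n w) powr q) \<partial>M)"
      using n by (intro add_left_mono SUP_upper) auto
    also have "\<dots> = ennreal N"
      unfolding N_def using xi_moment by (intro ennreal_enn2real[symmetric]) (simp add: less_top)
    finally show ?thesis by (simp add: xi_def)
  qed
  interpret lpsa: lpsa_process \<eta>0 \<alpha> \<beta> \<gamma> ?P gradf ?H xstar \<mu> "\<bar>L\<bar>" "\<bar>L'\<bar>" m h M D \<zeta> \<omega> gradF x x1 N
  proof
    show "?P (?H m) - step.\<nu> *\<^sub>R m = (1 / \<gamma>) *\<^sub>R h"
      using m_equation by (simp add: c_def step.\<nu>_def)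
    show "?P xstar = xstar" using feasible by (rule perp_proj_fixes_kernel)
    show "0 \<le> N" by (simp add: N_def)
  qed (simp_all add: monotone lipschitz taylor stationary perp_proj_idem perp_proj_self_adjoint Pm h_def
      matrix_vector_right_distrib matrix_vector_mult_scaleR noise gradF_integrable gradF_unbiased gradF_square_integrable
      \<open>0 < \<mu>\<close> \<open>2 * of_bool (\<alpha> = 1) / \<mu> < \<eta>0\<close> del: of_bool_eq_iff)
  have "\<forall>\<^sub>F n in sequentially.
      (\<integral>\<^sup>+w. ennreal ((norm ((1 / lpsa.\<rho> n) *\<^sub>R (?P (x n w) - xstar) - m))\<^sup>2) \<partial>M)
      = (\<integral>\<^sup>+w. ennreal ((norm (uhat n w - m))\<^sup>2) \<partial>M)"
    using eventually_ge_at_top[of 2]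
  proof eventually_elim
    case (elim n)
    have "lpsa.\<rho> n = \<eta> (n - 1) powr (1 - \<beta>)"
      using \<open>0 < \<gamma>\<close> by (simp add: lpsa.\<rho>_def step.\<kappa>_def \<eta>_eq)
    then have "1 / lpsa.\<rho> n = \<eta> (n - 1) powr (- (1 - \<beta>))"
      by (simp add: powr_minus_divide del: minus_diff_eq)
    then show ?case by (simp add: uhat_def[OF elim] u_def)
  qed
  with lpsa.rescaled_tangent_tendsto show ?thesis by (rule Lim_transform_eventually)
qed

end
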